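(* Let $d\ge 1$ be an integer, let $\mu$ be a doubling measure on $\mathbb{S}^d$, and let $\mathcal{E}=\{E_L\}_{L\ge 1}$ be a sequence of measurable subsets of $\mathbb{S}^d$. Then $\mathcal{E}$ is $L^p(\mu)$-Logvinenko-Sereda for some $1\le p<\infty$ if and only if $\mathcal{E}$ is $\mu$-relatively dense.
   Context: $\mathbb{S}^d$ is the unit sphere of $\mathbb{R}^{d+1}$ with geodesic distance $d(u,v)=\arccos\langle u,v\rangle$, and $B(u,\delta)=\{v\in\mathbb{S}^d: d(u,v)<\delta\}$ is the geodesic ball. $\Pi_L$ is the space of (complex-valued) spherical harmonics of degree at most $L$, i.e. the linear span of $\mathcal{H}_0,\dots,\mathcal{H}_L$, where $\mathcal{H}_\ell$ is the space of restrictions to $\mathbb{S}^d$ of homogeneous harmonic polynomials of degree $\ell$ in $d+1$ variables; equivalently, $\Pi_L$ is the space of restrictions to $\mathbb{S}^d$ of polynomials in $d+1$ variables of degree at most $L$. A doubling measure is a nonzero finite positive Borel measure $\mu$ on $\mathbb{S}^d$ for which there is a constant $C>0$ with $\mu(B(u,2\delta))\le C\mu(B(u,\delta))$ for all $u\in\mathbb{S}^d$ and $\delta>0$. For $1\le p<\infty$, $\mathcal{E}=\{E_L\}_{L\ge1}$ is $L^p(\mu)$-Logvinenko-Sereda if there is a constant $C_p>0$ such that for every $L\ge 1$ and every $Q\in\Pi_L$, $\int_{\mathbb{S}^d}|Q|^p\,d\mu\le C_p\int_{E_L}|Q|^p\,d\mu$. $\mathcal{E}$ is $\mu$-relatively dense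 if there exist $r>0$ and $\varrho>0$ such that for all $L\ge 1$, $$\inf_{u\in\mathbb{S}^d}\frac{\mu(E_L\cap B(u,r/L))}{\mu(B(u,r/L))}\ge\varrho.$$ *)

theory Defs
  imports "HOL-Analysis.Analysis" "HOL-Library.Function_Algebras"
begin

abbreviation unit_sphere :: "(real^'n) set"
  where "unit_sphere \<equiv> sphere 0 1"

definition geodesic_dist :: "real^'n \<Rightarrow> real^'n \<Rightarrow> real"
  where "geodesic_dist u v = arccos (u \<bullet> v)"

definition geodesic_ball :: "real^'n \<Rightarrow> real \<Rightarrow> (real^'n) set"
  where "geodesic_ball u \<delta> = {v \<in> unit_sphere. geodesic_dist u v < \<delta>}"

text \<open>A multi-index is a function \<open>\<alpha> :: 'n \<Rightarrow> nat\<close>; the multi-indices of a given total degree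
  form a finite set, so the sum below is a genuine polynomial expression.\<close>

lemma finite_multi_indices: "finite {\<alpha> :: 'n::finite \<Rightarrow> nat. (\<Sum>i\<in>UNIV. \<alpha> i) = l}"
proof (rule finite_subset)
  show "{\<alpha> :: 'n \<Rightarrow> nat. (\<Sum>i\<in>UNIV. \<alpha> i) = l} \<subseteq> PiE UNIV (\<lambda>_. {..l})"
    by (auto simp: PiE_UNIV_domain intro: member_le_sum)
  show "finite (PiE (UNIV :: 'n set) (\<lambda>_. {..l}))"
    by (intro finite_PiE) auto
qed

definition homogeneous_polys :: "nat \<Rightarrow> (real^'n \<Rightarrow> complex) set"
  where "homogeneous_polys l =
    {P. \<exists>c :: ('n \<Rightarrow> nat) \<Rightarrow> complex. \<forall>x.
       P x = (\<Sum>\<alpha> | (\<Sum>i\<in>UNIV. \<alpha> i) = l. c \<alpha> * (\<Prod>i\<in>UNIV. of_real (x $ i) ^ \<alpha> i))}"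

definition partial_deriv :: "'n \<Rightarrow> (real^'n \<Rightarrow> complex) \<Rightarrow> real^'n \<Rightarrow> complex"
  where "partial_deriv i f x = vector_derivative (\<lambda>t. f (x + t *\<^sub>R axis i 1)) (at 0)"

definition laplacian :: "(real^'n \<Rightarrow> complex) \<Rightarrow> real^'n \<Rightarrow> complex"
  where "laplacian f x = (\<Sum>i\<in>UNIV. partial_deriv i (partial_deriv i f) x)"

text \<open>Functions on the sphere are represented by their extension by zero, so that pointwise
  equality on the sphere is equality and the pointwise operations are those of functions on
  the sphere.\<close>

definition sphere_restrict :: "(real^'n \<Rightarrow> complex) \<Rightarrow> real^'n \<Rightarrow> complex"
  where "sphere_restrict f u = (if u \<in> unit_sphere then f u else 0)"

definition harmonics_of_degree :: "nat \<Rightarrow> (real^'n \<Rightarrow> complex) set"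
  where "harmonics_of_degree l =
    {sphere_restrict P | P. P \<in> homogeneous_polys l \<and> (\<forall>x. laplacian P x = 0)}"

interpretation complex_fun: vector_space "\<lambda>(c::complex) (f :: 'a \<Rightarrow> complex) u. c * f u"
  by unfold_locales (auto simp: fun_eq_iff algebra_simps)

definition spherical_harmonics :: "nat \<Rightarrow> (real^'n \<Rightarrow> complex) set"
  where "spherical_harmonics L = complex_fun.span (\<Union>l\<le>L. harmonics_of_degree l)"

text \<open>Measures on the sphere live on the trace of the Borel sigma-algebra, so that
  \<open>space \<mu> = unit_sphere\<close>.\<close>

definition doubling_measure :: "(real^'n) measure \<Rightarrow> bool"
  where "doubling_measure \<mu> \<longleftrightarrow>
    sets \<mu> = sets (restrict_space borel unit_sphere) \<and>
    finite_measure \<mu> \<and>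
    emeasure \<mu> (space \<mu>) \<noteq> 0 \<and>
    (\<exists>C>0. \<forall>u\<in>unit_sphere. \<forall>\<delta>>0.
       measure \<mu> (geodesic_ball u (2 * \<delta>)) \<le> C * measure \<mu> (geodesic_ball u \<delta>))"

definition Logvinenko_Sereda ::
    "(real^'n) measure \<Rightarrow> real \<Rightarrow> (nat \<Rightarrow> (real^'n) set) \<Rightarrow> bool"
  where "Logvinenko_Sereda \<mu> p E \<longleftrightarrow>
    (\<exists>C>0. \<forall>L\<ge>1. \<forall>Q\<in>spherical_harmonics L.
       (LINT u|\<mu>. norm (Q u) powr p) \<le> C * (LINT u:E L|\<mu>. norm (Q u) powr p))"

definition relatively_dense :: "(real^'n) measure \<Rightarrow> (nat \<Rightarrow> (real^'n) set) \<Rightarrow> bool"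
  where "relatively_dense \<mu> E \<longleftrightarrow>
    (\<exists>r>0. \<exists>\<rho>>0. \<forall>L\<ge>1.
       (INF u\<in>unit_sphere. measure \<mu> (E L \<inter> geodesic_ball u (r / real L))
                             / measure \<mu> (geodesic_ball u (r / real L))) \<ge> \<rho>)"

end

theory Submission
  imports Defs "HOL-Complex_Analysis.Conformal_Mappings"
begin

text \<open>Everything is done with chordal caps, which are comparable with geodesic balls.

  From Logvinenko--Sereda to density one tests with powers of Fejer kernels \<open>K (u \<bullet> v)\<close>: such a
  zonal polynomial is bounded below on a cap of radius of order \<open>1 / L\<close> at \<open>u\<close>, and it decays so fast that its integral
  outside a large multiple of this cap is negligible.

  For the converse \<open>p = 1\<close> suffices. The Peetre maximal function
  \<open>P u = sup\<^sub>v \<bar>Q v\<bar> / (1 + L \<bar>u - v\<bar>)\<^sup>N\<close> controls all rotational derivatives of \<open>Q\<close> by Bernstein's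
  inequality along great circles, is nearly constant on caps of radius \<open>1 / L\<close>, and satisfies
  \<open>\<integral>P d\<mu> \<le> C \<integral>\<bar>Q\<bar> d\<mu>\<close>. Hence density of \<open>E\<close> with respect to \<open>\<mu>\<close> gives density with respect to
  \<open>P \<mu>\<close>, and it remains to see that \<open>{\<bar>Q\<bar> < \<epsilon> P}\<close> has small \<open>P \<mu>\<close>-measure. At a point of this
  set either all derivatives up to a high order are small, in which case Taylor's formula forces the supremum
  defining \<open>P\<close> to be attained far away, and such points carry little mass; or some derivative of order
  \<open>k\<close> is small while one of order \<open>k + 1\<close> is not, and then doubling makes the set thin.\<close>

subsection \<open>Fejer kernels and Bernstein's inequality\<close>

text \<open>A doubling measure may be singular with respect to surface measure, so a bound on the
  surface area of a sublevel set of \<open>Q\<close> says nothing about its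
  \<open>\<mu>\<close>-mass. All that is used of \<open>\<mu>\<close> is the comparison of caps,
  while \<open>Q\<close> enters through pointwise estimates at scale \<open>1 / L\<close>. This is
  why thinness is obtained by counting disjoint shells, each shown to be heavy by a Vitali covering,
  and not by computing a volume.

  Rotational derivatives suit this scheme: they keep the degree \<open>L\<close>, exist globally,
  and along any great circle the derivative is a combination of them with constant coefficients, so
  that they can be iterated.

  Two exponents occur in the converse. The condition \<open>2 * D \<le> 2 ^ N\<close> makes the
  weight with exponent \<open>N\<close> integrable with the right size; the reference measure uses
  \<open>2 * N\<close>, and the quotient of the two weights gains \<open>(1 + R) ^ N\<close> at
  distance \<open>R / L\<close>. The constants depend on each other in one direction: density and
  doubling give \<open>K\<close>, this gives \<open>R\<close>, then the order \<open>m\<close> and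
  the threshold \<open>\<delta>\<close> of the derivatives, and finally
  \<open>\<epsilon>\<close>.\<close>

fun cheb :: "nat \<Rightarrow> real poly" where
  "cheb 0 = 1"
| "cheb (Suc 0) = [:0, 1:]"
| "cheb (Suc (Suc k)) = [:0, 2:] * cheb (Suc k) - cheb k"

definition dirichlet_poly :: "nat \<Rightarrow> real poly" where
  "dirichlet_poly i = 1 + smult 2 (\<Sum>k=1..i. cheb k)"

text \<open>The variable is \<open>x = cos t\<close>. The factor normalises the value at
  \<open>x = 1\<close> to 1, because the Dirichlet kernels there are the odd numbers
  \<open>1 + 2 * i\<close>, whose sum is \<open>(real m)\<^sup>2\<close>.\<close>

definition fejer_poly :: "nat \<Rightarrow> real poly" where
  "fejer_poly m = smult (1 / (real m)\<^sup>2) (\<Sum>i<m. dirichlet_poly i)"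

lemma degree_cheb: "degree (cheb k) \<le> k"
proof (induction k rule: cheb.induct)
  case (3 k)
  have "degree ([:0, 2:] * cheb (Suc k)) \<le> 1 + Suc k"
    using degree_mult_le[of "[:0, 2:]" "cheb (Suc k)"] 3 by simp
  then show ?case using 3 by (auto intro!: degree_diff_le)
qed auto

lemma poly_cheb_cos: "poly (cheb k) (cos t) = cos (real k * t)"
proof (induction k rule: cheb.induct)
  case (3 k)
  have "cos (real (Suc (Suc k)) * t) = 2 * cos t * cos (real (Suc k) * t) - cos (real k * t)"
    using cos_add[of "real (Suc k) * t" t] cos_diff[of "real (Suc k) * t" t]
    by (simp add: algebra_simps)
  then show ?case using 3 by simp
qed auto

lemma poly_cheb_1 [simp]: "poly (cheb k) 1 = 1"
  using poly_cheb_cos[of k 0] by simp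

lemma abs_poly_cheb_le: "\<bar>x\<bar> \<le> 1 \<Longrightarrow> \<bar>poly (cheb k) x\<bar> \<le> 1"
  using poly_cheb_cos[of k "arccos x"] cos_arccos_abs[of x] by (metis abs_cos_le_one)

lemma degree_fejer_poly: "degree (fejer_poly m) \<le> m - 1"
proof -
  have "degree (dirichlet_poly i) \<le> i" for i
    unfolding dirichlet_poly_def
    by (intro degree_add_le order.trans[OF degree_smult_le] degree_sum_le)
       (auto intro: order.trans[OF degree_cheb])
  note deg = this
  have "degree (\<Sum>i<m. dirichlet_poly i) \<le> m - 1"
  proof (intro degree_sum_le finite_lessThan)
    fix i assume "i \<in> {..<m}"
    then have "i \<le> m - 1" by auto
    then show "degree (dirichlet_poly i) \<le> m - 1" using deg[of i] by linarith
  qed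
  then show ?thesis
    unfolding fejer_poly_def by (meson degree_smult_le order.trans)
qed

lemma dirichlet_poly_eq:
  "(1 - x) * poly (dirichlet_poly i) x = poly (cheb i) x - poly (cheb (Suc i)) x"
proof (induction i)
  case 0
  then show ?case by (simp add: dirichlet_poly_def)
next
  case (Suc i)
  have "dirichlet_poly (Suc i) = dirichlet_poly i + smult 2 (cheb (Suc i))"
    by (simp add: dirichlet_poly_def smult_add_right)
  then have "(1 - x) * poly (dirichlet_poly (Suc i)) x
      = (1 - x) * poly (dirichlet_poly i) x + (1 - x) * (2 * poly (cheb (Suc i)) x)"
    by (simp add: algebra_simps)
  then show ?case
    unfolding Suc by (simp add: algebra_simps)
qed

lemma abs_dirichlet_poly_le:
  assumes "\<bar>x\<bar> \<le> 1" shows "\<bar>poly (dirichlet_poly i) x\<bar> \<le> 1 + 2 * real i"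
proof -
  have "\<bar>\<Sum>k=1..i. poly (cheb k) x\<bar> \<le> (\<Sum>k=1..i. 1)"
    using assms by (intro order.trans[OF sum_abs] sum_mono abs_poly_cheb_le)
  then show ?thesis
    by (simp add: dirichlet_poly_def poly_sum)
qed

lemma sum_odd_real: "(\<Sum>i<m. 1 + 2 * real i) = (real m)\<^sup>2"
  by (induction m) (auto simp: power2_eq_square algebra_simps)

lemma abs_sum_dirichlet_le:
  assumes "\<bar>x\<bar> \<le> 1" shows "\<bar>\<Sum>i<m. poly (dirichlet_poly i) x\<bar> \<le> (real m)\<^sup>2"
proof -
  have "\<bar>\<Sum>i<m. poly (dirichlet_poly i) x\<bar> \<le> (\<Sum>i<m. 1 + 2 * real i)"
    using assms by (intro order.trans[OF sum_abs] sum_mono abs_dirichlet_poly_le)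
  then show ?thesis by (simp add: sum_odd_real)
qed

text \<open>The identity for a single Dirichlet kernel telescopes. As \<open>cheb m\<close> is
  bounded by 1 on the interval, this closed form yields both the positivity and the decay of the
  Fejer kernel.\<close>

lemma sum_dirichlet_eq:
  "(1 - x) * (\<Sum>i<m. poly (dirichlet_poly i) x) = 1 - poly (cheb m) x"
  using sum_lessThan_telescope'[of "\<lambda>i. poly (cheb i) x" m]
  by (simp add: sum_distrib_left dirichlet_poly_eq)

lemma poly_fejer: "poly (fejer_poly m) x = (\<Sum>i<m. poly (dirichlet_poly i) x) / (real m)\<^sup>2"
  by (simp add: fejer_poly_def poly_sum)

lemma poly_fejer_1:
  assumes "m \<ge> 1" shows "poly (fejer_poly m) 1 = 1"
proof -
  have "poly (dirichlet_poly i) 1 = 1 + 2 * real i" for i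
    by (simp add: dirichlet_poly_def poly_sum)
  then show ?thesis using assms by (simp add: poly_fejer sum_odd_real)
qed

lemma poly_fejer_le_1:
  assumes "m \<ge> 1" "\<bar>x\<bar> \<le> 1" shows "poly (fejer_poly m) x \<le> 1"
  using abs_sum_dirichlet_le[OF assms(2), of m] assms(1) by (simp add: poly_fejer)

lemma poly_fejer_nonneg:
  assumes "m \<ge> 1" "\<bar>x\<bar> \<le> 1" shows "poly (fejer_poly m) x \<ge> 0"
proof (cases "x = 1")
  case True then show ?thesis using poly_fejer_1 assms by simp
next
  case False
  then have "1 - x > 0" using assms by auto
  moreover have "(1 - x) * (\<Sum>i<m. poly (dirichlet_poly i) x) \<ge> 0"
    unfolding sum_dirichlet_eq using abs_poly_cheb_le[OF assms(2), of m] by auto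
  ultimately show ?thesis
    by (simp add: poly_fejer zero_le_mult_iff)
qed

lemma poly_fejer_decay:
  assumes "m \<ge> 1" "\<bar>x\<bar> \<le> 1" shows "(1 - x) * (real m)\<^sup>2 * poly (fejer_poly m) x \<le> 2"
proof -
  have "(1 - x) * (real m)\<^sup>2 * poly (fejer_poly m) x = 1 - poly (cheb m) x"
    using assms(1) by (simp add: poly_fejer flip: sum_dirichlet_eq)
  then show ?thesis using abs_poly_cheb_le[OF assms(2), of m] by auto
qed

text \<open>The closed form with \<open>k\<close> in place of \<open>m\<close> bounds the distance
  of \<open>cheb k\<close> from 1. The lower bound \<open>c\<close> is the same for all
  \<open>k \<le> m\<close>, and since \<open>c \<le> 1\<close> it also bounds the constant term of
  each Dirichlet kernel, so it survives the averaging; it may be negative.\<close>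

lemma poly_fejer_lower:
  assumes "m \<ge> 1" "\<bar>x\<bar> \<le> 1" shows "poly (fejer_poly m) x \<ge> 1 - (real m)\<^sup>2 * (1 - x)"
proof -
  have cheb: "poly (cheb k) x \<ge> 1 - (real m)\<^sup>2 * (1 - x)" if "k \<le> m" for k
  proof -
    have "1 - poly (cheb k) x \<le> (1 - x) * (real k)\<^sup>2"
      unfolding sum_dirichlet_eq[symmetric]
      using abs_sum_dirichlet_le[OF assms(2), of k] assms by (intro mult_left_mono) auto
    also have "\<dots> \<le> (1 - x) * (real m)\<^sup>2"
      using that assms by (intro mult_left_mono power_mono) auto
    finally show ?thesis by (simp add: algebra_simps)
  qed
  define c where "c = 1 - (real m)\<^sup>2 * (1 - x)"
  have c1: "c \<le> 1" using assms by (simp add: c_def)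
  have dir: "poly (dirichlet_poly i) x \<ge> c * (1 + 2 * real i)" if "i < m" for i
  proof -
    have "(\<Sum>k=1..i. c) \<le> (\<Sum>k=1..i. poly (cheb k) x)"
      using that cheb by (intro sum_mono) (auto simp: c_def)
    then show ?thesis using c1 by (simp add: dirichlet_poly_def poly_sum algebra_simps)
  qed
  have "c * (real m)\<^sup>2 \<le> (\<Sum>i<m. poly (dirichlet_poly i) x)"
    unfolding sum_odd_real[symmetric] sum_distrib_left using dir by (intro sum_mono) auto
  then show ?thesis using assms(1) by (simp add: poly_fejer c_def field_simps)
qed

text \<open>A Laurent polynomial in \<open>cis t\<close> with exponents between \<open>-n\<close>
  and \<open>n\<close> is stored as an ordinary polynomial, so that the maximum principle and
  Cauchy's inequality apply to \<open>q\<close>.\<close>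

definition trig_poly :: "nat \<Rightarrow> (real \<Rightarrow> complex) \<Rightarrow> bool" where
  "trig_poly n T \<longleftrightarrow> (\<exists>q. degree q \<le> 2 * n \<and> (\<forall>t. T t = cis (- (real n * t)) * poly q (cis t)))"

lemma trig_polyI:
  "degree q \<le> 2 * n \<Longrightarrow> (\<And>t. T t = cis (- (real n * t)) * poly q (cis t)) \<Longrightarrow> trig_poly n T"
  unfolding trig_poly_def by blast

lemma trig_poly_mult:
  assumes "trig_poly n T" "trig_poly m U" shows "trig_poly (n + m) (\<lambda>t. T t * U t)"
proof -
  obtain p where p: "degree p \<le> 2 * n" "\<And>t. T t = cis (- (real n * t)) * poly p (cis t)"
    using assms(1) unfolding trig_poly_def by blast
  obtain q where q: "degree q \<le> 2 * m" "\<And>t. U t = cis (- (real m * t)) * poly q (cis t)"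
    using assms(2) unfolding trig_poly_def by blast
  have "cis (- (real (n + m) * t)) = cis (- (real n * t)) * cis (- (real m * t))" for t
    by (simp add: cis_mult algebra_simps)
  then show ?thesis
    using p q degree_mult_le[of p q] by (intro trig_polyI[of "p * q"]) auto
qed

lemma trig_poly_mono:
  assumes "trig_poly n T" "n \<le> m" shows "trig_poly m T"
proof -
  obtain p where p: "degree p \<le> 2 * n" "\<And>t. T t = cis (- (real n * t)) * poly p (cis t)"
    using assms(1) unfolding trig_poly_def by blast
  have "cis (- (real n * t)) = cis (- (real m * t)) * cis t ^ (m - n)" for t
  proof -
    have "- (real n * t) = - (real m * t) + real (m - n) * t"
      using assms(2) by (simp add: of_nat_diff algebra_simps)
    then show ?thesis by (simp only: Complex.DeMoivre cis_mult)
  qed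
  moreover have "degree (monom 1 (m - n) * p) \<le> 2 * m"
    using degree_mult_le[of "monom 1 (m - n)" p] degree_monom_le[of "1::complex" "m - n"] p(1) assms(2)
    by linarith
  ultimately show ?thesis
    using p(2) by (intro trig_polyI[of "monom 1 (m - n) * p"]) (auto simp: poly_monom)
qed

lemma trig_poly_add:
  assumes "trig_poly n T" "trig_poly n U" shows "trig_poly n (\<lambda>t. T t + U t)"
proof -
  obtain p where p: "degree p \<le> 2 * n" "\<And>t. T t = cis (- (real n * t)) * poly p (cis t)"
    using assms(1) unfolding trig_poly_def by blast
  obtain q where q: "degree q \<le> 2 * n" "\<And>t. U t = cis (- (real n * t)) * poly q (cis t)"
    using assms(2) unfolding trig_poly_def by blast
  show ?thesis
    using p q by (intro trig_polyI[of "p + q"]) (auto intro: degree_add_le simp: algebra_simps)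
qed

lemma trig_poly_const: "trig_poly n (\<lambda>t. c)"
  by (rule trig_poly_mono[of 0]) (auto intro!: trig_polyI[of "[:c:]"])

text \<open>A coordinate function restricted to a great circle has this form; through products and
  sums, polynomials of degree \<open>L\<close> become trigonometric polynomials of degree
  \<open>L\<close>.\<close>

lemma trig_poly_cos_sin: "trig_poly 1 (\<lambda>t. of_real (a * cos t + b * sin t))"
proof (rule trig_polyI)
  let ?A = "Complex (a / 2) (b / 2)" and ?B = "Complex (a / 2) (- b / 2)"
  show "degree [:?A, 0, ?B:] \<le> 2 * 1" by simp
  have cc: "cis (- (real 1 * t)) * cis t = 1" for t by (simp add: cis_mult)
  show "of_real (a * cos t + b * sin t) = cis (- (real 1 * t)) * poly [:?A, 0, ?B:] (cis t)" for t
  proof -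
    have "cis (- (real 1 * t)) * poly [:?A, 0, ?B:] (cis t)
        = cis (- (real 1 * t)) * ?A + (cis (- (real 1 * t)) * cis t) * (cis t * ?B)"
      by (simp add: algebra_simps)
    then show ?thesis unfolding cc by (simp add: complex_eq_iff algebra_simps)
  qed
qed

lemma trig_poly_power: "trig_poly n T \<Longrightarrow> trig_poly (k * n) (\<lambda>t. T t ^ k)"
  by (induction k) (auto intro: trig_poly_const trig_poly_mult)

lemma trig_poly_poly_cos:
  fixes p :: "real poly"
  shows "degree p \<le> n \<Longrightarrow> trig_poly n (\<lambda>t. of_real (poly p (cos t)))"
proof (induction p arbitrary: n)
  case 0
  then show ?case by (simp add: trig_poly_const)
next
  case (pCons a p)
  show ?case
  proof (cases "p = 0")
    case True then show ?thesis by (simp add: trig_poly_const)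
  next
    case False
    then obtain k where n: "n = Suc k" and k: "degree p \<le> k"
      using pCons.prems by (cases n) auto
    have "trig_poly (1 + k) (\<lambda>t. of_real (1 * cos t + 0 * sin t) * of_real (poly p (cos t)))"
      by (intro trig_poly_mult trig_poly_cos_sin pCons.IH k)
    then have "trig_poly n (\<lambda>t. of_real (cos t) * of_real (poly p (cos t)))"
      using n by simp
    from trig_poly_add[OF trig_poly_const this, of "of_real a"] show ?thesis by simp
  qed
qed

section \<open>Growth off the unit disc and Bernstein's inequality\<close>

lemma max_modulus_unit_disc:
  fixes q :: "complex poly"
  assumes "\<And>z. norm z = 1 \<Longrightarrow> norm (poly q z) \<le> M" "norm z \<le> 1"
  shows "norm (poly q z) \<le> M"
proof (rule maximum_modulus_frontier[where S = "cball 0 1" and f = "poly q"])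
  show "norm (poly q w) \<le> M" if "w \<in> frontier (cball 0 1)" for w
    using that assms(1) by simp
qed (use assms(2) in \<open>auto intro: holomorphic_intros continuous_intros\<close>)

text \<open>The reflected polynomial has the same modulus bound on the unit circle, and its values
  inside the disc are those of \<open>q\<close> outside, divided by a power of \<open>z\<close>;
  hence the maximum principle applies to it.\<close>

lemma poly_growth_outside_unit_disc:
  fixes q :: "complex poly"
  assumes M: "\<And>z. norm z = 1 \<Longrightarrow> norm (poly q z) \<le> M" and d: "degree q \<le> k" and R: "norm z \<le> R" "R \<ge> 1"
  shows "norm (poly q z) \<le> M * R ^ k"
proof (cases "norm z \<le> 1")
  case True
  have "0 \<le> M" using order.trans[OF norm_ge_zero M[of 1]] by simp
  then have "M * 1 \<le> M * R ^ k" using R by (intro mult_left_mono one_le_power) auto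
  then show ?thesis using max_modulus_unit_disc[OF M True] by simp
next
  case False
  then have z: "z \<noteq> 0" "norm (1 / z) \<le> 1" by (auto simp: norm_divide divide_le_eq_1)
  have refl: "norm (poly (reflect_poly q) w) \<le> M" if "norm w = 1" for w
  proof -
    have "w \<noteq> 0" using that by auto
    then show ?thesis
      using M[of "inverse w"] that by (simp add: poly_reflect_poly_nz norm_mult norm_power norm_inverse)
  qed
  have "norm (poly (reflect_poly q) (1 / z)) \<le> M"
    using refl z(2) by (rule max_modulus_unit_disc)
  then have "norm (poly q z) \<le> M * norm z ^ degree q"
    using z by (simp add: poly_reflect_poly_nz norm_mult norm_power norm_divide field_simps)
  also have "\<dots> \<le> M * R ^ k"
  proof (rule mult_left_mono)
    have "norm z ^ degree q \<le> norm z ^ k" using False d by (intro power_increasing) auto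
    also have "\<dots> \<le> R ^ k" using R by (intro power_mono) auto
    finally show "norm z ^ degree q \<le> R ^ k" .
    show "0 \<le> M" using order.trans[OF norm_ge_zero M[of 1]] by simp
  qed
  finally show ?thesis .
qed

text \<open>Cauchy's inequality is used on the circle of radius \<open>1 / n\<close> around 1, where
  \<open>q\<close> has grown by at most \<open>(1 + 1 / n) ^ (2 * n) \<le> 9\<close>. The constant
  10 is this 9 plus 1 from differentiating the factor \<open>cis (- (n * t))\<close>.\<close>

lemma bernstein_at_0:
  assumes T: "trig_poly n T" and n: "n \<ge> 1" and M: "\<And>t. norm (T t) \<le> M"
    and D: "(T has_vector_derivative T') (at 0)"
  shows "norm T' \<le> 10 * real n * M"
proof -
  obtain q where q: "degree q \<le> 2 * n" "\<And>t. T t = cis (- (real n * t)) * poly q (cis t)"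
    using T unfolding trig_poly_def by blast
  have M0: "0 \<le> M" using order.trans[OF norm_ge_zero M[of 0]] .
  have circ: "norm (poly q z) \<le> M" if "norm z = 1" for z
  proof -
    have "z = cis (Arg z)" using that rcis_cmod_Arg[of z] by (simp add: rcis_def)
    then show ?thesis using M[of "Arg z"] q(2)[of "Arg z"] by (simp add: norm_mult)
  qed
  have e9: "(1 + 1 / real n) ^ (2 * n) \<le> 9"
  proof -
    have "(1 + 1 / real n) ^ n \<le> exp (1 / real n) ^ n"
      by (intro power_mono exp_ge_add_one_self) auto
    also have "\<dots> = exp 1" using n by (simp flip: exp_of_nat_mult)
    also have "\<dots> \<le> 3" using exp_le by simp
    finally have "((1 + 1 / real n) ^ n)\<^sup>2 \<le> 3\<^sup>2" by (intro power_mono) auto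
    then show ?thesis by (simp add: power_even_eq)
  qed
  have "norm ((deriv ^^ 1) (poly q) 1) \<le> fact 1 * (9 * M) / (1 / real n) ^ 1"
  proof (rule Cauchy_inequality)
    fix x :: complex assume "norm (1 - x) = 1 / real n"
    then have "norm x \<le> 1 + 1 / real n"
      using norm_triangle_ineq4[of 1 "1 - x"] by simp
    from poly_growth_outside_unit_disc[OF circ q(1) this]
    have "norm (poly q x) \<le> M * (1 + 1 / real n) ^ (2 * n)" by simp
    also have "\<dots> \<le> M * 9" using e9 M0 by (intro mult_left_mono)
    finally show "norm (poly q x) \<le> 9 * M" by simp
  qed (use n in \<open>auto intro!: holomorphic_intros continuous_intros\<close>)
  moreover have "(deriv ^^ 1) (poly q) 1 = poly (pderiv q) 1"
    by (simp add: DERIV_imp_deriv poly_DERIV)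
  ultimately have q': "norm (poly (pderiv q) 1) \<le> 9 * real n * M" by (simp add: algebra_simps)
  have cis': "((\<lambda>t. cis (c * t)) has_vector_derivative (\<i> * of_real c)) (at 0)" for c
  proof -
    have "((\<lambda>t. cis (c * t)) has_derivative (\<lambda>h. (c * h) *\<^sub>R (\<i> * cis (c * 0)))) (at 0)"
      by (intro has_derivative_cis has_derivative_mult_right has_derivative_ident)
    then show ?thesis by (simp add: has_vector_derivative_def scaleR_conv_of_real mult_ac)
  qed
  have dT: "((\<lambda>t. cis ((- real n) * t) * poly q (cis (1 * t))) has_vector_derivative
      (cis ((- real n) * 0) * (\<i> * of_real 1 * poly (pderiv q) (cis (1 * 0))) + (\<i> * of_real (- real n)) * poly q (cis (1 * 0)))) (at 0)"
  proof (rule has_vector_derivative_mult)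
    show "((\<lambda>t. cis ((- real n) * t)) has_vector_derivative \<i> * of_real (- real n)) (at 0)"
      by (rule cis')
    show "((\<lambda>t. poly q (cis (1 * t))) has_vector_derivative \<i> * of_real 1 * poly (pderiv q) (cis (1 * 0))) (at 0)"
      using field_vector_diff_chain_at[OF cis'[of 1], of "poly q" "poly (pderiv q) (cis (1 * 0))"]
      by (simp add: o_def poly_DERIV)
  qed
  then have "(T has_vector_derivative (\<i> * poly (pderiv q) 1 - \<i> * of_real n * poly q 1)) (at 0)"
  proof -
    have "T = (\<lambda>t. cis ((- real n) * t) * poly q (cis (1 * t)))" using q(2) by (simp add: fun_eq_iff)
    then show ?thesis using dT by (simp add: algebra_simps)
  qed
  then have "T' = \<i> * poly (pderiv q) 1 - \<i> * of_real n * poly q 1"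
    using D vector_derivative_unique_at by blast
  then have "norm T' \<le> norm (poly (pderiv q) 1) + real n * norm (poly q 1)"
    by (metis (no_types, lifting) norm_triangle_ineq4 norm_mult norm_ii mult_1 norm_of_nat of_real_of_nat_eq)
  also have "\<dots> \<le> 9 * real n * M + real n * M"
    using q' circ[of 1] by (intro add_mono mult_left_mono) auto
  finally show ?thesis by (simp add: algebra_simps)
qed

text \<open>Multiplying \<open>T\<close> by a power of the Fejer kernel does not change \<open>T' 0\<close>, because the kernel is
  even and equals 1 at 0; its decay absorbs the polynomial growth allowed for \<open>T\<close>.\<close>

lemma weighted_bernstein_at_0:
  assumes T: "trig_poly L T" and L: "L \<ge> 1"
    and M: "\<And>t. norm (T t) \<le> M * (1 + real L * sqrt (2 * (1 - cos t))) ^ N"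
    and D: "(T has_vector_derivative T') (at 0)"
  shows "norm T' \<le> 10 * real (Suc N) * 3 ^ N * real L * M"
proof -
  define K where "K t = poly (fejer_poly L) (cos t)" for t
  have M0: "0 \<le> M" using order.trans[OF norm_ge_zero M[of 0]] by simp
  have K: "0 \<le> K t" "K t \<le> 1" for t
    unfolding K_def using poly_fejer_nonneg poly_fejer_le_1 L by auto
  have K0: "K 0 = 1" using poly_fejer_1 L by (simp add: K_def)
  \<comment> \<open>With \<open>s\<close> the scaled chord, \<open>K t * s \<le> 2\<close> follows
    from \<open>K t \<le> 1\<close> for small \<open>s\<close> and from the quadratic decay for
    large \<open>s\<close>; the remaining 1 is the bound of \<open>K t\<close> itself.\<close>
  have KM: "K t * (1 + real L * sqrt (2 * (1 - cos t))) \<le> 3" for t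
  proof -
    define s where "s = real L * sqrt (2 * (1 - cos t))"
    have s0: "s \<ge> 0" by (simp add: s_def)
    have "s\<^sup>2 = 2 * ((1 - cos t) * (real L)\<^sup>2)" by (simp add: s_def power_mult_distrib)
    then have Ks: "K t * s\<^sup>2 \<le> 4"
      using poly_fejer_decay[OF L, of "cos t"] by (simp add: K_def mult_ac)
    have "K t * s \<le> 2"
    proof (cases "s \<le> 2")
      case True then show ?thesis using K[of t] s0 mult_mono[of "K t" 1 s 2] by simp
    next
      case False
      then have "2 * (K t * s) \<le> s * (K t * s)" using K s0 by (intro mult_right_mono) auto
      then show ?thesis using Ks by (simp add: power2_eq_square algebra_simps)
    qed
    then show ?thesis using K(2)[of t] by (simp add: s_def algebra_simps)
  qed
  define P where "P t = T t * of_real (K t) ^ N" for t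
  have "trig_poly L (\<lambda>t. of_real (K t))" unfolding K_def
    by (rule trig_poly_poly_cos) (use degree_fejer_poly[of L] in simp)
  then have "trig_poly (L + N * L) P" unfolding P_def by (intro trig_poly_mult trig_poly_power T)
  then have tp: "trig_poly (Suc N * L) P" by simp
  have bd: "norm (P t) \<le> 3 ^ N * M" for t
  proof -
    have "norm (P t) = norm (T t) * K t ^ N" using K by (simp add: P_def norm_mult norm_power)
    also have "\<dots> \<le> (M * (1 + real L * sqrt (2 * (1 - cos t))) ^ N) * K t ^ N"
      using M K by (intro mult_right_mono) auto
    also have "\<dots> = M * (K t * (1 + real L * sqrt (2 * (1 - cos t)))) ^ N"
      by (simp add: power_mult_distrib)
    also have "\<dots> \<le> M * 3 ^ N"
      using KM K M0 by (intro mult_left_mono power_mono) (auto intro!: mult_nonneg_nonneg)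
    finally show ?thesis by (simp add: algebra_simps)
  qed
  have "((\<lambda>t. of_real (K t)) has_vector_derivative (of_real (poly (pderiv (fejer_poly L)) (cos 0) * (- sin 0)) :: complex)) (at 0)"
    unfolding K_def
    by (intro has_vector_derivative_of_real DERIV_chain2[OF poly_DERIV]) 
       (auto intro!: derivative_eq_intros)
  then have dK: "((\<lambda>t. of_real (K t)) has_vector_derivative (0 :: complex)) (at 0)" by simp
  have "((\<lambda>t. of_real (K t) ^ k) has_vector_derivative (0 :: complex)) (at 0)" for k
  proof (induction k)
    case (Suc k)
    from has_vector_derivative_mult[OF dK this] show ?case by simp
  qed simp
  then have "(P has_vector_derivative (T 0 * 0 + T' * of_real (K 0) ^ N)) (at 0)"
    unfolding P_def by (intro has_vector_derivative_mult D)
  then have dP: "(P has_vector_derivative T') (at 0)" by (simp add: K0)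
  show ?thesis
    using bernstein_at_0[OF tp _ bd dP] L by (simp add: algebra_simps)
qed

subsection \<open>Zonal spherical harmonics\<close>

abbreviation multi_indices :: "nat \<Rightarrow> ('n::finite \<Rightarrow> nat) set" where
  "multi_indices l \<equiv> {\<alpha>. (\<Sum>i\<in>UNIV. \<alpha> i) = l}"

definition monomial :: "('n::finite \<Rightarrow> nat) \<Rightarrow> real^'n \<Rightarrow> complex" where
  "monomial \<alpha> x = (\<Prod>i\<in>UNIV. of_real (x $ i) ^ \<alpha> i)"

lemma homogeneous_polys_iff:
  "P \<in> homogeneous_polys l \<longleftrightarrow> (\<exists>c. \<forall>x. P x = (\<Sum>\<alpha>\<in>multi_indices l. c \<alpha> * monomial \<alpha> x))"
  by (simp add: homogeneous_polys_def monomial_def)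

lemma homogeneous_polys_add:
  assumes "P \<in> homogeneous_polys l" "Q \<in> homogeneous_polys l"
  shows "(\<lambda>x. P x + Q x) \<in> homogeneous_polys l"
proof -
  obtain c where "\<And>x. P x = (\<Sum>\<alpha>\<in>multi_indices l. c \<alpha> * monomial \<alpha> x)"
    using assms(1) unfolding homogeneous_polys_iff by blast
  moreover obtain d where "\<And>x. Q x = (\<Sum>\<alpha>\<in>multi_indices l. d \<alpha> * monomial \<alpha> x)"
    using assms(2) unfolding homogeneous_polys_iff by blast
  ultimately show ?thesis unfolding homogeneous_polys_iff
    by (intro exI[of _ "\<lambda>\<alpha>. c \<alpha> + d \<alpha>"]) (simp add: algebra_simps sum.distrib)
qed

lemma homogeneous_polys_scale:
  assumes "P \<in> homogeneous_polys l" shows "(\<lambda>x. a * P x) \<in> homogeneous_polys l"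
proof -
  obtain c where "\<And>x. P x = (\<Sum>\<alpha>\<in>multi_indices l. c \<alpha> * monomial \<alpha> x)"
    using assms(1) unfolding homogeneous_polys_iff by blast
  then show ?thesis unfolding homogeneous_polys_iff
    by (intro exI[of _ "\<lambda>\<alpha>. a * c \<alpha>"]) (simp add: mult.assoc sum_distrib_left)
qed

lemma homogeneous_polys_sum:
  assumes "\<And>k. k \<in> A \<Longrightarrow> P k \<in> homogeneous_polys l"
  shows "(\<lambda>x. \<Sum>k\<in>A. P k x) \<in> homogeneous_polys l"
  using assms
proof (induction A rule: infinite_finite_induct)
  case (insert k A)
  then show ?case by (simp add: homogeneous_polys_add)
qed (auto simp: homogeneous_polys_iff intro!: exI[of _ "\<lambda>_. 0"])

lemma homogeneous_polys_const: "(\<lambda>x. a) \<in> homogeneous_polys 0"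
proof -
  have *: "{\<alpha> :: 'a::finite \<Rightarrow> nat. (\<Sum>i\<in>UNIV. \<alpha> i) = 0} = {\<lambda>_. 0}"
    by (auto simp: fun_eq_iff)
  show ?thesis unfolding homogeneous_polys_iff *
    by (intro exI[of _ "\<lambda>_. a"]) (simp add: monomial_def)
qed

lemma homogeneous_polys_coord_mult:
  assumes "P \<in> homogeneous_polys l"
  shows "(\<lambda>x. of_real (x $ i) * P x) \<in> homogeneous_polys (Suc l)"
proof -
  obtain c where c: "\<And>x. P x = (\<Sum>\<alpha>\<in>multi_indices l. c \<alpha> * monomial \<alpha> x)"
    using assms(1) unfolding homogeneous_polys_iff by blast
  define up :: "('a \<Rightarrow> nat) \<Rightarrow> 'a \<Rightarrow> nat" where "up \<alpha> = \<alpha>(i := Suc (\<alpha> i))" for \<alpha>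
  \<comment> \<open>Multi-indices with \<open>\<alpha> i = 0\<close> lie outside the image of
    \<open>up\<close>; the value 0 there lets the sum be extended to all multi-indices of the new
    degree.\<close>
  define c' where "c' \<alpha> = (if \<alpha> i = 0 then 0 else c (\<alpha>(i := \<alpha> i - 1)))" for \<alpha>
  have sum_up: "(\<Sum>k\<in>UNIV. up \<alpha> k) = Suc (\<Sum>k\<in>UNIV. \<alpha> k)" for \<alpha>
    by (simp add: up_def sum.remove[of UNIV i])
  have mon_up: "monomial (up \<alpha>) x = of_real (x $ i) * monomial \<alpha> x" for \<alpha> x
    by (simp add: up_def monomial_def prod.remove[of UNIV i] mult.assoc)
  have inj: "inj_on up A" for A
  proof (rule inj_onI)
    fix \<alpha> \<beta> assume "up \<alpha> = up \<beta>"
    then have "up \<alpha> k = up \<beta> k" for k by simp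
    then have "\<alpha> k = \<beta> k" for k unfolding up_def by (metis fun_upd_other fun_upd_same nat.inject)
    then show "\<alpha> = \<beta>" by auto
  qed
  have "of_real (x $ i) * P x = (\<Sum>\<alpha>\<in>multi_indices (Suc l). c' \<alpha> * monomial \<alpha> x)" for x
  proof -
    have "of_real (x $ i) * P x = (\<Sum>\<alpha>\<in>multi_indices l. c' (up \<alpha>) * monomial (up \<alpha>) x)"
      unfolding c sum_distrib_left mon_up
      by (intro sum.cong) (auto simp: c'_def up_def)
    also have "\<dots> = (\<Sum>\<alpha> \<in> up ` multi_indices l. c' \<alpha> * monomial \<alpha> x)"
      by (simp add: sum.reindex inj o_def)
    also have "\<dots> = (\<Sum>\<alpha>\<in>multi_indices (Suc l). c' \<alpha> * monomial \<alpha> x)"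
    proof (rule sum.mono_neutral_left[OF finite_multi_indices])
      show "up ` multi_indices l \<subseteq> multi_indices (Suc l)"
        using sum_up by auto
      show "\<forall>\<alpha>\<in>multi_indices (Suc l) - up ` multi_indices l. c' \<alpha> * monomial \<alpha> x = 0"
      proof
        fix \<alpha> assume \<alpha>: "\<alpha> \<in> multi_indices (Suc l) - up ` multi_indices l"
        show "c' \<alpha> * monomial \<alpha> x = 0"
        proof (cases "\<alpha> i = 0")
          case False
          then have "\<alpha> = up (\<alpha>(i := \<alpha> i - 1))" by (auto simp: up_def)
          with \<alpha> sum_up[of "\<alpha>(i := \<alpha> i - 1)"] show ?thesis by auto
        qed (simp add: c'_def)
      qed
    qed
    finally show ?thesis .
  qed
  then show ?thesis unfolding homogeneous_polys_iff by blast
qed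

lemma homogeneous_polys_inner_mult:
  assumes "P \<in> homogeneous_polys l"
  shows "(\<lambda>x. of_real (u \<bullet> x) * P x) \<in> homogeneous_polys (Suc l)"
proof -
  have "(\<lambda>x. \<Sum>i\<in>UNIV. of_real (u $ i) * (of_real (x $ i) * P x)) \<in> homogeneous_polys (Suc l)"
    by (intro homogeneous_polys_sum homogeneous_polys_scale homogeneous_polys_coord_mult assms)
  then show ?thesis by (simp add: inner_vec_def sum_distrib_right mult.assoc)
qed

lemma homogeneous_polys_norm_mult:
  assumes "P \<in> homogeneous_polys l"
  shows "(\<lambda>x. of_real (x \<bullet> x) * P x) \<in> homogeneous_polys (Suc (Suc l))"
proof -
  have "(\<lambda>x. \<Sum>i\<in>UNIV. of_real (x $ i) * (of_real (x $ i) * P x)) \<in> homogeneous_polys (Suc (Suc l))"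
    by (intro homogeneous_polys_sum homogeneous_polys_coord_mult assms)
  then show ?thesis by (simp add: inner_vec_def sum_distrib_right mult.assoc)
qed

lemma homogeneous_polys_inner_norm:
  "(\<lambda>x. of_real ((u \<bullet> x) ^ m * (x \<bullet> x) ^ j)) \<in> homogeneous_polys (m + 2 * j)"
proof (induction m)
  case 0
  show ?case
  proof (induction j)
    case (Suc j)
    from homogeneous_polys_norm_mult[OF this] show ?case by (simp add: mult.assoc)
  qed (simp add: homogeneous_polys_const)
next
  case (Suc m)
  from homogeneous_polys_inner_mult[OF this, of u] show ?case by (simp add: mult.assoc)
qed

section \<open>Zonal harmonics and zonal polynomials\<close>

lemma laplacian_of_real:
  fixes F :: "real^'n::finite \<Rightarrow> real"
  assumes "\<And>i x. ((\<lambda>t. F (x + t *\<^sub>R axis i 1)) has_real_derivative F1 i x) (at 0)"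
    and "\<And>i x. ((\<lambda>t. F1 i (x + t *\<^sub>R axis i 1)) has_real_derivative F2 i x) (at 0)"
  shows "laplacian (\<lambda>x. of_real (F x)) x = of_real (\<Sum>i\<in>UNIV. F2 i x)"
proof -
  have "partial_deriv i (\<lambda>x. of_real (F x)) = (\<lambda>x. of_real (F1 i x))" for i
    unfolding partial_deriv_def
    by (intro ext vector_derivative_at has_vector_derivative_of_real assms(1))
  moreover have "partial_deriv i (\<lambda>x. of_real (F1 i x)) = (\<lambda>x. of_real (F2 i x))" for i
    unfolding partial_deriv_def
    by (intro ext vector_derivative_at has_vector_derivative_of_real assms(2))
  ultimately show ?thesis by (simp only: laplacian_def of_real_sum)
qed

text \<open>These are the first and second derivatives along the \<open>i\<close>-th axis of
  \<open>(u \<bullet> x) ^ m * (x \<bullet> x) ^ j\<close>. Whenever a natural subtraction in an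
  exponent is cut off at 0, the numerical factor in front vanishes.\<close>

definition zonal_d1 :: "real^'n \<Rightarrow> nat \<Rightarrow> nat \<Rightarrow> 'n \<Rightarrow> real^'n \<Rightarrow> real" where
  "zonal_d1 u m j i x = (real m * (u \<bullet> x) ^ (m - 1) * u $ i) * (x \<bullet> x) ^ j
     + (real j * (x \<bullet> x) ^ (j - 1) * (2 * x $ i)) * (u \<bullet> x) ^ m"

definition zonal_d2 :: "real^'n \<Rightarrow> nat \<Rightarrow> nat \<Rightarrow> 'n \<Rightarrow> real^'n \<Rightarrow> real" where
  "zonal_d2 u m j i x =
     real m * (real (m - 1) * (u \<bullet> x) ^ (m - 2)) * (u $ i * u $ i) * (x \<bullet> x) ^ j
     + 4 * (real m * (u \<bullet> x) ^ (m - 1) * (real j * (x \<bullet> x) ^ (j - 1)) * (u $ i * x $ i))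
     + 4 * (real j * (real (j - 1) * (x \<bullet> x) ^ (j - 2)) * (x $ i * x $ i) * (u \<bullet> x) ^ m)
     + 2 * (real j * (x \<bullet> x) ^ (j - 1) * (u \<bullet> x) ^ m)"

context
  fixes x u :: "real^'n::finite" and i :: 'n
begin

lemma DERIV_inner_axis: "((\<lambda>t. u \<bullet> (x + t *\<^sub>R axis i 1)) has_real_derivative u $ i) (at 0)"
proof -
  have "((\<lambda>t. u \<bullet> x + t * u $ i) has_real_derivative u $ i) (at 0)"
    by (auto intro!: derivative_eq_intros)
  then show ?thesis by (simp add: inner_add_right inner_axis)
qed

lemma DERIV_inner_self_axis:
  "((\<lambda>t. (x + t *\<^sub>R axis i 1) \<bullet> (x + t *\<^sub>R axis i 1)) has_real_derivative (2 * x $ i)) (at 0)"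
proof -
  have "((\<lambda>t. x \<bullet> x + t * (2 * x $ i) + t * t) has_real_derivative 2 * x $ i) (at 0)"
    by (auto intro!: derivative_eq_intros)
  moreover have "(x + t *\<^sub>R axis i 1) \<bullet> (x + t *\<^sub>R axis i 1) = x \<bullet> x + t * (2 * x $ i) + t * t" for t
    by (simp add: inner_add_right inner_add_left inner_axis inner_commute[of "axis i 1" x] algebra_simps)
  ultimately show ?thesis by simp
qed

lemma DERIV_inner_power_axis:
  "((\<lambda>t. (u \<bullet> (x + t *\<^sub>R axis i 1)) ^ m) has_real_derivative real m * (u \<bullet> x) ^ (m - 1) * u $ i) (at 0)"
  using DERIV_power[OF DERIV_inner_axis, of m] by (simp add: mult_ac)

lemma DERIV_inner_self_power_axis:
  "((\<lambda>t. ((x + t *\<^sub>R axis i 1) \<bullet> (x + t *\<^sub>R axis i 1)) ^ j) has_real_derivative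
     real j * (x \<bullet> x) ^ (j - 1) * (2 * x $ i)) (at 0)"
  using DERIV_power[OF DERIV_inner_self_axis, of j] by (simp add: mult_ac)

lemma DERIV_nth_axis: "((\<lambda>t. (x + t *\<^sub>R axis i 1) $ i) has_real_derivative 1) (at 0)"
  by (auto intro!: derivative_eq_intros)

lemma DERIV_zonal_d1:
  "((\<lambda>t. (u \<bullet> (x + t *\<^sub>R axis i 1)) ^ m * ((x + t *\<^sub>R axis i 1) \<bullet> (x + t *\<^sub>R axis i 1)) ^ j)
     has_real_derivative zonal_d1 u m j i x) (at 0)"
  using DERIV_mult[OF DERIV_inner_power_axis[of m] DERIV_inner_self_power_axis[of j]]
  by (simp add: zonal_d1_def)

lemma DERIV_zonal_d2:
  "((\<lambda>t. zonal_d1 u m j i (x + t *\<^sub>R axis i 1)) has_real_derivative zonal_d2 u m j i x) (at 0)"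
  unfolding zonal_d1_def
  apply (rule DERIV_cong)
   apply (rule DERIV_add DERIV_mult DERIV_cmult DERIV_const DERIV_inner_power_axis DERIV_inner_self_power_axis DERIV_nth_axis)+
  apply (simp add: zonal_d2_def algebra_simps numeral_2_eq_2)
  done

end

text \<open>The Laplacian sends the pair of exponents \<open>(m, j)\<close> to
  \<open>(m - 2, j)\<close> and \<open>(m, j - 1)\<close>. Along the chain
  \<open>(k - 2 * j, j)\<close> these are neighbours, so harmonicity becomes a two-term recursion
  for the coefficients.\<close>

lemma sum_zonal_d2:
  fixes u :: "real^'n::finite"
  assumes "norm u = 1"
  shows "(\<Sum>i\<in>UNIV. zonal_d2 u m j i x)
    = real m * real (m - 1) * ((u \<bullet> x) ^ (m - 2) * (x \<bullet> x) ^ j)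
      + 2 * real j * (2 * real m + 2 * real j - 2 + real CARD('n)) * ((u \<bullet> x) ^ m * (x \<bullet> x) ^ (j - 1))"
proof -
  have uu: "(\<Sum>i\<in>UNIV. u $ i * u $ i) = 1"
    using assms by (simp add: norm_eq_1 inner_vec_def)
  have ux: "(\<Sum>i\<in>UNIV. u $ i * x $ i) = u \<bullet> x" and xx: "(\<Sum>i\<in>UNIV. x $ i * x $ i) = x \<bullet> x"
    by (simp_all add: inner_vec_def)
  have m: "real m * (u \<bullet> x) ^ (m - 1) * (u \<bullet> x) = real m * (u \<bullet> x) ^ m" by (cases m) auto
  have j: "real j * real (j - 1) * (x \<bullet> x) ^ (j - 2) * (x \<bullet> x) = real j * (real j - 1) * (x \<bullet> x) ^ (j - 1)"
  proof (cases j)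
    case (Suc k) then show ?thesis by (cases k) auto
  qed simp
  have "(\<Sum>i\<in>UNIV. zonal_d2 u m j i x) =
     real m * (real (m - 1) * (u \<bullet> x) ^ (m - 2)) * (x \<bullet> x) ^ j * (\<Sum>i\<in>UNIV. u $ i * u $ i)
     + 4 * (real m * (u \<bullet> x) ^ (m - 1) * (real j * (x \<bullet> x) ^ (j - 1)) * (\<Sum>i\<in>UNIV. u $ i * x $ i))
     + 4 * (real j * (real (j - 1) * (x \<bullet> x) ^ (j - 2)) * (u \<bullet> x) ^ m * (\<Sum>i\<in>UNIV. x $ i * x $ i))
     + 2 * real CARD('n) * (real j * (x \<bullet> x) ^ (j - 1) * (u \<bullet> x) ^ m)"
    unfolding zonal_d2_def sum.distrib sum_distrib_left sum_distrib_right
    by (simp add: mult_ac)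
  also have "\<dots> = real m * (real (m - 1) * (u \<bullet> x) ^ (m - 2)) * (x \<bullet> x) ^ j
     + 4 * ((real m * (u \<bullet> x) ^ (m - 1) * (u \<bullet> x)) * (real j * (x \<bullet> x) ^ (j - 1)))
     + 4 * ((real j * real (j - 1) * (x \<bullet> x) ^ (j - 2) * (x \<bullet> x)) * (u \<bullet> x) ^ m)
     + 2 * real CARD('n) * (real j * (x \<bullet> x) ^ (j - 1) * (u \<bullet> x) ^ m)"
    unfolding uu ux xx by (simp add: mult_ac)
  also have "\<dots> = real m * (real (m - 1) * (u \<bullet> x) ^ (m - 2)) * (x \<bullet> x) ^ j
     + 4 * ((real m * (u \<bullet> x) ^ m) * (real j * (x \<bullet> x) ^ (j - 1)))
     + 4 * ((real j * (real j - 1) * (x \<bullet> x) ^ (j - 1)) * (u \<bullet> x) ^ m)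
     + 2 * real CARD('n) * (real j * (x \<bullet> x) ^ (j - 1) * (u \<bullet> x) ^ m)"
    unfolding m j ..
  finally show ?thesis by (simp add: algebra_simps)
qed

text \<open>Coefficients of the Gegenbauer polynomial, normalised to have leading coefficient 1.\<close>

primrec zonal_coeff :: "nat \<Rightarrow> nat \<Rightarrow> nat \<Rightarrow> real" where
  "zonal_coeff n k 0 = 1"
| "zonal_coeff n k (Suc j) = - zonal_coeff n k j * (real (k - 2 * j) * real (k - 2 * j - 1))
     / (2 * real (Suc j) * (2 * real (k - 2 * Suc j) + 2 * real j + real n))"

definition zonal_harmonic :: "real^'n \<Rightarrow> nat \<Rightarrow> real^'n \<Rightarrow> real" where
  "zonal_harmonic u k x = (\<Sum>j\<le>k div 2. zonal_coeff CARD('n) k j * ((u \<bullet> x) ^ (k - 2 * j) * (x \<bullet> x) ^ j))"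

lemma zonal_harmonic_homogeneous: "(\<lambda>x. of_real (zonal_harmonic u k x)) \<in> homogeneous_polys k"
proof -
  have "(\<lambda>x. of_real ((u \<bullet> x) ^ (k - 2 * j) * (x \<bullet> x) ^ j)) \<in> homogeneous_polys k" if "j \<le> k div 2" for j
    using homogeneous_polys_inner_norm[of u "k - 2 * j" j] that by simp
  then have "(\<lambda>x. \<Sum>j\<le>k div 2. of_real (zonal_coeff CARD('a) k j) * of_real ((u \<bullet> x) ^ (k - 2 * j) * (x \<bullet> x) ^ j))
      \<in> homogeneous_polys k"
    by (intro homogeneous_polys_sum homogeneous_polys_scale) auto
  then show ?thesis by (simp add: zonal_harmonic_def)
qed

lemma laplacian_zonal_harmonic:
  fixes u :: "real^'n::finite"
  assumes "norm u = 1"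
  shows "laplacian (\<lambda>x. of_real (zonal_harmonic u k x)) x = 0"
proof -
  define c where "c = zonal_coeff CARD('n) k"
  define A where "A j = c j * (real (k - 2 * j) * real (k - 2 * j - 1) * ((u \<bullet> x) ^ (k - 2 * j - 2) * (x \<bullet> x) ^ j))" for j
  define B where "B j = c j * (2 * real j * (2 * real (k - 2 * j) + 2 * real j - 2 + real CARD('n)) * ((u \<bullet> x) ^ (k - 2 * j) * (x \<bullet> x) ^ (j - 1)))" for j
  have "laplacian (\<lambda>x. of_real (zonal_harmonic u k x)) x
      = of_real (\<Sum>i\<in>UNIV. \<Sum>j\<le>k div 2. c j * zonal_d2 u (k - 2 * j) j i x)"
    unfolding zonal_harmonic_def c_def
    by (rule laplacian_of_real[where ?F1.0 = "\<lambda>i x. \<Sum>j\<le>k div 2. zonal_coeff CARD('n) k j * zonal_d1 u (k - 2 * j) j i x"];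
        intro DERIV_sum DERIV_cmult DERIV_zonal_d1 DERIV_zonal_d2)
  also have "(\<Sum>i\<in>UNIV. \<Sum>j\<le>k div 2. c j * zonal_d2 u (k - 2 * j) j i x)
      = (\<Sum>j\<le>k div 2. c j * (\<Sum>i\<in>UNIV. zonal_d2 u (k - 2 * j) j i x))"
    by (subst sum.swap) (simp add: sum_distrib_left)
  also have "\<dots> = (\<Sum>j\<le>k div 2. A j + B j)"
    unfolding sum_zonal_d2[OF assms] A_def B_def by (simp add: algebra_simps)
  also have "\<dots> = (\<Sum>j\<le>k div 2. A j) + (\<Sum>j\<le>k div 2. B j)"
    by (rule sum.distrib)
  \<comment> \<open>In the last term the exponent of \<open>u \<bullet> x\<close> is 0 or 1, which
    kills its \<open>A\<close>; at the other end \<open>B 0\<close> carries the factor 0. What is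
    left pairs \<open>A j\<close> with \<open>B (Suc j)\<close>.\<close>
  also have "(\<Sum>j\<le>k div 2. A j) = (\<Sum>j<k div 2. A j)"
  proof -
    have "k - 2 * (k div 2) = 0 \<or> k - 2 * (k div 2) = 1" by linarith
    then have "A (k div 2) = 0" by (auto simp: A_def)
    then show ?thesis by (simp add: lessThan_Suc_atMost[symmetric])
  qed
  also have "(\<Sum>j\<le>k div 2. B j) = (\<Sum>j<k div 2. B (Suc j))"
    unfolding sum.atMost_shift by (simp add: B_def)
  also have "(\<Sum>j<k div 2. A j) + (\<Sum>j<k div 2. B (Suc j)) = (\<Sum>j<k div 2. A j + B (Suc j))"
    by (rule sum.distrib[symmetric])
  also have "\<dots> = 0"
  proof (rule sum.neutral, rule ballI)
    fix j assume "j \<in> {..<k div 2}"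
    \<comment> \<open>The denominator in \<open>zonal_coeff\<close>; it is positive because the
      dimension is.\<close>
    define D where "D = 2 * real (Suc j) * (2 * real (k - 2 * Suc j) + 2 * real j + real CARD('n))"
    have D: "D \<noteq> 0"
      unfolding D_def by (auto intro!: add_nonneg_pos simp: add_nonneg_eq_0_iff simp del: of_nat_Suc)
    have c: "c (Suc j) * D = - (c j * (real (k - 2 * j) * real (k - 2 * j - 1)))"
      using D unfolding c_def zonal_coeff.simps(2) D_def[symmetric] by simp
    have "B (Suc j) = (c (Suc j) * D) * ((u \<bullet> x) ^ (k - 2 * Suc j) * (x \<bullet> x) ^ j)"
      unfolding B_def D_def by (simp add: mult_ac)
    then show "A j + B (Suc j) = 0" unfolding c A_def by (simp add: mult_ac)
  qed
  finally show ?thesis by simp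
qed

lemma spherical_harmonics_mono: "k \<le> L \<Longrightarrow> spherical_harmonics k \<subseteq> spherical_harmonics L"
  unfolding spherical_harmonics_def by (intro complex_fun.span_mono UN_mono) auto

lemma spherical_harmonics_sum:
  assumes "\<And>i. i \<in> A \<Longrightarrow> f i \<in> spherical_harmonics L"
  shows "(\<lambda>x. \<Sum>i\<in>A. c i * f i x) \<in> spherical_harmonics L"
proof -
  have "(\<Sum>i\<in>A. (\<lambda>x. c i * f i x)) \<in> spherical_harmonics L"
    using assms unfolding spherical_harmonics_def
    by (intro complex_fun.span_sum complex_fun.span_scale)
  moreover have "(\<Sum>i\<in>A. (\<lambda>x. c i * f i x)) = (\<lambda>x. \<Sum>i\<in>A. c i * f i x)"
    by (induction A rule: infinite_finite_induct) (auto simp: fun_eq_iff)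
  ultimately show ?thesis by simp
qed

text \<open>On the sphere \<open>x \<bullet> x = 1\<close>, so the zonal harmonic of degree
  \<open>k\<close> is \<open>(u \<bullet> x) ^ k\<close> plus multiples of lower powers of the same
  parity, which are covered by induction. This places the test polynomials in the span by which
  \<open>spherical_harmonics\<close> is defined.\<close>

lemma inner_power_in_spherical_harmonics:
  fixes u :: "real^'n::finite"
  assumes u: "norm u = 1"
  shows "sphere_restrict (\<lambda>x. of_real ((u \<bullet> x) ^ k)) \<in> spherical_harmonics k"
proof (induction k rule: less_induct)
  case (less k)
  define c where "c = zonal_coeff CARD('n) k"
  define h where "h = sphere_restrict (\<lambda>x. of_real (zonal_harmonic u k x))"
  have h: "h \<in> spherical_harmonics k"
    unfolding spherical_harmonics_def h_def
    using zonal_harmonic_homogeneous[of u k] laplacian_zonal_harmonic[OF u, of k]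
    by (intro complex_fun.span_base UN_I[of k]) (auto simp: harmonics_of_degree_def simp del: of_real_eq_0_iff)
  have "sphere_restrict (\<lambda>x. of_real ((u \<bullet> x) ^ (k - 2 * j))) \<in> spherical_harmonics k"
    if "j \<in> {1..k div 2}" for j
    using less.IH[of "k - 2 * j"] spherical_harmonics_mono[of "k - 2 * j" k] that by auto
  then have r: "(\<lambda>x. \<Sum>j=1..k div 2. of_real (c j) * sphere_restrict (\<lambda>x. of_real ((u \<bullet> x) ^ (k - 2 * j))) x)
      \<in> spherical_harmonics k"
    by (rule spherical_harmonics_sum)
  have eq: "sphere_restrict (\<lambda>x. of_real ((u \<bullet> x) ^ k))
      = h - (\<lambda>x. \<Sum>j=1..k div 2. of_real (c j) * sphere_restrict (\<lambda>x. of_real ((u \<bullet> x) ^ (k - 2 * j))) x)"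
  proof (rule ext)
    fix x
    show "sphere_restrict (\<lambda>x. of_real ((u \<bullet> x) ^ k)) x
      = (h - (\<lambda>x. \<Sum>j=1..k div 2. of_real (c j) * sphere_restrict (\<lambda>x. of_real ((u \<bullet> x) ^ (k - 2 * j))) x)) x"
    proof (cases "x \<in> unit_sphere")
      case True
      then have "x \<bullet> x = 1" by (simp add: norm_eq_1)
      moreover have "{..k div 2} = insert 0 {1..k div 2}" by auto
      ultimately show ?thesis using True
        by (simp add: sphere_restrict_def h_def zonal_harmonic_def c_def)
    qed (simp add: sphere_restrict_def h_def)
  qed
  show ?case unfolding eq using h r unfolding spherical_harmonics_def by (rule complex_fun.span_diff)
qed

lemma zonal_poly_in_spherical_harmonics:
  fixes u :: "real^'n::finite" and p :: "real poly"
  assumes "norm u = 1" "degree p \<le> L"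
  shows "sphere_restrict (\<lambda>x. of_real (poly p (u \<bullet> x))) \<in> spherical_harmonics L"
proof -
  have "sphere_restrict (\<lambda>x. of_real ((u \<bullet> x) ^ i)) \<in> spherical_harmonics L" if "i \<in> {..degree p}" for i
    using inner_power_in_spherical_harmonics[OF assms(1)] spherical_harmonics_mono[of i L] that assms(2) by auto
  then have "(\<lambda>x. \<Sum>i\<le>degree p. of_real (coeff p i) * sphere_restrict (\<lambda>x. of_real ((u \<bullet> x) ^ i)) x)
      \<in> spherical_harmonics L"
    by (rule spherical_harmonics_sum)
  also have "(\<lambda>x. \<Sum>i\<le>degree p. of_real (coeff p i) * sphere_restrict (\<lambda>x. of_real ((u \<bullet> x) ^ i)) x)
      = sphere_restrict (\<lambda>x. of_real (poly p (u \<bullet> x)))"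
    by (auto simp: fun_eq_iff sphere_restrict_def poly_altdef)
  finally show ?thesis .
qed

subsection \<open>Caps and doubling measures\<close>

lemma sin_ge_half:
  fixes x :: real
  assumes "0 \<le> x" "x \<le> pi / 2" shows "x / 2 \<le> sin x"
proof -
  have "\<bar>sin x - x\<bar> \<le> inverse (fact 3) * \<bar>x\<bar> ^ 3"
    using Maclaurin_sin_bound[of x 3] by (simp add: numeral_3_eq_3 sin_coeff_def)
  moreover have "inverse (fact 3) * \<bar>x\<bar> ^ 3 \<le> x / 2"
  proof -
    \<comment> \<open>The bound \<open>pi / 2 \<le> 17 / 10\<close> suffices because
      \<open>(17 / 10)\<^sup>2 < 3\<close>, which is half of \<open>fact 3\<close>.\<close>
    have "x * x\<^sup>2 \<le> x * (17 / 10)\<^sup>2"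
      using assms pi_approx by (intro mult_left_mono power_mono) auto
    then show ?thesis using assms by (simp add: fact_numeral power3_eq_cube power2_eq_square)
  qed
  ultimately show ?thesis by linarith
qed

lemma sq_dist_unit:
  fixes u v :: "'a::real_inner"
  assumes "norm u = 1" "norm v = 1" shows "(dist u v)\<^sup>2 = 2 * (1 - u \<bullet> v)"
  using assms by (simp add: dist_norm power2_norm_eq_inner inner_diff inner_commute norm_eq_1 algebra_simps)

lemma abs_inner_unit_le: "norm u = 1 \<Longrightarrow> norm v = 1 \<Longrightarrow> \<bar>u \<bullet> v\<bar> \<le> 1" for u v :: "'a::real_inner"
  using Cauchy_Schwarz_ineq2[of u v] by simp

lemma dist_eq_sin_arccos:
  fixes u v :: "'a::real_inner"
  assumes "norm u = 1" "norm v = 1" shows "dist u v = 2 * sin (arccos (u \<bullet> v) / 2)"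
proof -
  have uv: "\<bar>u \<bullet> v\<bar> \<le> 1" using abs_inner_unit_le[OF assms] .
  have "(dist u v)\<^sup>2 = (2 * sin (arccos (u \<bullet> v) / 2))\<^sup>2"
    using cos_double_sin[of "arccos (u \<bullet> v) / 2"] cos_arccos_abs[OF uv]
    by (simp add: sq_dist_unit[OF assms] power_mult_distrib)
  moreover have "0 \<le> sin (arccos (u \<bullet> v) / 2)"
    using arccos_lbound[of "u \<bullet> v"] arccos_ubound[of "u \<bullet> v"] uv by (intro sin_ge_zero) (auto simp: abs_le_iff)
  ultimately show ?thesis by (intro power2_eq_imp_eq[of "dist u v"]) auto
qed

lemma dist_le_arccos:
  fixes u v :: "'a::real_inner"
  assumes "norm u = 1" "norm v = 1" shows "dist u v \<le> arccos (u \<bullet> v)"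
  using sin_x_le_x[of "arccos (u \<bullet> v) / 2"] arccos_lbound[of "u \<bullet> v"] abs_inner_unit_le[OF assms]
  by (simp add: dist_eq_sin_arccos[OF assms])

lemma arccos_le_dist:
  fixes u v :: "'a::real_inner"
  assumes "norm u = 1" "norm v = 1" shows "arccos (u \<bullet> v) \<le> 2 * dist u v"
  using sin_ge_half[of "arccos (u \<bullet> v) / 2"] arccos_lbound[of "u \<bullet> v"] arccos_ubound[of "u \<bullet> v"]
    abs_inner_unit_le[OF assms]
  by (simp add: dist_eq_sin_arccos[OF assms] abs_le_iff)

text \<open>Chordal caps are traces of metric balls, which gives access to Vitali's lemma and to the
  triangle inequality of the ambient space. Chord and angle differ by a factor of at most 2.\<close>

definition cap :: "real^'n \<Rightarrow> real \<Rightarrow> (real^'n) set" where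
  "cap u s = unit_sphere \<inter> ball u s"

lemma mem_cap [simp]: "v \<in> cap u s \<longleftrightarrow> norm v = 1 \<and> dist u v < s"
  by (auto simp: cap_def)

lemma geodesic_ball_subset_cap: "norm u = 1 \<Longrightarrow> geodesic_ball u s \<subseteq> cap u s"
  using dist_le_arccos[of u] by (force simp: geodesic_ball_def geodesic_dist_def)

lemma cap_subset_geodesic_ball: "norm u = 1 \<Longrightarrow> cap u s \<subseteq> geodesic_ball u (2 * s)"
  using arccos_le_dist[of u] by (force simp: geodesic_ball_def geodesic_dist_def)

lemma geodesic_ball_whole: "norm u = 1 \<Longrightarrow> pi < s \<Longrightarrow> geodesic_ball u s = unit_sphere"
  using order.strict_trans1[OF arccos_ubound] abs_inner_unit_le[of u]
  by (auto simp: geodesic_ball_def geodesic_dist_def abs_le_iff)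

text \<open>If \<open>v\<close> is \<open>u\<close> or its antipode, the direction is not determined
  and any unit vector orthogonal to \<open>u\<close> serves; this is where the dimension must be at
  least 2. The bound of \<open>t\<close> by the chord is what later estimates along the arc rely
  on.\<close>

lemma great_circle_param:
  fixes u v :: "real^'n"
  assumes n: "CARD('n) \<ge> 2" and u: "norm u = 1" and v: "norm v = 1"
  obtains \<eta> t where "norm \<eta> = 1" "u \<bullet> \<eta> = 0" "0 \<le> t" "t \<le> 2 * dist u v"
    "v = cos t *\<^sub>R u + sin t *\<^sub>R \<eta>"
proof -
  define t where "t = arccos (u \<bullet> v)"
  have uv: "\<bar>u \<bullet> v\<bar> \<le> 1" using abs_inner_unit_le[OF u v] .
  have t: "0 \<le> t" "t \<le> 2 * dist u v" "cos t = u \<bullet> v"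
    using arccos_le_dist[OF u v] arccos_bounded[of "u \<bullet> v"] uv by (auto simp: t_def cos_arccos_abs)
  have uu: "u \<bullet> u = 1" "v \<bullet> v = 1" using u v by (simp_all add: norm_eq_1)
  show thesis
  proof (cases "sin t = 0")
    case False
    define \<eta> where "\<eta> = (1 / sin t) *\<^sub>R (v - cos t *\<^sub>R u)"
    have "u \<bullet> \<eta> = 0" by (simp add: \<eta>_def inner_diff_right uu t(3))
    moreover have "(v - cos t *\<^sub>R u) \<bullet> (v - cos t *\<^sub>R u) = (sin t)\<^sup>2"
      by (simp add: inner_diff_left inner_diff_right uu t(3)[symmetric] inner_commute[of v u] sin_squared_eq
          algebra_simps power2_eq_square)
    then have "\<eta> \<bullet> \<eta> = 1" using False by (simp add: \<eta>_def power2_eq_square)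
    moreover have "v = cos t *\<^sub>R u + sin t *\<^sub>R \<eta>" using False by (simp add: \<eta>_def)
    ultimately show ?thesis using that t by (simp add: norm_eq_1)
  next
    case True
    then have "\<bar>cos t\<bar> = 1"
      using sin_cos_squared_add[of t] by (simp add: abs_square_eq_1 power2_eq_1_iff)
    moreover have "(v - cos t *\<^sub>R u) \<bullet> (v - cos t *\<^sub>R u) = 1 - (cos t)\<^sup>2"
      by (simp add: inner_diff_left inner_diff_right uu t(3)[symmetric] inner_commute[of v u]
          algebra_simps power2_eq_square)
    ultimately have "(v - cos t *\<^sub>R u) \<bullet> (v - cos t *\<^sub>R u) = 0"
      using abs_square_eq_1 by (metis diff_self)
    then have "v = cos t *\<^sub>R u" by simp
    obtain y :: "real^'n" where y: "y \<noteq> 0" "orthogonal u y"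
      using orthogonal_to_vector_exists[of u] n by auto
    define \<eta> where "\<eta> = (1 / norm y) *\<^sub>R y"
    have \<eta>: "norm \<eta> = 1" "u \<bullet> \<eta> = 0" using y by (auto simp: \<eta>_def orthogonal_def)
    have "v = cos t *\<^sub>R u + sin t *\<^sub>R \<eta>"
      using \<open>v = cos t *\<^sub>R u\<close> unfolding True by (metis add.right_neutral scaleR_zero_left)
    from that[OF \<eta> t(1,2) this] show ?thesis .
  qed
qed

section \<open>Covering and doubling for measures on the sphere\<close>

locale sphere_measure = finite_measure \<mu> for \<mu> :: "(real^'n) measure" +
  assumes sets_eq: "sets \<mu> = sets (restrict_space borel unit_sphere)"
begin

lemma space_eq: "space \<mu> = unit_sphere"
  using sets_eq_imp_space_eq[OF sets_eq] by (simp add: space_restrict_space)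

lemma sets_iff: "A \<in> sets \<mu> \<longleftrightarrow> A \<subseteq> unit_sphere \<and> A \<in> sets borel"
  unfolding sets_eq by (subst sets_restrict_space_iff) auto

lemma cap_in_sets [measurable, simp]: "cap u s \<in> sets \<mu>"
  by (auto simp: sets_iff cap_def)

lemma borel_measurable_continuous_on_sphere:
  fixes f :: "real^'n \<Rightarrow> 'b::topological_space"
  shows "continuous_on unit_sphere f \<Longrightarrow> f \<in> borel_measurable \<mu>"
  using borel_measurable_continuous_on_restrict measurable_cong_sets[OF sets_eq refl] by blast

text \<open>Turns a density estimate at every point into a global one: disjoint balls of radius
  \<open>s\<close> centred in \<open>A\<close> are selected whose fivefold enlargements cover
  \<open>A\<close>, and the disjoint pieces of \<open>G\<close> add up to at most \<open>G\<close>.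
  No doubling is assumed, so that the lemma applies to the weighted measures below.\<close>

lemma vitali_density_bound:
  assumes A: "A \<subseteq> unit_sphere" "A \<in> sets \<mu>" and G: "G \<in> sets \<mu>" and s: "s > 0" and K: "K \<ge> 0"
    and dens: "\<And>v. v \<in> A \<Longrightarrow> measure \<mu> (cap v (5 * s)) \<le> K * measure \<mu> (G \<inter> ball v s)"
  shows "measure \<mu> A \<le> K * measure \<mu> G"
proof -
  have "A \<subseteq> (\<Union>v\<in>A. ball v s)" using s by auto
  then obtain C where C: "countable C" "C \<subseteq> A"
     "pairwise (\<lambda>v w. disjnt (ball v s) (ball w s)) C" "A \<subseteq> (\<Union>v\<in>C. ball v (5 * s))"
    by (rule Vitali_covering_lemma_balls[where B = s and r = "\<lambda>_. s"]) (use s in auto)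
  have Gb: "G \<inter> ball v s \<in> sets \<mu>" for v using G by (auto simp: sets_iff)
  have "emeasure \<mu> A \<le> emeasure \<mu> (\<Union>v\<in>C. cap v (5 * s))"
    using C A by (intro emeasure_mono sets.countable_UN' cap_in_sets) (auto simp: subset_iff)
  \<comment> \<open>Countable subadditivity, with the sum written as an integral over
    \<open>count_space C\<close> because \<open>C\<close> is not enumerated.\<close>
  also have "\<dots> \<le> (\<integral>\<^sup>+v. emeasure \<mu> (cap v (5 * s)) \<partial>count_space C)"
  proof -
    have "emeasure \<mu> (\<Union>v\<in>C. cap v (5 * s)) = (\<integral>\<^sup>+x. indicator (\<Union>v\<in>C. cap v (5 * s)) x \<partial>\<mu>)"
      using C by (intro nn_integral_indicator[symmetric] sets.countable_UN' cap_in_sets) auto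
    also have "\<dots> \<le> (\<integral>\<^sup>+x. \<integral>\<^sup>+v. indicator (cap v (5 * s)) x \<partial>count_space C \<partial>\<mu>)"
    proof (rule nn_integral_mono)
      fix x
      show "indicator (\<Union>v\<in>C. cap v (5 * s)) x \<le> (\<integral>\<^sup>+v. indicator (cap v (5 * s)) x \<partial>count_space C)"
      proof (cases "x \<in> (\<Union>v\<in>C. cap v (5 * s))")
        case True
        then obtain v where v: "v \<in> C" "x \<in> cap v (5 * s)" by blast
        then have "indicator (\<Union>v\<in>C. cap v (5 * s)) x = (indicator (cap v (5 * s)) x :: ennreal)"
          by (auto simp: indicator_def)
        then show ?thesis using nn_integral_ge_point[OF v(1), of "\<lambda>v. indicator (cap v (5 * s)) x"] by simp
      qed simp
    qed
    also have "\<dots> = (\<integral>\<^sup>+v. \<integral>\<^sup>+x. indicator (cap v (5 * s)) x \<partial>\<mu> \<partial>count_space C)"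
      by (intro nn_integral_count_space_nn_integral C) auto
    also have "\<dots> = (\<integral>\<^sup>+v. emeasure \<mu> (cap v (5 * s)) \<partial>count_space C)" by simp
    finally show ?thesis .
  qed
  also have "\<dots> \<le> (\<integral>\<^sup>+v. ennreal K * emeasure \<mu> (G \<inter> ball v s) \<partial>count_space C)"
    using dens C(2) K
    by (intro nn_integral_mono) (auto simp: emeasure_eq_measure ennreal_mult[symmetric] intro!: ennreal_leI)
  also have "\<dots> = ennreal K * (\<integral>\<^sup>+v. emeasure \<mu> (G \<inter> ball v s) \<partial>count_space C)"
    by (simp add: nn_integral_cmult)
  also have "(\<integral>\<^sup>+v. emeasure \<mu> (G \<inter> ball v s) \<partial>count_space C) = emeasure \<mu> (\<Union>v\<in>C. G \<inter> ball v s)"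
    using C by (intro emeasure_UN_countable[symmetric] Gb)
      (auto simp: disjoint_family_on_def pairwise_def disjnt_def)
  also have "ennreal K * \<dots> \<le> ennreal K * emeasure \<mu> G"
    using G by (intro mult_left_mono emeasure_mono) auto
  finally show ?thesis
    using K by (simp add: emeasure_eq_measure ennreal_mult[symmetric] ennreal_le_iff)
qed

end

locale doubling_sphere_measure = sphere_measure \<mu> for \<mu> :: "(real^'n) measure" +
  fixes D :: real
  assumes D: "D \<ge> 1"
    and cap_pos: "norm u = 1 \<Longrightarrow> s > 0 \<Longrightarrow> measure \<mu> (cap u s) > 0"
    and cap_doubling: "norm u = 1 \<Longrightarrow> s > 0 \<Longrightarrow> measure \<mu> (cap u (2 * s)) \<le> D * measure \<mu> (cap u s)"
begin

lemma cap_doubling_power: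
  assumes "norm u = 1" "s > 0" shows "measure \<mu> (cap u (2 ^ k * s)) \<le> D ^ k * measure \<mu> (cap u s)"
proof (induction k)
  case (Suc k)
  have "measure \<mu> (cap u (2 ^ Suc k * s)) \<le> D * measure \<mu> (cap u (2 ^ k * s))"
    using cap_doubling[of u "2 ^ k * s"] assms by (simp add: mult.assoc)
  also have "\<dots> \<le> D * (D ^ k * measure \<mu> (cap u s))" using Suc D by (intro mult_left_mono) auto
  finally show ?case by (simp add: mult.assoc)
qed simp

lemma cap_doubling_le:
  assumes "norm u = 1" "s > 0" "t \<le> 2 ^ k * s"
  shows "measure \<mu> (cap u t) \<le> D ^ k * measure \<mu> (cap u s)"
proof -
  have "measure \<mu> (cap u t) \<le> measure \<mu> (cap u (2 ^ k * s))"
    using assms by (intro finite_measure_mono) auto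
  then show ?thesis using cap_doubling_power[OF assms(1,2), of k] by simp
qed

text \<open>On the dyadic annulus of index \<open>s + j\<close> the integrand is at most
  \<open>(2 * D) ^ -(s + j)\<close>, by the choice of \<open>N\<close>, while the cap containing it
  has mass at most \<open>D ^ (s + j + 1)\<close> times the central one. The products decay like
  \<open>2 ^ -(s + j)\<close>, and their sum gains the factor \<open>1 / 2 ^ s\<close>.\<close>

lemma nn_integral_tail_le:
  assumes N: "2 * D \<le> 2 ^ N" and L: "L > 0" and w: "norm w = 1"
  shows "(\<integral>\<^sup>+u. ennreal ((1 / (L * dist w u)) ^ N) * indicator {u. 2 ^ s \<le> L * dist w u} u \<partial>\<mu>)
    \<le> ennreal (2 * D / 2 ^ s * measure \<mu> (cap w (1 / L)))"
proof -
  define m where "m = measure \<mu> (cap w (1 / L))"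
  define c :: "nat \<Rightarrow> real" where "c j = (1 / 2 ^ (s + j)) ^ N" for j
  define B where "B j = cap w (2 ^ Suc (s + j) / L)" for j
  have "(\<integral>\<^sup>+u. ennreal ((1 / (L * dist w u)) ^ N) * indicator {u. 2 ^ s \<le> L * dist w u} u \<partial>\<mu>)
      \<le> (\<integral>\<^sup>+u. (\<Sum>j. ennreal (c j) * indicator (B j) u) \<partial>\<mu>)"
  proof (rule nn_integral_mono)
    fix u assume u: "u \<in> space \<mu>"
    show "ennreal ((1 / (L * dist w u)) ^ N) * indicator {u. 2 ^ s \<le> L * dist w u} u
      \<le> (\<Sum>j. ennreal (c j) * indicator (B j) u)"
    proof (cases "2 ^ s \<le> L * dist w u")
      case True
      \<comment> \<open>The least such exponent identifies the annulus of \<open>u\<close>: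
        minimality gives the lower bound on the distance, the property itself the upper one.\<close>
      define k where "k = (LEAST k. L * dist w u < 2 ^ k)"
      have ex: "\<exists>k. L * dist w u < 2 ^ k" using real_arch_pow[of 2 "L * dist w u"] by auto
      have k: "L * dist w u < 2 ^ k" unfolding k_def using ex by (rule LeastI_ex)
      have "(2::real) ^ s < 2 ^ k" using True k by linarith
      then have "s < k" by (simp add: power_strict_increasing_iff)
      then obtain j where j: "k = Suc (s + j)" using less_imp_Suc_add by blast
      have kk: "2 ^ (s + j) \<le> L * dist w u"
        using not_less_Least[of "s + j" "\<lambda>k. L * dist w u < 2 ^ k"] j by (simp add: k_def not_less)
      have pos: "0 < L * dist w u" using True by (intro order.strict_trans2[OF _ True]) simp
      have "(1 / (L * dist w u)) ^ N \<le> c j"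
        unfolding c_def using kk pos L by (intro power_mono divide_left_mono mult_pos_pos)
          (auto intro: order.strict_trans2[OF _ kk])
      moreover have "u \<in> B j" using u k L by (simp add: B_def space_eq j field_simps)
      ultimately have "ennreal ((1 / (L * dist w u)) ^ N) * indicator {u. 2 ^ s \<le> L * dist w u} u
        \<le> (\<Sum>j\<in>{j}. ennreal (c j) * indicator (B j) u)"
        using True by (simp add: ennreal_leI)
      also have "\<dots> \<le> (\<Sum>j. ennreal (c j) * indicator (B j) u)"
        by (rule sum_le_suminf) auto
      finally show ?thesis .
    qed simp
  qed
  also have "\<dots> = (\<Sum>j. ennreal (c j) * emeasure \<mu> (B j))"
    by (subst nn_integral_suminf) (auto simp: B_def nn_integral_cmult)
  also have "\<dots> \<le> (\<Sum>j. ennreal ((1 / 2) ^ j * (D / 2 ^ s * m)))"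
  proof (intro suminf_le summableI)
    fix j
    have "c j * measure \<mu> (B j) \<le> c j * (D ^ Suc (s + j) * m)"
      unfolding B_def m_def using w L cap_doubling_power[of w "1 / L" "Suc (s + j)"]
      by (intro mult_left_mono) (auto simp: c_def)
    also have "c j \<le> (1 / (2 * D)) ^ (s + j)"
    proof -
      have "c j = (1 / 2 ^ N) ^ (s + j)" by (simp add: c_def power_divide flip: power_mult mult.commute)
      also have "\<dots> \<le> (1 / (2 * D)) ^ (s + j)"
        using N D by (intro power_mono divide_left_mono) auto
      finally show ?thesis .
    qed
    then have "c j * (D ^ Suc (s + j) * m) \<le> (1 / (2 * D)) ^ (s + j) * (D ^ Suc (s + j) * m)"
      using D by (intro mult_right_mono) (auto simp: m_def)
    also have "\<dots> = (1 / 2) ^ j * (D / 2 ^ s * m)"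
      using D by (simp add: power_add power_divide power_mult_distrib field_simps)
    finally show "ennreal (c j) * emeasure \<mu> (B j) \<le> ennreal ((1 / 2) ^ j * (D / 2 ^ s * m))"
      by (simp add: emeasure_eq_measure ennreal_mult[symmetric] c_def ennreal_leI)
  qed
  also have "\<dots> = ennreal (\<Sum>j. (1 / 2) ^ j * (D / 2 ^ s * m))"
    using D by (intro suminf_ennreal2) (auto simp: m_def intro!: summable_mult2 summable_geometric)
  also have "(\<Sum>j. (1 / 2) ^ j * (D / 2 ^ s * m)) = 2 * (D / 2 ^ s * m)"
    by (subst suminf_mult2[symmetric]) (auto simp: suminf_geometric summable_geometric)
  finally show ?thesis by (simp add: m_def mult.assoc)
qed

end

text \<open>The constant is squared because a cap of radius \<open>2 * s\<close> fits only into a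
  geodesic ball of radius \<open>4 * s\<close>, two doublings away from \<open>s\<close>.\<close>

lemma doubling_measure_imp_locale:
  fixes \<mu> :: "(real^'n) measure"
  assumes "doubling_measure \<mu>"
  obtains D where "doubling_sphere_measure \<mu> D"
    "\<And>u s. norm u = 1 \<Longrightarrow> s > 0 \<Longrightarrow> measure \<mu> (geodesic_ball u (2 * s)) \<le> D * measure \<mu> (geodesic_ball u s)"
    "\<And>u s. norm u = 1 \<Longrightarrow> geodesic_ball u s \<in> sets \<mu>"
proof -
  obtain C where se: "sets \<mu> = sets (restrict_space borel unit_sphere)" and fin: "finite_measure \<mu>"
    and ne: "emeasure \<mu> (space \<mu>) \<noteq> 0" and C: "C > 0"
    and dbl: "\<And>u s. norm u = 1 \<Longrightarrow> s > 0 \<Longrightarrow> measure \<mu> (geodesic_ball u (2 * s)) \<le> C * measure \<mu> (geodesic_ball u s)"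
    using assms by (auto simp: doubling_measure_def)
  interpret sphere_measure \<mu> using fin se by (simp add: sphere_measure_def sphere_measure_axioms_def)
  define K where "K = max 1 C"
  have K: "1 \<le> K" "C \<le> K" by (auto simp: K_def)
  have gs: "geodesic_ball u s \<in> sets \<mu>" if "norm u = 1" for u s
  proof -
    have [measurable]: "(\<lambda>v. arccos (u \<bullet> v)) \<in> borel_measurable \<mu>"
      by (intro borel_measurable_continuous_on_sphere continuous_intros)
         (use abs_inner_unit_le[OF that] in \<open>auto simp: abs_le_iff\<close>)
    have "geodesic_ball u s = {v \<in> space \<mu>. arccos (u \<bullet> v) < s}"
      by (auto simp: geodesic_ball_def geodesic_dist_def space_eq)
    then show ?thesis by simp
  qed
  have dblK: "measure \<mu> (geodesic_ball u (2 * s)) \<le> K * measure \<mu> (geodesic_ball u s)"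
    if "norm u = 1" "s > 0" for u s
    using dbl[OF that] K(2) mult_right_mono[of C K "measure \<mu> (geodesic_ball u s)"] by simp
  have dbl_power: "measure \<mu> (geodesic_ball u (2 ^ k * s)) \<le> K ^ k * measure \<mu> (geodesic_ball u s)"
    if "norm u = 1" "s > 0" for u s k
  proof (induction k)
    case (Suc k)
    have "measure \<mu> (geodesic_ball u (2 ^ Suc k * s)) \<le> K * measure \<mu> (geodesic_ball u (2 ^ k * s))"
      using dblK[of u "2 ^ k * s"] that by (simp add: mult.assoc)
    also have "\<dots> \<le> K * (K ^ k * measure \<mu> (geodesic_ball u s))"
      using Suc K by (intro mult_left_mono) auto
    finally show ?case by (simp add: mult.assoc)
  qed simp
  have pos: "measure \<mu> (geodesic_ball u s) > 0" if us: "norm u = 1" "s > 0" for u s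
  proof -
    \<comment> \<open>After \<open>k\<close> doublings the ball is the whole sphere, so a ball of
      mass 0 would make the total mass 0.\<close>
    obtain k where k: "pi / s < 2 ^ k" using real_arch_pow[of 2 "pi / s"] by auto
    then have "geodesic_ball u (2 ^ k * s) = space \<mu>"
      using us by (subst geodesic_ball_whole) (auto simp: space_eq field_simps)
    moreover have "measure \<mu> (space \<mu>) > 0" using ne by (simp add: emeasure_eq_measure zero_less_measure_iff)
    ultimately have "0 < K ^ k * measure \<mu> (geodesic_ball u s)" using dbl_power[OF us, of k] by simp
    then show ?thesis using K by (simp add: zero_less_mult_iff)
  qed
  have "doubling_sphere_measure \<mu> (K\<^sup>2)"
  proof unfold_locales
    show "1 \<le> K\<^sup>2" using K by simp
    fix u :: "real^'n" and s :: real assume us: "norm u = 1" "s > 0"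
    show "0 < measure \<mu> (cap u s)"
      using pos[OF us] finite_measure_mono[OF geodesic_ball_subset_cap[OF us(1)], of s] by simp
    have "measure \<mu> (cap u (2 * s)) \<le> measure \<mu> (geodesic_ball u (2 * (2 * s)))"
      by (intro finite_measure_mono cap_subset_geodesic_ball gs us)
    also have "\<dots> \<le> K\<^sup>2 * measure \<mu> (geodesic_ball u s)"
      using dbl_power[OF us, of 2] by simp
    also have "\<dots> \<le> K\<^sup>2 * measure \<mu> (cap u s)"
      by (intro mult_left_mono finite_measure_mono geodesic_ball_subset_cap us) auto
    finally show "measure \<mu> (cap u (2 * s)) \<le> K\<^sup>2 * measure \<mu> (cap u s)" .
  qed
  moreover have "K \<le> K\<^sup>2" using K by (simp add: power2_eq_square)
  then have "measure \<mu> (geodesic_ball u (2 * s)) \<le> K\<^sup>2 * measure \<mu> (geodesic_ball u s)"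
    if "norm u = 1" "s > 0" for u s
    using dblK[OF that] mult_right_mono[of K "K\<^sup>2" "measure \<mu> (geodesic_ball u s)"] by simp
  ultimately show thesis using that gs by blast
qed

subsection \<open>Rotational derivatives and the Peetre maximal function\<close>

inductive poly_fun :: "nat \<Rightarrow> (real^'n \<Rightarrow> complex) \<Rightarrow> bool" where
  const: "poly_fun L (\<lambda>x. c)"
| coord: "poly_fun L f \<Longrightarrow> poly_fun (Suc L) (\<lambda>x. of_real (x $ i) * f x)"
| add: "poly_fun L f \<Longrightarrow> poly_fun L g \<Longrightarrow> poly_fun L (\<lambda>x. f x + g x)"

lemma poly_fun_Suc: "poly_fun L f \<Longrightarrow> poly_fun (Suc L) f"
  by (induction rule: poly_fun.induct) (auto intro: poly_fun.intros)

lemma poly_fun_mono: "poly_fun L f \<Longrightarrow> L \<le> M \<Longrightarrow> poly_fun M f"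
  by (induction M) (auto simp: le_Suc_eq intro: poly_fun_Suc)

lemma poly_fun_scale: "poly_fun L f \<Longrightarrow> poly_fun L (\<lambda>x. c * f x)"
proof (induction rule: poly_fun.induct)
  case (coord L f i)
  from poly_fun.coord[OF coord.IH, of i] show ?case by (simp add: mult_ac)
next
  case (add L f g)
  from poly_fun.add[OF add.IH] show ?case by (simp add: algebra_simps)
qed (rule poly_fun.const)

lemma poly_fun_sum: "(\<And>k. k \<in> A \<Longrightarrow> poly_fun L (f k)) \<Longrightarrow> poly_fun L (\<lambda>x. \<Sum>k\<in>A. f k x)"
  by (induction A rule: infinite_finite_induct) (auto intro: poly_fun.intros)

lemma poly_fun_monomial:
  "finite A \<Longrightarrow> poly_fun (\<Sum>i\<in>A. \<alpha> i) (\<lambda>x. \<Prod>i\<in>A. of_real (x $ i) ^ \<alpha> i)"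
proof (induction A rule: finite_induct)
  case empty
  show ?case using poly_fun.const by simp
next
  case (insert i A)
  have "poly_fun (k + (\<Sum>i\<in>A. \<alpha> i)) (\<lambda>x. of_real (x $ i) ^ k * (\<Prod>i\<in>A. of_real (x $ i) ^ \<alpha> i))" for k
  proof (induction k)
    case (Suc k)
    from poly_fun.coord[OF this, of i] show ?case by (simp add: mult.assoc)
  qed (use insert in simp)
  from this[of "\<alpha> i"] insert show ?case by simp
qed

lemma poly_fun_homogeneous:
  assumes "P \<in> homogeneous_polys l" shows "poly_fun l P"
proof -
  obtain c where "\<And>x. P x = (\<Sum>\<alpha>\<in>multi_indices l. c \<alpha> * (\<Prod>i\<in>UNIV. of_real (x $ i) ^ \<alpha> i))"
    using assms unfolding homogeneous_polys_def by blast
  then have "P = (\<lambda>x. \<Sum>\<alpha> | (\<Sum>i\<in>UNIV. \<alpha> i) = l. c \<alpha> * (\<Prod>i\<in>UNIV. of_real (x $ i) ^ \<alpha> i))" by blast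
  moreover have "poly_fun l (\<lambda>x. \<Sum>\<alpha> | (\<Sum>i\<in>UNIV. \<alpha> i) = l. c \<alpha> * (\<Prod>i\<in>UNIV. of_real (x $ i) ^ \<alpha> i))"
  proof (rule poly_fun_sum)
    fix \<alpha> :: "'a \<Rightarrow> nat" assume "\<alpha> \<in> multi_indices l"
    then show "poly_fun l (\<lambda>x. c \<alpha> * (\<Prod>i\<in>UNIV. of_real (x $ i) ^ \<alpha> i))"
      using poly_fun_scale[OF poly_fun_monomial[of UNIV \<alpha>], of "c \<alpha>"] by simp
  qed
  ultimately show ?thesis by simp
qed

text \<open>Elements of \<open>spherical_harmonics\<close> are cut off to zero outside the sphere
  and cannot be differentiated in the ambient space; the representative \<open>f\<close>
  can.\<close>

lemma spherical_harmonics_poly_fun: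
  assumes "Q \<in> spherical_harmonics L"
  obtains f where "poly_fun L f" "Q = sphere_restrict f"
proof -
  let ?V = "{Q :: real^'a \<Rightarrow> complex. \<exists>f. poly_fun L f \<and> Q = sphere_restrict f}"
  have "complex_fun.span (\<Union>l\<le>L. harmonics_of_degree l) \<subseteq> ?V"
  proof (rule complex_fun.span_minimal)
    show "(\<Union>l\<le>L. harmonics_of_degree l) \<subseteq> ?V"
    proof
      fix Q :: "real^'a \<Rightarrow> complex" assume "Q \<in> (\<Union>l\<le>L. harmonics_of_degree l)"
      then obtain l P where "l \<le> L" "Q = sphere_restrict P" "P \<in> homogeneous_polys l"
        by (auto simp: harmonics_of_degree_def)
      then show "Q \<in> ?V" using poly_fun_mono[OF poly_fun_homogeneous] by blast
    qed
    show "complex_fun.subspace ?V"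
    proof (rule complex_fun.subspaceI)
      show "0 \<in> ?V" by (auto intro!: exI[of _ "\<lambda>_. 0"] poly_fun.const simp: sphere_restrict_def fun_eq_iff)
      fix P Q assume "P \<in> ?V" "Q \<in> ?V"
      then obtain f g where "poly_fun L f" "P = sphere_restrict f" "poly_fun L g" "Q = sphere_restrict g" by blast
      then show "P + Q \<in> ?V"
        by (auto intro!: exI[of _ "\<lambda>x. f x + g x"] poly_fun.add simp: sphere_restrict_def fun_eq_iff)
    next
      fix c P assume "P \<in> ?V"
      then obtain f where "poly_fun L f" "P = sphere_restrict f" by blast
      then show "(\<lambda>u. c * P u) \<in> ?V"
        by (auto intro!: exI[of _ "\<lambda>x. c * f x"] poly_fun_scale simp: sphere_restrict_def fun_eq_iff)
    qed
  qed
  then show thesis using assms that unfolding spherical_harmonics_def by blast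
qed

lemma has_derivative_of_real_nth:
  "((\<lambda>x :: real^'n. complex_of_real (x $ k)) has_derivative (\<lambda>h. of_real (h $ k))) (at x)"
  by (rule bounded_linear_imp_has_derivative)
     (rule bounded_linear_compose[OF bounded_linear_of_real bounded_linear_vec_nth])

lemma poly_fun_differentiable: "poly_fun L f \<Longrightarrow> f differentiable (at x)"
proof (induction rule: poly_fun.induct)
  case (coord L f i)
  have "(\<lambda>x :: real^'a. complex_of_real (x $ i)) differentiable (at x)"
    unfolding differentiable_def using has_derivative_of_real_nth by blast
  then show ?case using coord.IH by (intro differentiable_mult)
qed auto

lemma poly_fun_continuous: "poly_fun L f \<Longrightarrow> continuous_on S f"
  by (induction rule: poly_fun.induct) (auto intro!: continuous_intros)

text \<open>The generator of the rotations in the coordinate plane of \<open>i\<close> and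
  \<open>j\<close>: a linear vector field, tangent to all spheres around the origin.\<close>

definition rotation_field :: "'n \<Rightarrow> 'n \<Rightarrow> real^'n \<Rightarrow> real^'n" where
  "rotation_field i j x = x $ i *\<^sub>R axis j 1 - x $ j *\<^sub>R axis i 1"

definition rder :: "'n \<Rightarrow> 'n \<Rightarrow> (real^'n \<Rightarrow> complex) \<Rightarrow> real^'n \<Rightarrow> complex" where
  "rder i j f x = frechet_derivative f (at x) (rotation_field i j x)"

lemma rotation_field_nth:
  "rotation_field i j x $ k = (if k = j then x $ i else 0) - (if k = i then x $ j else 0)"
  by (auto simp: rotation_field_def axis_def)

lemma rder_eqI: "(f has_derivative f') (at x) \<Longrightarrow> rder i j f x = f' (rotation_field i j x)"
  unfolding rder_def by (metis frechet_derivative_at)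

lemma poly_fun_has_derivative:
  "poly_fun L f \<Longrightarrow> (f has_derivative frechet_derivative f (at x)) (at x)"
  using poly_fun_differentiable by (simp add: frechet_derivative_works)

text \<open>The field is linear, so the rotational derivative of a coordinate is again a coordinate
  up to sign, or 0. The degree bound is preserved, and every further derivative obeys Bernstein's
  inequality with the same \<open>L\<close>.\<close>

lemma poly_fun_rder: "poly_fun L f \<Longrightarrow> poly_fun L (rder i j f)"
proof (induction rule: poly_fun.induct)
  case (const L c)
  have "rder i j (\<lambda>x. c) = (\<lambda>x. 0)"
    by (intro ext rder_eqI[where f' = "\<lambda>_. 0"]) auto
  then show ?case by (simp add: poly_fun.const)
next
  case (coord L f k)
  have "rder i j (\<lambda>x. of_real (x $ k) * f x)
      = (\<lambda>x. of_real (x $ k) * rder i j f x + of_real (rotation_field i j x $ k) * f x)"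
  proof (rule ext)
    fix x :: "real^'a"
    from rder_eqI[OF has_derivative_mult[OF has_derivative_of_real_nth[of k] poly_fun_has_derivative[OF coord.hyps]], of i j]
    show "rder i j (\<lambda>x. of_real (x $ k) * f x) x
      = of_real (x $ k) * rder i j f x + of_real (rotation_field i j x $ k) * f x"
      by (simp add: rder_def)
  qed
  moreover have "poly_fun (Suc L) (\<lambda>x. (if k = j then 1 else 0) * (of_real (x $ i) * f x)
      + (if k = i then - 1 else 0) * (of_real (x $ j) * f x))"
    by (intro poly_fun.add poly_fun_scale poly_fun.coord coord.hyps)
  moreover have "(\<lambda>x. (if k = j then 1 else 0) * (of_real (x $ i) * f x)
      + (if k = i then - 1 else 0) * (of_real (x $ j) * f x))
      = (\<lambda>x. of_real (rotation_field i j x $ k) * f x)"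
    by (auto simp: rotation_field_nth fun_eq_iff algebra_simps)
  ultimately show ?case
    using poly_fun.add[OF poly_fun.coord[OF coord.IH, of k]] by simp
next
  case (add L f g)
  have "rder i j (\<lambda>x. f x + g x) = (\<lambda>x. rder i j f x + rder i j g x)"
    using rder_eqI[OF has_derivative_add[OF poly_fun_has_derivative[OF add.hyps(1)] poly_fun_has_derivative[OF add.hyps(2)]], of i j]
    by (simp add: rder_def fun_eq_iff)
  then show ?case using poly_fun.add[OF add.IH] by simp
qed

abbreviation biform :: "real^'n \<Rightarrow> real^'n \<Rightarrow> ('n \<Rightarrow> 'n \<Rightarrow> complex) \<Rightarrow> complex" where
  "biform u \<eta> a \<equiv> (\<Sum>i\<in>UNIV. \<Sum>j\<in>UNIV. of_real (u $ i * \<eta> $ j) * a i j)"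

locale great_circle =
  fixes u \<eta> :: "real^'n"
  assumes u: "norm u = 1" and eta: "norm \<eta> = 1" and orth: "u \<bullet> \<eta> = 0"
begin

definition gc :: "real \<Rightarrow> real^'n" where "gc t = cos t *\<^sub>R u + sin t *\<^sub>R \<eta>"

lemma gc_0 [simp]: "gc 0 = u" by (simp add: gc_def)

lemma inner_gc: "u \<bullet> gc t = cos t" "\<eta> \<bullet> gc t = sin t"
  using u eta orth by (auto simp: gc_def inner_add_right norm_eq_1 inner_commute)

lemma norm_gc [simp]: "norm (gc t) = 1"
proof -
  have "gc t \<bullet> gc t = cos t * (u \<bullet> gc t) + sin t * (\<eta> \<bullet> gc t)"
    by (subst (1) gc_def) (simp add: inner_add_left)
  then show ?thesis
    using sin_cos_squared_add[of t] by (simp add: inner_gc norm_eq_1 power2_eq_square)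
qed

lemma dist_gc: "dist u (gc t) = sqrt (2 * (1 - cos t))"
  using sq_dist_unit[OF u norm_gc, of t] by (simp add: inner_gc real_sqrt_unique)

lemma dist_gc_le: assumes "0 \<le> t" shows "dist u (gc t) \<le> t"
proof -
  have "\<bar>sin (t / 2)\<bar>\<^sup>2 \<le> \<bar>t / 2\<bar>\<^sup>2" by (intro power_mono abs_sin_x_le_abs_x) auto
  then have "2 * (1 - cos t) \<le> t\<^sup>2" using cos_double_sin[of "t / 2"] by (simp add: power2_eq_square)
  then show ?thesis unfolding dist_gc using assms by (intro real_le_lsqrt) auto
qed

text \<open>The velocity is that of the rotation in the plane of \<open>u\<close> and
  \<open>\<eta>\<close>, whose generator is a combination of the coordinate rotations. Its
  coefficients do not depend on \<open>t\<close>, so higher derivatives along the circle involve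
  only iterated \<open>rder\<close>.\<close>

lemma gc_has_vector_derivative:
  "(gc has_vector_derivative (\<Sum>i\<in>UNIV. \<Sum>j\<in>UNIV. (u $ i * \<eta> $ j) *\<^sub>R rotation_field i j (gc t))) (at t)"
proof -
  have "(gc has_vector_derivative (cos t *\<^sub>R \<eta> - sin t *\<^sub>R u)) (at t)"
    unfolding gc_def[abs_def] by (auto intro!: derivative_eq_intros)
  moreover have "(\<Sum>i\<in>UNIV. \<Sum>j\<in>UNIV. (u $ i * \<eta> $ j) *\<^sub>R rotation_field i j (gc t))
      = cos t *\<^sub>R \<eta> - sin t *\<^sub>R u"
    unfolding vec_eq_iff
  proof
    fix k
    have "(\<Sum>i\<in>UNIV. \<Sum>j\<in>UNIV. (u $ i * \<eta> $ j) *\<^sub>R rotation_field i j (gc t)) $ k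
      = (\<Sum>i\<in>UNIV. \<Sum>j\<in>UNIV. u $ i * \<eta> $ j * (if k = j then gc t $ i else 0))
        - (\<Sum>i\<in>UNIV. \<Sum>j\<in>UNIV. u $ i * \<eta> $ j * (if k = i then gc t $ j else 0))"
      by (simp add: rotation_field_nth right_diff_distrib sum_subtractf)
    also have "(\<Sum>i\<in>UNIV. \<Sum>j\<in>UNIV. u $ i * \<eta> $ j * (if k = j then gc t $ i else 0)) = (u \<bullet> gc t) * \<eta> $ k"
      by (simp add: inner_vec_def sum_distrib_left mult_ac if_distrib[of "\<lambda>x. _ * x"] cong: if_cong)
    also have "(\<Sum>i\<in>UNIV. \<Sum>j\<in>UNIV. u $ i * \<eta> $ j * (if k = i then gc t $ j else 0)) = (\<eta> \<bullet> gc t) * u $ k"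
      by (subst sum.swap) (simp add: inner_vec_def sum_distrib_left mult_ac if_distrib[of "\<lambda>x. _ * x"] cong: if_cong)
    finally show "(\<Sum>i\<in>UNIV. \<Sum>j\<in>UNIV. (u $ i * \<eta> $ j) *\<^sub>R rotation_field i j (gc t)) $ k
      = (cos t *\<^sub>R \<eta> - sin t *\<^sub>R u) $ k" by (simp add: inner_gc)
  qed
  ultimately show ?thesis by simp
qed

lemma poly_fun_gc_has_vector_derivative:
  assumes "poly_fun L f"
  shows "((\<lambda>t. f (gc t)) has_vector_derivative
    (biform u \<eta> (\<lambda>i j. rder i j f (gc t)))) (at t)"
proof -
  let ?f' = "frechet_derivative f (at (gc t))"
  have f': "(f has_derivative ?f') (at (gc t))" using poly_fun_has_derivative[OF assms] .
  interpret f': bounded_linear ?f' using f' by (rule has_derivative_bounded_linear)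
  have "((f \<circ> gc) has_vector_derivative ?f' (\<Sum>i\<in>UNIV. \<Sum>j\<in>UNIV. (u $ i * \<eta> $ j) *\<^sub>R rotation_field i j (gc t))) (at t)"
    using gc_has_vector_derivative f' by (rule vector_derivative_diff_chain_within[OF _ has_derivative_at_withinI])
  then show ?thesis by (simp add: f'.sum f'.scaleR rder_def o_def scaleR_conv_of_real[where 'a = complex])
qed

lemma trig_poly_gc: "poly_fun L f \<Longrightarrow> trig_poly L (\<lambda>t. f (gc t))"
proof (induction rule: poly_fun.induct)
  case (coord L f i)
  have "trig_poly (1 + L) (\<lambda>t. of_real (u $ i * cos t + \<eta> $ i * sin t) * f (gc t))"
    by (intro trig_poly_mult trig_poly_cos_sin coord.IH)
  then show ?case by (simp add: gc_def mult.commute)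
qed (auto intro: trig_poly_const trig_poly_add)

lemma norm_gc_sum_le:
  fixes a :: "'n \<Rightarrow> 'n \<Rightarrow> complex"
  assumes "\<And>i j. norm (a i j) \<le> B"
  shows "norm (\<Sum>i\<in>UNIV. \<Sum>j\<in>UNIV. of_real (u $ i * \<eta> $ j) * a i j) \<le> (real CARD('n))\<^sup>2 * B"
proof -
  have B: "0 \<le> B" using order.trans[OF norm_ge_zero assms] .
  have "norm (of_real (u $ i * \<eta> $ j) * a i j) \<le> B" for i j
  proof -
    have "\<bar>u $ i\<bar> * \<bar>\<eta> $ j\<bar> \<le> 1 * 1"
      using component_le_norm_cart[of u i] component_le_norm_cart[of \<eta> j] u eta by (intro mult_mono) auto
    then have "(\<bar>u $ i\<bar> * \<bar>\<eta> $ j\<bar>) * norm (a i j) \<le> 1 * B"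
      using B assms by (intro mult_mono) auto
    then show ?thesis by (simp add: norm_mult)
  qed
  then have "norm (\<Sum>i\<in>UNIV. \<Sum>j\<in>UNIV. of_real (u $ i * \<eta> $ j) * a i j) \<le> (\<Sum>i\<in>(UNIV::'n set). \<Sum>j\<in>(UNIV::'n set). B)"
    by (intro order.trans[OF norm_sum] sum_mono)
  then show ?thesis by (simp add: power2_eq_square)
qed

end

section \<open>The Peetre maximal function and its Bernstein inequality\<close>

definition peetre :: "nat \<Rightarrow> real \<Rightarrow> (real^'n \<Rightarrow> complex) \<Rightarrow> real^'n \<Rightarrow> real" where
  "peetre N L f u = (SUP v\<in>unit_sphere. norm (f v) / (1 + L * dist u v) ^ N)"

text \<open>The weight is submultiplicative. The Peetre function inherits this and changes by at
  most a bounded factor over distances of order \<open>1 / L\<close>.\<close>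

lemma one_plus_dist_triangle:
  assumes "L \<ge> 0" shows "1 + L * dist u w \<le> (1 + L * dist u v) * (1 + L * dist v w)"
proof -
  have "L * dist u w \<le> L * (dist u v + dist v w)"
    using assms by (intro mult_left_mono dist_triangle)
  also have "\<dots> \<le> L * dist u v + L * dist v w + (L * dist u v) * (L * dist v w)"
    using assms by (simp add: distrib_left)
  finally show ?thesis by (simp add: algebra_simps)
qed

context
  fixes f :: "real^'n \<Rightarrow> complex" and L :: real and N :: nat
  assumes f: "continuous_on unit_sphere f" and L: "L \<ge> 0"
begin

lemma one_plus_dist_pos: "1 + L * dist u v > 0"
  using L by (simp add: add_pos_nonneg)

lemma peetre_attained:
  obtains v where "norm v = 1" "peetre N L f u = norm (f v) / (1 + L * dist u v) ^ N"
    "\<And>w. norm w = 1 \<Longrightarrow> norm (f w) / (1 + L * dist u w) ^ N \<le> norm (f v) / (1 + L * dist u v) ^ N"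
proof -
  have "continuous_on unit_sphere (\<lambda>v. norm (f v) / (1 + L * dist u v) ^ N)"
  proof (intro continuous_intros f)
    show "\<forall>v\<in>unit_sphere. (1 + L * dist u v) ^ N \<noteq> 0"
      using zero_less_power[OF one_plus_dist_pos] by (metis less_irrefl)
  qed
  moreover have "unit_sphere \<noteq> ({} :: (real^'n) set)" by simp
  ultimately have "\<exists>v\<in>unit_sphere. \<forall>w\<in>unit_sphere. norm (f w) / (1 + L * dist u w) ^ N \<le> norm (f v) / (1 + L * dist u v) ^ N"
    by (intro continuous_attains_sup compact_sphere)
  then obtain v where v: "v \<in> unit_sphere"
    "\<And>w. w \<in> unit_sphere \<Longrightarrow> norm (f w) / (1 + L * dist u w) ^ N \<le> norm (f v) / (1 + L * dist u v) ^ N"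
    by blast
  then have "peetre N L f u = norm (f v) / (1 + L * dist u v) ^ N"
    unfolding peetre_def by (intro cSup_eq_maximum) auto
  with v that show thesis by simp
qed

lemma norm_le_peetre:
  assumes "norm v = 1" shows "norm (f v) \<le> peetre N L f u * (1 + L * dist u v) ^ N"
proof -
  obtain w where "norm (f v) / (1 + L * dist u v) ^ N \<le> peetre N L f u"
    using peetre_attained[of u] assms by metis
  then show ?thesis using zero_less_power[OF one_plus_dist_pos, of u v N] by (simp add: pos_divide_le_eq)
qed

lemma norm_le_peetre_same: "norm u = 1 \<Longrightarrow> norm (f u) \<le> peetre N L f u"
  using norm_le_peetre[of u u] by simp

lemma peetre_le:
  assumes "\<And>v. norm v = 1 \<Longrightarrow> norm (f v) \<le> B * (1 + L * dist u v) ^ N"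
  shows "peetre N L f u \<le> B"
proof -
  obtain v where "norm v = 1" "peetre N L f u = norm (f v) / (1 + L * dist u v) ^ N"
    using peetre_attained[of u] by metis
  then show ?thesis using assms[of v] zero_less_power[OF one_plus_dist_pos, of u v N] by (simp add: pos_divide_le_eq)
qed

lemma peetre_nonneg: "0 \<le> peetre N L f u"
proof -
  obtain v where "peetre N L f u = norm (f v) / (1 + L * dist u v) ^ N"
    using peetre_attained[of u] by metis
  then show ?thesis using L by simp
qed

lemma peetre_triangle: "peetre N L f u \<le> (1 + L * dist u v) ^ N * peetre N L f v"
proof (rule peetre_le)
  fix w :: "real^'n" assume "norm w = 1"
  then have "norm (f w) \<le> peetre N L f v * (1 + L * dist v w) ^ N" by (rule norm_le_peetre)
  also have "\<dots> \<le> peetre N L f v * ((1 + L * dist v u) * (1 + L * dist u w)) ^ N"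
    using one_plus_dist_triangle[OF L] L peetre_nonneg by (intro mult_left_mono power_mono) auto
  finally show "norm (f w) \<le> (1 + L * dist u v) ^ N * peetre N L f v * (1 + L * dist u w) ^ N"
    by (simp add: power_mult_distrib mult_ac dist_commute)
qed

lemma peetre_near:
  assumes "L * dist u v \<le> R" shows "peetre N L f u \<le> (1 + R) ^ N * peetre N L f v"
proof -
  have "(1 + L * dist u v) ^ N * peetre N L f v \<le> (1 + R) ^ N * peetre N L f v"
    using assms L peetre_nonneg by (intro mult_right_mono power_mono) auto
  then show ?thesis using peetre_triangle[of u v] by simp
qed

lemma continuous_on_peetre: "continuous_on S (peetre N L f)"
  unfolding continuous_on_def
proof
  fix u assume "u \<in> S"
  have lim: "((\<lambda>v. (1 + L * dist u v) ^ N) \<longlongrightarrow> (1 + L * dist u u) ^ N) (at u within S)"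
    by (intro tendsto_intros)
  show "(peetre N L f \<longlongrightarrow> peetre N L f u) (at u within S)"
  proof (rule tendsto_sandwich)
    show "\<forall>\<^sub>F v in at u within S. peetre N L f u / (1 + L * dist u v) ^ N \<le> peetre N L f v"
      using peetre_triangle[of u] zero_less_power[OF one_plus_dist_pos, of u _ N]
      by (simp add: pos_divide_le_eq mult.commute)
    show "\<forall>\<^sub>F v in at u within S. peetre N L f v \<le> (1 + L * dist u v) ^ N * peetre N L f u"
      using peetre_triangle[of _ u] by (simp add: dist_commute)
    show "((\<lambda>v. peetre N L f u / (1 + L * dist u v) ^ N) \<longlongrightarrow> peetre N L f u) (at u within S)"
      using tendsto_divide[OF tendsto_const lim] by simp
    show "((\<lambda>v. (1 + L * dist u v) ^ N * peetre N L f u) \<longlongrightarrow> peetre N L f u) (at u within S)"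
      using tendsto_mult[OF lim tendsto_const] by simp
  qed
qed

end

text \<open>Twice the constant of \<open>weighted_bernstein_at_0\<close> apart from the factor
  \<open>L\<close>, since a rotation field has length at most 2 on the sphere.\<close>

definition bern_const :: "nat \<Rightarrow> real" where "bern_const N = 20 * real (Suc N) * 3 ^ N"

lemma bern_const_pos: "bern_const N > 0" by (simp add: bern_const_def)

text \<open>At a fixed point a rotational derivative is \<open>s\<close> times the derivative along
  one great circle, where one-dimensional estimates apply. Later \<open>s \<le> 2\<close> serves in
  both directions: for upper bounds on \<open>rder\<close>, and for lower bounds on the derivative
  along the circle.\<close>

lemma rotation_field_direction:
  fixes u :: "real^'n"
  assumes u: "norm u = 1" and ne: "rotation_field i j u \<noteq> 0" and f: "poly_fun L f"
  obtains \<eta> s where "great_circle u \<eta>" "0 < s" "s \<le> 2"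
    "rder i j f u = of_real s * (biform u \<eta> (\<lambda>i j. rder i j f u))"
proof -
  define \<xi> where "\<xi> = rotation_field i j u"
  define \<eta> where "\<eta> = (1 / norm \<xi>) *\<^sub>R \<xi>"
  have \<xi>: "norm \<xi> > 0" using ne by (simp add: \<xi>_def)
  have "u \<bullet> \<xi> = 0" by (simp add: \<xi>_def rotation_field_def inner_diff_right inner_axis)
  then interpret great_circle u \<eta> using \<xi> u by unfold_locales (auto simp: \<eta>_def)
  have "norm \<xi> \<le> norm (u $ i *\<^sub>R axis j (1::real)) + norm (u $ j *\<^sub>R axis i (1::real) :: real^'n)"
    unfolding \<xi>_def rotation_field_def by (rule norm_triangle_ineq4)
  also have "\<dots> \<le> 2" using component_le_norm_cart[of u i] component_le_norm_cart[of u j] u by simp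
  finally have le: "norm \<xi> \<le> 2" .
  let ?f' = "frechet_derivative f (at u)"
  have f': "(f has_derivative ?f') (at u)" using poly_fun_has_derivative[OF f] .
  interpret f': bounded_linear ?f' using f' by (rule has_derivative_bounded_linear)
  have "(gc has_vector_derivative (cos 0 *\<^sub>R \<eta> - sin 0 *\<^sub>R u)) (at 0)"
    unfolding gc_def[abs_def] by (auto intro!: derivative_eq_intros)
  \<comment> \<open>Two computations of the velocity of the circle at 0 are compared, which
    expresses \<open>\<eta>\<close> through the rotation fields at \<open>u\<close>.\<close>
  then have "(\<Sum>k\<in>UNIV. \<Sum>l\<in>UNIV. (u $ k * \<eta> $ l) *\<^sub>R rotation_field k l u) = \<eta>"
    using vector_derivative_unique_at[OF gc_has_vector_derivative[of 0]] by simp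
  from arg_cong[OF this, of ?f']
  have "?f' \<eta> = (biform u \<eta> (\<lambda>i j. rder i j f u))"
    by (simp add: f'.sum f'.scaleR rder_def scaleR_conv_of_real[where 'a = complex])
  moreover have "rder i j f u = of_real (norm \<xi>) * ?f' \<eta>"
    using \<xi> by (simp add: rder_def \<eta>_def f'.scaleR \<xi>_def[symmetric] scaleR_conv_of_real[where 'a = complex])
  ultimately show thesis using that[of \<eta> "norm \<xi>"] \<xi> le great_circle_axioms by simp
qed

lemma rder_zero_field: "rotation_field i j u = 0 \<Longrightarrow> poly_fun L f \<Longrightarrow> rder i j f u = 0"
  unfolding rder_def using linear_0[OF has_derivative_linear[OF poly_fun_has_derivative]] by simp

lemma norm_rder_le_peetre:
  fixes f :: "real^'n \<Rightarrow> complex"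
  assumes f: "poly_fun L f" and L: "L \<ge> 1" and u: "norm u = 1"
  shows "norm (rder i j f u) \<le> bern_const N * real L * peetre N L f u"
proof (cases "rotation_field i j u = 0")
  case True
  then show ?thesis
    using rder_zero_field[OF True f] peetre_nonneg[OF poly_fun_continuous[OF f], of L N u] bern_const_pos[of N] by simp
next
  case False
  from rotation_field_direction[OF u False f] obtain \<eta> s where
    gc: "great_circle u \<eta>" and s: "0 < s" "s \<le> 2"
    and eq: "rder i j f u = of_real s * (biform u \<eta> (\<lambda>i j. rder i j f u))" by blast
  interpret great_circle u \<eta> by fact
  let ?S = "biform u \<eta> (\<lambda>i j. rder i j f u)"
  have "norm ?S \<le> 10 * real (Suc N) * 3 ^ N * real L * peetre N L f u"
  proof (rule weighted_bernstein_at_0)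
    show "trig_poly L (\<lambda>t. f (gc t))" using f by (rule trig_poly_gc)
    show "((\<lambda>t. f (gc t)) has_vector_derivative ?S) (at 0)"
      using poly_fun_gc_has_vector_derivative[OF f, of 0] by simp
    show "norm (f (gc t)) \<le> peetre N L f u * (1 + real L * sqrt (2 * (1 - cos t))) ^ N" for t
      using norm_le_peetre[OF poly_fun_continuous[OF f], of L "gc t" N u] by (simp add: dist_gc)
  qed fact
  then have "s * norm ?S \<le> 2 * (10 * real (Suc N) * 3 ^ N * real L * peetre N L f u)"
    using s by (intro mult_mono) auto
  moreover have "norm (rder i j f u) = s * norm ?S" unfolding eq norm_mult using s by simp
  ultimately show ?thesis unfolding bern_const_def by linarith
qed

text \<open>The pointwise bound is fed back into the supremum. Having the Peetre function on both
  sides is what allows the estimate to be iterated.\<close>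

lemma peetre_rder_le:
  assumes f: "poly_fun L f" and L: "L \<ge> 1"
  shows "peetre N L (rder i j f) u \<le> bern_const N * real L * peetre N L f u"
proof (rule peetre_le)
  show "continuous_on unit_sphere (rder i j f)" using poly_fun_continuous[OF poly_fun_rder[OF f]] .
  fix v :: "real^'a" assume v: "norm v = 1"
  have "norm (rder i j f v) \<le> bern_const N * real L * peetre N L f v"
    by (rule norm_rder_le_peetre) fact+
  also have "\<dots> \<le> bern_const N * real L * ((1 + real L * dist v u) ^ N * peetre N L f u)"
    using bern_const_pos[of N] by (intro mult_left_mono peetre_triangle poly_fun_continuous[OF f]) auto
  finally show "norm (rder i j f v) \<le> bern_const N * real L * peetre N L f u * (1 + real L * dist u v) ^ N"
    by (simp add: mult_ac dist_commute)
qed simp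

section \<open>Iterated rotational derivatives and their variation along great circles\<close>

primrec rders :: "('n \<times> 'n) list \<Rightarrow> (real^'n \<Rightarrow> complex) \<Rightarrow> real^'n \<Rightarrow> complex" where
  "rders [] f = f"
| "rders (p # w) f = rder (fst p) (snd p) (rders w f)"

lemma poly_fun_rders: "poly_fun L f \<Longrightarrow> poly_fun L (rders w f)"
  by (induction w) (auto intro: poly_fun_rder)

lemma peetre_rders_le:
  assumes f: "poly_fun L f" and L: "L \<ge> 1"
  shows "peetre N L (rders w f) u \<le> (bern_const N * real L) ^ length w * peetre N L f u"
proof (induction w)
  case (Cons p w)
  have "peetre N L (rders (p # w) f) u \<le> bern_const N * real L * peetre N L (rders w f) u"
    using peetre_rder_le[OF poly_fun_rders[OF f] L] by simp
  also have "\<dots> \<le> bern_const N * real L * ((bern_const N * real L) ^ length w * peetre N L f u)"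
    using Cons bern_const_pos[of N] by (intro mult_left_mono) auto
  finally show ?case by (simp add: mult.assoc)
qed simp

lemma norm_rders_le_peetre:
  assumes f: "poly_fun L f" and L: "L \<ge> 1" and u: "norm u = 1"
  shows "norm (rders w f u) \<le> (bern_const N * real L) ^ length w * peetre N L f u"
  using norm_le_peetre_same[OF poly_fun_continuous[OF poly_fun_rders[OF f]] _ u] peetre_rders_le[OF f L, of N w u]
  by (meson of_nat_0_le_iff order.trans)

lemma norm_rders_near:
  fixes f :: "real^'n \<Rightarrow> complex"
  assumes f: "poly_fun L f" and L: "L \<ge> 1" and x: "norm x = 1" and near: "real L * dist u x \<le> R"
  shows "norm (rders w f x) \<le> (bern_const N * real L) ^ length w * ((1 + R) ^ N * peetre N L f u)"
proof -
  have "norm (rders w f x) \<le> (bern_const N * real L) ^ length w * peetre N L f x"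
    by (rule norm_rders_le_peetre) fact+
  also have "\<dots> \<le> (bern_const N * real L) ^ length w * ((1 + R) ^ N * peetre N L f u)"
    using bern_const_pos[of N] near
    by (intro mult_left_mono peetre_near poly_fun_continuous[OF f]) (auto simp: dist_commute)
  finally show ?thesis .
qed

lemma rders_lipschitz:
  fixes f :: "real^'n \<Rightarrow> complex"
  assumes n: "CARD('n) \<ge> 2" and f: "poly_fun L f" and L: "L \<ge> 1"
    and u: "norm u = 1" and v: "norm v = 1" and uv: "real L * dist u v \<le> 1"
  shows "norm (rders w f v - rders w f u)
    \<le> 2 * (real CARD('n))\<^sup>2 * 3 ^ N * bern_const N ^ Suc (length w) * real L ^ length w
       * peetre N L f u * (real L * dist u v)"
proof -
  obtain \<eta> t where \<eta>: "norm \<eta> = 1" "u \<bullet> \<eta> = 0" and t: "0 \<le> t" "t \<le> 2 * dist u v"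
    and v_eq: "v = cos t *\<^sub>R u + sin t *\<^sub>R \<eta>"
    using great_circle_param[OF n u v] by blast
  interpret great_circle u \<eta> using u \<eta> by unfold_locales
  define B where "B = (bern_const N * real L) ^ Suc (length w) * (3 ^ N * peetre N L f u)"
  have B0: "0 \<le> B"
    using bern_const_pos[of N] peetre_nonneg[OF poly_fun_continuous[OF f]] by (simp add: B_def)
  have v_gc: "v = gc t" using v_eq by (simp add: gc_def)
  note wf = poly_fun_rders[OF f, of w]
  \<comment> \<open>The arc parameter may reach twice the chord, so points of the arc are within
    \<open>2 / L\<close> of \<open>u\<close>; this is the origin of \<open>3 ^ N\<close>.\<close>
  have bnd: "norm (rder i j (rders w f) (gc s)) \<le> B" if "0 < s" "s < t" for i j s
  proof -
    have "real L * dist u (gc s) \<le> real L * (2 * dist u v)"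
      using dist_gc_le[of s] that t by (intro mult_left_mono) auto
    also have "\<dots> \<le> 2" using uv by simp
    finally have "real L * dist u (gc s) \<le> 2" .
    from norm_rders_near[OF f L norm_gc this, of "(i, j) # w" N] show ?thesis by (simp add: B_def)
  qed
  have "norm (rders w f (gc t) - rders w f (gc 0)) \<le> (real CARD('n))\<^sup>2 * B * t"
  proof (cases "t = 0")
    case False
    then have "norm (rders w f (gc t) - rders w f (gc 0)) \<le> (real CARD('n))\<^sup>2 * B * t - (real CARD('n))\<^sup>2 * B * 0"
    proof (intro differentiable_bound_general)
      show "continuous_on {0..t} (\<lambda>s. rders w f (gc s))"
        by (intro continuous_at_imp_continuous_on ballI
            has_vector_derivative_continuous[OF poly_fun_gc_has_vector_derivative[OF wf]])
      fix s assume s: "0 < s" "s < t"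
      show "((\<lambda>s. rders w f (gc s)) has_vector_derivative
        (biform u \<eta> (\<lambda>i j. rder i j (rders w f) (gc s)))) (at s)"
        by (rule poly_fun_gc_has_vector_derivative[OF wf])
      show "norm (biform u \<eta> (\<lambda>i j. rder i j (rders w f) (gc s)))
        \<le> (real CARD('n))\<^sup>2 * B"
        using bnd[OF s] by (rule norm_gc_sum_le)
      show "((*) ((real CARD('n))\<^sup>2 * B) has_vector_derivative (real CARD('n))\<^sup>2 * B) (at s)"
        by (auto intro!: derivative_eq_intros)
    qed (use t in \<open>auto intro!: continuous_intros\<close>)
    then show ?thesis by simp
  qed simp
  also have "\<dots> \<le> (real CARD('n))\<^sup>2 * B * (2 * dist u v)"
    using t B0 by (intro mult_left_mono) auto
  finally show ?thesis
    unfolding v_gc[symmetric] gc_0 B_def by (simp add: power_mult_distrib mult_ac)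
qed

text \<open>A large rotational derivative means a large derivative \<open>T1 0\<close> along some
  great circle. Integrating the bound \<open>h\<close> for the second derivative twice gives linear
  growth with a quadratic error, for all steps \<open>\<tau> / L\<close> at once. The loss of
  \<open>\<delta>\<close> to \<open>\<delta> / 2\<close> comes from the length
  \<open>s \<le> 2\<close> of the rotation field.\<close>

lemma rders_second_order:
  fixes f :: "real^'n \<Rightarrow> complex"
  assumes f: "poly_fun L f" and L: "L \<ge> 1" and u: "norm u = 1"
    and P: "peetre N L f u > 0" and \<delta>: "\<delta> > 0"
    and large: "norm (rder i j (rders w f) u) \<ge> \<delta> * real L * real L ^ length w * peetre N L f u"
    and H: "H = (real CARD('n))\<^sup>2 * (real CARD('n))\<^sup>2 * bern_const N ^ Suc (Suc (length w)) * 2 ^ N"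
  obtains \<eta> where "great_circle u \<eta>"
    "\<And>\<tau>. 0 < \<tau> \<Longrightarrow> \<tau> \<le> 1 \<Longrightarrow> norm (rders w f (great_circle.gc u \<eta> (\<tau> / real L))) \<ge>
       (\<delta> / 2 * \<tau> - H * \<tau>\<^sup>2) * (real L ^ length w * peetre N L f u) - norm (rders w f u)"
proof -
  note wf = poly_fun_rders[OF f, of w]
  have "rotation_field i j u \<noteq> 0"
  proof
    assume "rotation_field i j u = 0"
    then have "rder i j (rders w f) u = 0" using rder_zero_field[OF _ wf] by blast
    moreover have "0 < \<delta> * real L * real L ^ length w * peetre N L f u" using \<delta> L P by simp
    ultimately show False using large by simp
  qed
  from rotation_field_direction[OF u this wf] obtain \<eta> s where
    gc: "great_circle u \<eta>" and s: "0 < s" "s \<le> 2"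
    and eq: "rder i j (rders w f) u = of_real s * (biform u \<eta> (\<lambda>i j. rder i j (rders w f) u))"
    by blast
  interpret great_circle u \<eta> by fact
  define T where "T t = rders w f (gc t)" for t
  define T1 where "T1 t = (biform u \<eta> (\<lambda>i j. rder i j (rders w f) (gc t)))" for t
  define T2 where "T2 t = (\<Sum>k\<in>UNIV. \<Sum>l\<in>UNIV. of_real (u $ k * \<eta> $ l) *
    (\<Sum>a\<in>UNIV. \<Sum>b\<in>UNIV. of_real (u $ a * \<eta> $ b) * rder a b (rder k l (rders w f)) (gc t)))" for t
  define h where "h = (real CARD('n))\<^sup>2 * ((real CARD('n))\<^sup>2 * ((bern_const N * real L) ^ Suc (Suc (length w)) * (2 ^ N * peetre N L f u)))"
  have dT: "(T has_vector_derivative T1 t) (at t)" for t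
    unfolding T_def T1_def by (rule poly_fun_gc_has_vector_derivative[OF wf])
  have dT1: "(T1 has_vector_derivative T2 t) (at t)" for t
    unfolding T1_def T2_def
    by (intro has_vector_derivative_sum has_vector_derivative_mult_right
        poly_fun_gc_has_vector_derivative[OF poly_fun_rder[OF wf]])
  have T2_le: "norm (T2 t) \<le> h" if "0 < t" "t \<le> 1 / real L" for t
    unfolding T2_def h_def
  proof (rule norm_gc_sum_le, rule norm_gc_sum_le)
    fix k l a b
    have "real L * dist u (gc t) \<le> real L * (1 / real L)"
      using dist_gc_le[of t] that by (intro mult_left_mono) auto
    then have "real L * dist u (gc t) \<le> 1" using L by simp
    from norm_rders_near[OF f L norm_gc this, of "(a, b) # (k, l) # w" N]
    show "norm (rder a b (rder k l (rders w f)) (gc t))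
      \<le> (bern_const N * real L) ^ Suc (Suc (length w)) * (2 ^ N * peetre N L f u)" by simp
  qed
  have T1_diff: "norm (T1 t - T1 0) \<le> h * t" if "0 < t" "t \<le> 1 / real L" for t
  proof -
    have "norm (T1 t - T1 0) \<le> h * t - h * 0"
    proof (rule differentiable_bound_general[where f' = T2 and \<phi>' = "\<lambda>_. h"])
      show "continuous_on {0..t} T1"
        by (intro continuous_at_imp_continuous_on ballI has_vector_derivative_continuous[OF dT1])
      show "norm (T2 x) \<le> h" if "0 < x" "x < t" for x
        using that \<open>t \<le> 1 / real L\<close> by (intro T2_le) auto
    qed (use that dT1 in \<open>auto intro!: continuous_intros derivative_eq_intros\<close>)
    then show ?thesis by simp
  qed
  have T_diff: "norm (T t - T 0 - t *\<^sub>R T1 0) \<le> h * t\<^sup>2" if t: "0 < t" "t \<le> 1 / real L" for t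
  proof -
    have "norm ((T t - t *\<^sub>R T1 0) - (T 0 - 0 *\<^sub>R T1 0)) \<le> h * t * t - h * t * 0"
    proof (rule differentiable_bound_general[where f' = "\<lambda>x. T1 x - T1 0" and \<phi>' = "\<lambda>_. h * t"])
      show "continuous_on {0..t} (\<lambda>x. T x - x *\<^sub>R T1 0)"
        by (intro continuous_intros continuous_at_imp_continuous_on ballI has_vector_derivative_continuous[OF dT])
      show "norm (T1 x - T1 0) \<le> h * t" if x: "0 < x" "x < t" for x
      proof -
        have "0 \<le> h" using order.trans[OF norm_ge_zero T2_le[OF t]] .
        then have "h * x \<le> h * t" using x by (intro mult_left_mono) auto
        then show ?thesis using T1_diff[of x] x t by simp
      qed
    qed (use t dT in \<open>auto intro!: continuous_intros derivative_eq_intros\<close>)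
    then show ?thesis by (simp add: power2_eq_square mult.assoc algebra_simps)
  qed
  define S where "S = norm (T1 0)"
  have "norm (rder i j (rders w f) u) = s * S"
    using s by (simp add: eq norm_mult T1_def S_def)
  also have "\<dots> \<le> 2 * S" using s by (intro mult_right_mono) (auto simp: S_def)
  finally have S: "S \<ge> \<delta> / 2 * (real L * (real L ^ length w * peetre N L f u))"
    using large by (simp add: mult_ac)
  have "norm (T (\<tau> / real L)) \<ge>
       (\<delta> / 2 * \<tau> - H * \<tau>\<^sup>2) * (real L ^ length w * peetre N L f u) - norm (T 0)"
    if \<tau>: "0 < \<tau>" "\<tau> \<le> 1" for \<tau>
  proof -
    define t where "t = \<tau> / real L"
    have t: "0 < t" "t \<le> 1 / real L" using \<tau> L by (auto simp: t_def field_simps)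
    have "t * S = norm (t *\<^sub>R T1 0)" using t by (simp add: S_def)
    also have "t *\<^sub>R T1 0 = T t - T 0 - (T t - T 0 - t *\<^sub>R T1 0)" by simp
    also have "norm \<dots> \<le> (norm (T t) + norm (T 0)) + h * t\<^sup>2"
      using T_diff[OF t] norm_triangle_ineq4[of "T t - T 0" "T t - T 0 - t *\<^sub>R T1 0"] norm_triangle_ineq4[of "T t" "T 0"]
      by linarith
    finally have 1: "t * S \<le> norm (T t) + norm (T 0) + h * t\<^sup>2" .
    have "t * (\<delta> / 2 * (real L * (real L ^ length w * peetre N L f u))) \<le> t * S"
      using S t by (intro mult_left_mono) auto
    then have 2: "\<delta> / 2 * \<tau> * (real L ^ length w * peetre N L f u) \<le> t * S"
      using L by (simp add: t_def field_simps)
    have 3: "h * t\<^sup>2 = H * \<tau>\<^sup>2 * (real L ^ length w * peetre N L f u)"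
      using L by (simp add: h_def H t_def power_mult_distrib power_divide power2_eq_square field_simps)
    show ?thesis using 1 2 unfolding 3 t_def[symmetric] by (simp add: algebra_simps)
  qed
  then show thesis using that[OF gc] by (simp add: T_def)
qed

text \<open>The strict bound \<open>i < k\<close> makes the index drop by exactly one under
  differentiation, down to the empty sum 0. The bound by \<open>exp\<close>, uniform in
  \<open>k\<close>, keeps the factor of \<open>\<delta>\<close> in Taylor's formula independent of
  the order.\<close>

definition exp_partial :: "nat \<Rightarrow> real \<Rightarrow> real" where
  "exp_partial k x = (\<Sum>i<k. x ^ i / fact i)"

lemma DERIV_power_div_fact: "((\<lambda>x. x ^ Suc k / fact (Suc k)) has_real_derivative x ^ k / fact k) (at x)"
proof -
  have "((\<lambda>x. x ^ Suc k / fact (Suc k)) has_real_derivative real (Suc k) * x ^ k / fact (Suc k)) (at x)"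
    using DERIV_cdivide[OF DERIV_pow[of "Suc k" x UNIV], of "fact (Suc k)"]
    by (simp only: diff_Suc_Suc diff_zero)
  moreover have "real (Suc k) * x ^ k / fact (Suc k) = x ^ k / fact k"
    unfolding fact_Suc by (simp del: of_nat_Suc)
  ultimately show ?thesis by simp
qed

lemma DERIV_exp_partial: "(exp_partial (Suc k) has_real_derivative exp_partial k x) (at x)"
proof (induction k)
  case 0
  then show ?case by (simp add: exp_partial_def[abs_def])
next
  case (Suc k)
  from DERIV_add[OF Suc DERIV_power_div_fact[of k x]] show ?case by (simp add: exp_partial_def[abs_def])
qed

lemma exp_partial_le: assumes "0 \<le> x" shows "exp_partial k x \<le> exp x"
proof -
  have "(\<lambda>i. x ^ i / fact i) sums exp x"
    using exp_converges[of x] by (simp only: real_scaleR_def divide_real_def mult.commute)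
  then show ?thesis
    using assms sum_le_suminf[of "\<lambda>i. x ^ i / fact i" "{..<k}"]
    by (simp add: exp_partial_def sums_iff)
qed

text \<open>Taylor's formula along a great circle, organised as a downward induction on the order of the
  derivatives.\<close>

lemma taylor_bound:
  fixes f :: "real^'n \<Rightarrow> complex"
  assumes n: "CARD('n) \<ge> 2" and f: "poly_fun L f" and L: "L \<ge> 1"
    and u: "norm u = 1" and v: "norm v = 1" and uv: "real L * dist u v \<le> R" and \<delta>: "\<delta> \<ge> 0"
    and small: "\<And>w. length w < m \<Longrightarrow> norm (rders w f u) \<le> \<delta> * real L ^ length w * peetre N L f u"
  shows "norm (f v) \<le> (\<delta> * exp ((real CARD('n))\<^sup>2 * (2 * R))
     + (1 + 2 * R) ^ N * ((bern_const N * (real CARD('n))\<^sup>2 * (2 * R)) ^ m / fact m)) * peetre N L f u"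
proof -
  obtain \<eta> t0 where \<eta>: "norm \<eta> = 1" "u \<bullet> \<eta> = 0" and t0: "0 \<le> t0" "t0 \<le> 2 * dist u v"
    and v_eq: "v = cos t0 *\<^sub>R u + sin t0 *\<^sub>R \<eta>"
    using great_circle_param[OF n u v] by blast
  interpret great_circle u \<eta> using u \<eta> by unfold_locales
  have v_gc: "v = gc t0" using v_eq by (simp add: gc_def)
  define P where "P = peetre N L f u"
  have P0: "0 \<le> P" using peetre_nonneg[OF poly_fun_continuous[OF f]] by (simp add: P_def)
  define a where "a = (real CARD('n))\<^sup>2 * real L"
  define B where "B = bern_const N ^ m * (1 + 2 * R) ^ N"
  \<comment> \<open>The majorant for derivatives of order \<open>m - k\<close>:
    \<open>\<phi> 0\<close> is the constant \<open>B\<close> from Bernstein's inequality, and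
    \<open>\<phi> (Suc k)\<close> has initial value \<open>\<delta>\<close> and derivative
    \<open>a * \<phi> k\<close>, matching one integration along the circle.\<close>
  define \<phi> where "\<phi> k t = \<delta> * exp_partial k (a * t) + B * ((a * t) ^ k / fact k)" for k t
  have R0: "0 \<le> R" using uv zero_le_dist[of u v] by (meson mult_nonneg_nonneg of_nat_0_le_iff order.trans)
  have t0R: "real L * t0 \<le> 2 * R"
    using mult_left_mono[OF t0(2), of "real L"] uv by simp
  have claim: "norm (rders w f (gc t)) \<le> real L ^ length w * P * \<phi> k t"
    if "k \<le> m" "length w = m - k" "0 \<le> t" "t \<le> t0" for k w t
    using that
  proof (induction k arbitrary: w t)
    case 0
    have "real L * dist u (gc t) \<le> real L * t0"
      using dist_gc_le[of t] 0 by (intro mult_left_mono) auto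
    then have "real L * dist u (gc t) \<le> 2 * R" using t0R by simp
    from norm_rders_near[OF f L norm_gc this, of w N] show ?case
      using 0 by (simp add: \<phi>_def exp_partial_def B_def P_def power_mult_distrib mult_ac)
  next
    case (Suc k)
    note wf = poly_fun_rders[OF f, of w]
    have w: "length w < m" "Suc (length w) = m - k" using Suc.prems by auto
    have \<phi>0: "\<phi> (Suc k) 0 = \<delta>"
    proof -
      have "exp_partial (Suc k) 0 = 1" by (simp add: exp_partial_def lessThan_Suc_eq_insert_0 sum.reindex)
      then show ?thesis by (simp add: \<phi>_def)
    qed
    have d\<phi>: "((\<phi> (Suc k)) has_real_derivative a * \<phi> k s) (at s)" for s
    proof -
      have 1: "((\<lambda>s. exp_partial (Suc k) (a * s)) has_real_derivative exp_partial k (a * s) * a) (at s)"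
        by (rule DERIV_chain2[OF DERIV_exp_partial]) (auto intro!: derivative_eq_intros)
      have 2: "((\<lambda>s. (a * s) ^ Suc k / fact (Suc k)) has_real_derivative ((a * s) ^ k / fact k) * a) (at s)"
        by (rule DERIV_chain2[OF DERIV_power_div_fact]) (auto intro!: derivative_eq_intros)
      from DERIV_add[OF DERIV_cmult[OF 1, of \<delta>] DERIV_cmult[OF 2, of B]]
      show ?thesis unfolding \<phi>_def[abs_def] by (rule DERIV_cong) (simp add: algebra_simps)
    qed
    have base: "norm (rders w f (gc 0)) \<le> real L ^ length w * P * \<phi> (Suc k) 0"
      using small[OF w(1)] by (simp add: \<phi>0 P_def mult_ac)
    show ?case
    proof (cases "t = 0")
      case True then show ?thesis using base by simp
    next
      case False
      have "norm (rders w f (gc t) - rders w f (gc 0))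
        \<le> real L ^ length w * P * \<phi> (Suc k) t - real L ^ length w * P * \<phi> (Suc k) 0"
      proof (rule differentiable_bound_general)
        show "0 < t" using False Suc.prems by simp
        show "continuous_on {0..t} (\<lambda>s. rders w f (gc s))"
          by (intro continuous_at_imp_continuous_on ballI
              has_vector_derivative_continuous[OF poly_fun_gc_has_vector_derivative[OF wf]])
        show "continuous_on {0..t} (\<lambda>s. real L ^ length w * P * \<phi> (Suc k) s)"
          using DERIV_isCont[OF d\<phi>] by (intro continuous_intros continuous_at_imp_continuous_on) auto
        fix s assume s: "0 < s" "s < t"
        show "((\<lambda>s. rders w f (gc s)) has_vector_derivative
          (biform u \<eta> (\<lambda>i j. rder i j (rders w f) (gc s)))) (at s)"
          by (rule poly_fun_gc_has_vector_derivative[OF wf])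
        show "((\<lambda>s. real L ^ length w * P * \<phi> (Suc k) s) has_vector_derivative
          real L ^ length w * P * (a * \<phi> k s)) (at s)"
          using DERIV_cmult[OF d\<phi>] by (simp add: has_real_derivative_iff_has_vector_derivative)
        have "norm (biform u \<eta> (\<lambda>i j. rder i j (rders w f) (gc s)))
          \<le> (real CARD('n))\<^sup>2 * (real L ^ Suc (length w) * P * \<phi> k s)"
        proof (rule norm_gc_sum_le)
          fix i j
          show "norm (rder i j (rders w f) (gc s)) \<le> real L ^ Suc (length w) * P * \<phi> k s"
          proof -
            have "norm (rders ((i, j) # w) f (gc s)) \<le> real L ^ length ((i, j) # w) * P * \<phi> k s"
              by (rule Suc.IH) (use Suc.prems w s in auto)
            then show ?thesis by simp
          qed
        qed
        then show "norm (biform u \<eta> (\<lambda>i j. rder i j (rders w f) (gc s)))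
          \<le> real L ^ length w * P * (a * \<phi> k s)"
          by (simp add: a_def mult_ac)
      qed
      moreover have "norm (rders w f (gc t)) \<le> norm (rders w f (gc t) - rders w f (gc 0)) + norm (rders w f (gc 0))"
        by (metis diff_add_cancel norm_triangle_ineq)
      ultimately show ?thesis using base by linarith
    qed
  qed
  have at: "0 \<le> a * t0" "a * t0 \<le> (real CARD('n))\<^sup>2 * (2 * R)"
    using t0 t0R by (auto simp: a_def mult.assoc intro!: mult_left_mono)
  have "norm (f v) \<le> P * \<phi> m t0" using claim[of m "[]" t0] t0 by (simp add: v_gc)
  moreover have "\<phi> m t0 \<le> \<delta> * exp ((real CARD('n))\<^sup>2 * (2 * R))
     + (1 + 2 * R) ^ N * ((bern_const N * (real CARD('n))\<^sup>2 * (2 * R)) ^ m / fact m)"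
  proof -
    have "exp_partial m (a * t0) \<le> exp ((real CARD('n))\<^sup>2 * (2 * R))"
      using exp_partial_le[OF at(1), of m] at(2) by (meson exp_le_cancel_iff order.trans)
    moreover have "B * ((a * t0) ^ m / fact m) \<le> B * (((real CARD('n))\<^sup>2 * (2 * R)) ^ m / fact m)"
      using at R0 bern_const_pos[of N] by (intro mult_left_mono divide_right_mono power_mono) (auto simp: B_def)
    moreover have "B * (((real CARD('n))\<^sup>2 * (2 * R)) ^ m / fact m)
      = (1 + 2 * R) ^ N * ((bern_const N * (real CARD('n))\<^sup>2 * (2 * R)) ^ m / fact m)"
      by (simp add: B_def power_mult_distrib)
    ultimately show ?thesis using \<delta> unfolding \<phi>_def by (intro add_mono mult_left_mono) auto
  qed
  then have "P * \<phi> m t0 \<le> P * (\<delta> * exp ((real CARD('n))\<^sup>2 * (2 * R))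
     + (1 + 2 * R) ^ N * ((bern_const N * (real CARD('n))\<^sup>2 * (2 * R)) ^ m / fact m))"
    using P0 by (rule mult_left_mono)
  ultimately show ?thesis unfolding P_def by (simp only: mult.commute)
qed

subsection \<open>The integral of the Peetre maximal function\<close>

context sphere_measure
begin

lemma integrable_continuous_on_sphere:
  fixes f :: "real^'n \<Rightarrow> real"
  assumes "continuous_on unit_sphere f" shows "integrable \<mu> f"
proof -
  have "bounded (f ` unit_sphere)"
    using compact_imp_bounded[OF compact_continuous_image[OF assms compact_sphere]] .
  then obtain B where "\<And>x. x \<in> unit_sphere \<Longrightarrow> norm (f x) \<le> B" unfolding bounded_iff by blast
  then show ?thesis
    using borel_measurable_continuous_on_sphere[OF assms]
    by (intro integrable_const_bound[where B = B]) (auto simp: space_eq)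
qed

lemma nn_integral_continuous_on_sphere:
  fixes f :: "real^'n \<Rightarrow> real"
  assumes "continuous_on unit_sphere f" "\<And>x. norm x = 1 \<Longrightarrow> 0 \<le> f x"
  shows "(\<integral>\<^sup>+x. ennreal (f x) \<partial>\<mu>) = ennreal (\<integral>x. f x \<partial>\<mu>)"
  using assms by (intro nn_integral_eq_integral integrable_continuous_on_sphere) (auto simp: space_eq)

lemma measurable_id_borel [measurable]: "(\<lambda>x. x) \<in> measurable \<mu> borel"
  by (intro borel_measurable_continuous_on_sphere continuous_on_id)

text \<open>A cap is a section of the set of pairs at distance less than \<open>s\<close>. The
  result is needed because cap masses appear as a denominator under Fubini's theorem.\<close>

lemma measure_cap_measurable [measurable]: "(\<lambda>x. measure \<mu> (cap x s)) \<in> borel_measurable \<mu>"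
proof -
  define Q where "Q = {p \<in> space (\<mu> \<Otimes>\<^sub>M \<mu>). dist (fst p) (snd p) < s}"
  have [measurable]: "Q \<in> sets (\<mu> \<Otimes>\<^sub>M \<mu>)"
  proof -
    have "(\<lambda>p. fst p) \<in> borel_measurable (\<mu> \<Otimes>\<^sub>M \<mu>)" "(\<lambda>p. snd p) \<in> borel_measurable (\<mu> \<Otimes>\<^sub>M \<mu>)"
      using measurable_compose[OF measurable_fst measurable_id_borel]
        measurable_compose[OF measurable_snd measurable_id_borel] by auto
    then have "(\<lambda>p. dist (fst p) (snd p)) \<in> borel_measurable (\<mu> \<Otimes>\<^sub>M \<mu>)"
      by (rule borel_measurable_dist)
    then show ?thesis unfolding Q_def by measurable
  qed
  have "(\<lambda>x. emeasure \<mu> (Pair x -` Q)) \<in> borel_measurable \<mu>"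
    by (rule measurable_emeasure_Pair) simp
  then have "(\<lambda>x. enn2real (emeasure \<mu> (Pair x -` Q))) \<in> borel_measurable \<mu>" by simp
  moreover have "enn2real (emeasure \<mu> (Pair x -` Q)) = measure \<mu> (cap x s)" if "x \<in> space \<mu>" for x
  proof -
    have "Pair x -` Q = cap x s" using that by (auto simp: Q_def space_pair_measure space_eq)
    then show ?thesis by (simp add: measure_def)
  qed
  ultimately show ?thesis by (simp cong: measurable_cong)
qed

end

context doubling_sphere_measure
begin

text \<open>Within distance \<open>1 / L\<close> the kernel is at most 1; beyond it the tail
  estimate applies with \<open>s = 0\<close>.\<close>

lemma nn_integral_kernel_le:
  assumes N: "2 * D \<le> 2 ^ N" and L: "L > 0" and x: "norm x = 1"
  shows "(\<integral>\<^sup>+u. ennreal (1 / (1 + L * dist u x) ^ N) \<partial>\<mu>) \<le> ennreal ((1 + 2 * D) * measure \<mu> (cap x (1 / L)))"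
proof -
  have "(\<integral>\<^sup>+u. ennreal (1 / (1 + L * dist u x) ^ N) \<partial>\<mu>)
    \<le> (\<integral>\<^sup>+u. indicator (cap x (1 / L)) u +
          ennreal ((1 / (L * dist x u)) ^ N) * indicator {u. 2 ^ 0 \<le> L * dist x u} u \<partial>\<mu>)"
  proof (rule nn_integral_mono)
    fix u assume u: "u \<in> space \<mu>"
    show "ennreal (1 / (1 + L * dist u x) ^ N) \<le> indicator (cap x (1 / L)) u +
          ennreal ((1 / (L * dist x u)) ^ N) * indicator {u. 2 ^ 0 \<le> L * dist x u} u"
    proof (cases "1 \<le> L * dist x u")
      case True
      then have "(L * dist x u) ^ N \<le> (1 + L * dist u x) ^ N" by (intro power_mono) (auto simp: dist_commute)
      moreover have "0 < (L * dist x u) ^ N" using True by (intro zero_less_power) simp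
      ultimately have "1 / (1 + L * dist u x) ^ N \<le> (1 / (L * dist x u)) ^ N"
        unfolding power_one_over by (intro divide_left_mono mult_pos_pos) auto
      then show ?thesis using True by (auto intro!: add_increasing ennreal_leI)
    next
      case False
      have "1 \<le> (1 + L * dist u x) ^ N" using L by (intro one_le_power) auto
      then have "1 / (1 + L * dist u x) ^ N \<le> 1" by (simp add: divide_le_eq)
      then have "ennreal (1 / (1 + L * dist u x) ^ N) \<le> 1" by (simp add: ennreal_le_1)
      moreover have "u \<in> cap x (1 / L)" using False u L by (simp add: space_eq field_simps)
      ultimately show ?thesis using False by simp
    qed
  qed
  also have "\<dots> = emeasure \<mu> (cap x (1 / L)) +
      (\<integral>\<^sup>+u. ennreal ((1 / (L * dist x u)) ^ N) * indicator {u. 2 ^ 0 \<le> L * dist x u} u \<partial>\<mu>)"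
    by (subst nn_integral_add) auto
  also have "\<dots> \<le> ennreal (measure \<mu> (cap x (1 / L))) + ennreal (2 * D / 2 ^ 0 * measure \<mu> (cap x (1 / L)))"
    using nn_integral_tail_le[OF N L x, of 0] by (simp add: emeasure_eq_measure add_left_mono)
  also have "\<dots> = ennreal ((1 + 2 * D) * measure \<mu> (cap x (1 / L)))"
    using D by (simp add: ennreal_plus[symmetric] algebra_simps del: ennreal_plus)
  finally show ?thesis .
qed

text \<open>At a maximum point \<open>v\<close> for \<open>peetre N L f u\<close> the function \<open>f\<close> itself dominates the Peetre
  function at \<open>v\<close>, so by Bernstein's inequality \<open>f\<close> is comparable with \<open>f v\<close> on a cap of radius
  proportional to \<open>1 / L\<close>.\<close>

lemma peetre_pointwise_le:
  assumes n: "CARD('n) \<ge> 2"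
  obtains C where "C > 0" "\<And>L f u. L \<ge> 1 \<Longrightarrow> poly_fun L f \<Longrightarrow> norm u = 1 \<Longrightarrow>
    ennreal (peetre N L f u) \<le> (\<integral>\<^sup>+x. ennreal (C * norm (f x) / measure \<mu> (cap x (1 / real L))
      * (1 / (1 + real L * dist u x) ^ N)) \<partial>\<mu>)"
proof -
  \<comment> \<open>The Lipschitz constant of \<open>f\<close> itself. The radius factor
    \<open>\<eta>\<close> below is dyadic with \<open>A * \<eta> \<le> 1 / 2\<close>, so that
    \<open>f\<close> loses at most half of its modulus and \<open>Suc q\<close> doublings compare
    the caps.\<close>
  define A where "A = 2 * (real CARD('n))\<^sup>2 * 3 ^ N * bern_const N"
  have A0: "A > 0" unfolding A_def using bern_const_pos[of N] by (intro mult_pos_pos) auto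
  obtain q where q: "2 * A < 2 ^ q" using real_arch_pow[of 2 "2 * A"] by auto
  define \<eta> where "\<eta> = 1 / (2 ^ q :: real)"
  have \<eta>: "0 < \<eta>" "\<eta> \<le> 1" "A * \<eta> \<le> 1 / 2" using q by (auto simp: \<eta>_def field_simps)
  \<comment> \<open>The factors come from \<open>norm (f v) \<le> 2 * norm (f x)\<close>, from
    moving the weight from \<open>v\<close> to \<open>x\<close>, and from comparing the cap of
    radius \<open>1 / L\<close> at \<open>x\<close> with \<open>B\<close>.\<close>
  define C where "C = 2 * 2 ^ N * D ^ Suc q"
  show thesis
  proof (rule that[of C])
    show "C > 0" using D by (simp add: C_def)
    fix L :: nat and f :: "real^'n \<Rightarrow> complex" and u :: "real^'n"
    assume L: "L \<ge> 1" and f: "poly_fun L f" and u: "norm u = 1"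
    note fc = poly_fun_continuous[OF f]
    have [measurable]: "(\<lambda>x. norm (f x)) \<in> borel_measurable \<mu>"
      by (intro borel_measurable_continuous_on_sphere continuous_intros fc)
    have [measurable]: "(\<lambda>x. dist u x) \<in> borel_measurable \<mu>"
      by (intro borel_measurable_continuous_on_sphere continuous_intros)
    define b where "b x = measure \<mu> (cap x (1 / real L))" for x
    have [measurable]: "b \<in> borel_measurable \<mu>" unfolding b_def by measurable
    define g where "g x = C * norm (f x) / b x * (1 / (1 + real L * dist u x) ^ N)" for x
    have [measurable]: "g \<in> borel_measurable \<mu>" unfolding g_def by measurable
    define P where "P = peetre N L f u"
    obtain v where v: "norm v = 1" "P = norm (f v) / (1 + real L * dist u v) ^ N"
      unfolding P_def by (rule peetre_attained[OF fc, of "real L" N u]) auto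
    have pos: "0 < (1 + real L * dist u x) ^ N" for x
      by (intro zero_less_power add_pos_nonneg) auto
    have "peetre N L f v \<le> (1 + real L * dist v u) ^ N * P"
      unfolding P_def by (intro peetre_triangle fc) auto
    also have "\<dots> = norm (f v)"
      by (simp only: v(2) dist_commute[of v u] times_divide_eq_right
          nonzero_mult_div_cancel_left[OF less_imp_neq[OF pos, THEN not_sym]])
    finally have Pv: "peetre N L f v \<le> norm (f v)" .
    define B where "B = cap v (\<eta> / real L)"
    define m where "m = measure \<mu> B"
    have m: "m > 0" unfolding m_def B_def using v \<eta> L by (intro cap_pos) auto
    have gB: "P \<le> m * g x" if x: "x \<in> B" for x
    proof -
      have x1: "norm x = 1" and dx: "real L * dist v x \<le> \<eta>"
        using x L by (auto simp: B_def field_simps)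
      have "norm (f x - f v) \<le> A * peetre N L f v * (real L * dist v x)"
        using rders_lipschitz[OF n f L v(1) x1, of "[]" N] dx \<eta> by (simp add: A_def)
      also have "\<dots> \<le> A * norm (f v) * \<eta>"
        using Pv dx A0 peetre_nonneg[OF fc] by (intro mult_mono) auto
      also have "\<dots> = norm (f v) * (A * \<eta>)" by simp
      also have "\<dots> \<le> norm (f v) * (1 / 2)" using \<eta> by (intro mult_left_mono) auto
      finally have "norm (f v) \<le> 2 * norm (f x)"
        using norm_triangle_sub[of "f v" "f x"] by (simp add: norm_minus_commute)
      moreover have "(1 + real L * dist u x) ^ N \<le> 2 ^ N * (1 + real L * dist u v) ^ N"
      proof -
        have "1 + real L * dist u x \<le> (1 + real L * dist u v) * (1 + real L * dist v x)"
          by (rule one_plus_dist_triangle) simp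
        also have "\<dots> \<le> (1 + real L * dist u v) * 2" using dx \<eta> by (intro mult_left_mono) auto
        finally have "(1 + real L * dist u x) ^ N \<le> ((1 + real L * dist u v) * 2) ^ N"
          by (intro power_mono) auto
        then show ?thesis by (simp only: power_mult_distrib mult.commute)
      qed
      ultimately have "norm (f v) * (1 + real L * dist u x) ^ N
        \<le> (2 * norm (f x)) * (2 ^ N * (1 + real L * dist u v) ^ N)"
        by (intro mult_mono) auto
      then have 1: "P \<le> 2 * 2 ^ N * norm (f x) * (1 / (1 + real L * dist u x) ^ N)"
        unfolding v(2) using pos[of x] pos[of v] by (simp add: field_simps)
      have bx: "b x > 0" unfolding b_def using x1 L by (intro cap_pos) auto
      have "b x \<le> measure \<mu> (cap v (2 / real L))"
        unfolding b_def
      proof (rule finite_measure_mono)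
        show "cap x (1 / real L) \<subseteq> cap v (2 / real L)"
        proof
          fix y assume y: "y \<in> cap x (1 / real L)"
          have "dist v y \<le> dist v x + dist x y" by (rule dist_triangle)
          moreover have "dist v x < 1 / real L" using x \<eta> L by (auto simp: B_def field_simps)
          ultimately show "y \<in> cap v (2 / real L)" using y by (simp add: field_simps)
        qed
      qed simp
      also have "\<dots> \<le> D ^ Suc q * m"
        unfolding m_def B_def using v L \<eta> by (intro cap_doubling_le) (auto simp: \<eta>_def)
      finally have "1 \<le> D ^ Suc q * m / b x" using bx by simp
      then have "1 * (2 * 2 ^ N * norm (f x) * (1 / (1 + real L * dist u x) ^ N))
        \<le> (D ^ Suc q * m / b x) * (2 * 2 ^ N * norm (f x) * (1 / (1 + real L * dist u x) ^ N))"
        using pos[of x] by (intro mult_right_mono) auto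
      also have "\<dots> = m * g x" by (simp add: g_def C_def)
      finally show ?thesis using 1 by linarith
    qed
    have "ennreal m * ennreal P = (\<integral>\<^sup>+x. ennreal P * indicator B x \<partial>\<mu>)"
      by (simp add: B_def m_def emeasure_eq_measure nn_integral_cmult_indicator mult.commute)
    also have "\<dots> \<le> (\<integral>\<^sup>+x. ennreal m * ennreal (g x) \<partial>\<mu>)"
      using gB m by (intro nn_integral_mono) (auto simp: indicator_def ennreal_mult'[symmetric] intro!: ennreal_leI)
    also have "\<dots> = ennreal m * (\<integral>\<^sup>+x. ennreal (g x) \<partial>\<mu>)"
      by (rule nn_integral_cmult) measurable
    finally have "ennreal P \<le> (\<integral>\<^sup>+x. ennreal (g x) \<partial>\<mu>)"
      using m by (subst (asm) ennreal_mult_le_mult_iff) auto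
    then show "ennreal (peetre N L f u) \<le> (\<integral>\<^sup>+x. ennreal (C * norm (f x) / measure \<mu> (cap x (1 / real L))
      * (1 / (1 + real L * dist u x) ^ N)) \<partial>\<mu>)"
      unfolding P_def g_def b_def .
  qed
qed

text \<open>After exchanging the integrals in the pointwise bound, the inner integral of the kernel
  is comparable with \<open>b x\<close> and cancels the denominator.\<close>

lemma peetre_integral_le:
  assumes n: "CARD('n) \<ge> 2" and N: "2 * D \<le> 2 ^ N"
  obtains C where "C > 0" "\<And>L f. L \<ge> 1 \<Longrightarrow> poly_fun L f \<Longrightarrow>
    (\<integral>x. peetre N L f x \<partial>\<mu>) \<le> C * (\<integral>x. norm (f x) \<partial>\<mu>)"
proof -
  obtain C where C: "C > 0" and pw: "\<And>L f u. L \<ge> 1 \<Longrightarrow> poly_fun L f \<Longrightarrow> norm u = 1 \<Longrightarrow>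
    ennreal (peetre N L f u) \<le> (\<integral>\<^sup>+x. ennreal (C * norm (f x) / measure \<mu> (cap x (1 / real L))
      * (1 / (1 + real L * dist u x) ^ N)) \<partial>\<mu>)"
    using peetre_pointwise_le[OF n, of N] by blast
  show thesis
  proof (rule that[of "C * (1 + 2 * D)"])
    show "0 < C * (1 + 2 * D)" using C D by simp
    fix L :: nat and f :: "real^'n \<Rightarrow> complex" assume L: "L \<ge> 1" and f: "poly_fun L f"
    note fc = poly_fun_continuous[OF f]
    have [measurable]: "(\<lambda>x. norm (f x)) \<in> borel_measurable \<mu>"
      by (intro borel_measurable_continuous_on_sphere continuous_intros fc)
    define b where "b x = measure \<mu> (cap x (1 / real L))" for x
    have [measurable]: "b \<in> borel_measurable \<mu>" unfolding b_def by measurable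
    interpret pair_sigma_finite \<mu> \<mu> ..
    have "ennreal (\<integral>x. peetre N L f x \<partial>\<mu>) = (\<integral>\<^sup>+u. ennreal (peetre N L f u) \<partial>\<mu>)"
      using continuous_on_peetre[OF fc] peetre_nonneg[OF fc]
      by (intro nn_integral_continuous_on_sphere[symmetric]) auto
    also have "\<dots> \<le> (\<integral>\<^sup>+u. \<integral>\<^sup>+x. ennreal (C * norm (f x) / b x * (1 / (1 + real L * dist u x) ^ N)) \<partial>\<mu> \<partial>\<mu>)"
      unfolding b_def using pw[OF L f] by (intro nn_integral_mono) (auto simp: space_eq)
    also have "\<dots> = (\<integral>\<^sup>+x. \<integral>\<^sup>+u. ennreal (C * norm (f x) / b x * (1 / (1 + real L * dist u x) ^ N)) \<partial>\<mu> \<partial>\<mu>)"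
      by (rule Fubini') measurable
    also have "\<dots> \<le> (\<integral>\<^sup>+x. ennreal (C * (1 + 2 * D) * norm (f x)) \<partial>\<mu>)"
    proof (rule nn_integral_mono)
      fix x assume "x \<in> space \<mu>"
      then have x: "norm x = 1" by (simp add: space_eq)
      have bx: "b x > 0" unfolding b_def using x L by (intro cap_pos) auto
      have [measurable]: "(\<lambda>u. dist u x) \<in> borel_measurable \<mu>"
        by (intro borel_measurable_continuous_on_sphere continuous_intros)
      have "(\<integral>\<^sup>+u. ennreal (C * norm (f x) / b x * (1 / (1 + real L * dist u x) ^ N)) \<partial>\<mu>)
        = ennreal (C * norm (f x) / b x) * (\<integral>\<^sup>+u. ennreal (1 / (1 + real L * dist u x) ^ N) \<partial>\<mu>)"
        using bx C by (subst nn_integral_cmult[symmetric]) (auto simp: ennreal_mult'[symmetric])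
      also have "\<dots> \<le> ennreal (C * norm (f x) / b x) * ennreal ((1 + 2 * D) * b x)"
        unfolding b_def using L x by (intro mult_left_mono nn_integral_kernel_le N) auto
      also have "\<dots> = ennreal (C * (1 + 2 * D) * norm (f x))"
        using bx C D by (simp add: ennreal_mult'[symmetric] mult_ac)
      finally show "(\<integral>\<^sup>+u. ennreal (C * norm (f x) / b x * (1 / (1 + real L * dist u x) ^ N)) \<partial>\<mu>)
        \<le> ennreal (C * (1 + 2 * D) * norm (f x))" .
    qed
    also have "\<dots> = ennreal (\<integral>x. C * (1 + 2 * D) * norm (f x) \<partial>\<mu>)"
      using C D by (intro nn_integral_continuous_on_sphere continuous_intros fc) auto
    finally show "(\<integral>x. peetre N L f x \<partial>\<mu>) \<le> C * (1 + 2 * D) * (\<integral>x. norm (f x) \<partial>\<mu>)"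
      using C D by (subst (asm) ennreal_le_iff) auto
  qed
qed

end

subsection \<open>Sets where the polynomial is small\<close>

context doubling_sphere_measure
begin

section \<open>The measure weighted by the Peetre function\<close>

definition peetre_measure :: "nat \<Rightarrow> nat \<Rightarrow> (real^'n \<Rightarrow> complex) \<Rightarrow> (real^'n) measure" where
  "peetre_measure N L f = density \<mu> (\<lambda>x. ennreal (peetre N L f x))"

lemma sets_peetre_measure [simp]: "sets (peetre_measure N L f) = sets \<mu>" and space_peetre_measure [simp]: "space (peetre_measure N L f) = unit_sphere"
  by (simp_all add: peetre_measure_def space_eq)

context
  fixes N L :: nat and f :: "real^'n \<Rightarrow> complex"
  assumes f: "poly_fun L f"
begin

lemma peetre_nonneg': "0 \<le> peetre N L f x"
  by (rule peetre_nonneg[OF poly_fun_continuous[OF f]]) simp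

lemma continuous_peetre: "continuous_on S (peetre N L f)"
  by (rule continuous_on_peetre[OF poly_fun_continuous[OF f]]) simp

lemma peetre_measurable [measurable]: "peetre N L f \<in> borel_measurable \<mu>"
  by (rule borel_measurable_continuous_on_sphere[OF continuous_peetre])

lemma emeasure_peetre_measure:
  "A \<in> sets \<mu> \<Longrightarrow> emeasure (peetre_measure N L f) A = (\<integral>\<^sup>+x. ennreal (peetre N L f x) * indicator A x \<partial>\<mu>)"
  unfolding peetre_measure_def by (rule emeasure_density) measurable

lemma emeasure_peetre_measure_sphere: "emeasure (peetre_measure N L f) unit_sphere = ennreal (\<integral>x. peetre N L f x \<partial>\<mu>)"
proof -
  have "unit_sphere \<in> sets \<mu>" using sets.top[of \<mu>] by (simp add: space_eq)
  then have "emeasure (peetre_measure N L f) unit_sphere = (\<integral>\<^sup>+x. ennreal (peetre N L f x) * indicator unit_sphere x \<partial>\<mu>)"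
    by (rule emeasure_peetre_measure)
  also have "\<dots> = (\<integral>\<^sup>+x. ennreal (peetre N L f x) \<partial>\<mu>)"
    by (intro nn_integral_cong) (auto simp: space_eq)
  also have "\<dots> = ennreal (\<integral>x. peetre N L f x \<partial>\<mu>)"
    by (intro nn_integral_continuous_on_sphere continuous_peetre peetre_nonneg')
  finally show ?thesis .
qed

lemma sphere_measure_peetre: "sphere_measure (peetre_measure N L f)"
proof -
  have "finite_measure (peetre_measure N L f)"
    by (rule finite_measureI) (simp add: emeasure_peetre_measure_sphere)
  then show ?thesis by (simp add: sphere_measure_def sphere_measure_axioms_def sets_eq)
qed

interpretation pm: sphere_measure "peetre_measure N L f" by (rule sphere_measure_peetre)

lemma measure_peetre_measure_sphere: "measure (peetre_measure N L f) unit_sphere = (\<integral>x. peetre N L f x \<partial>\<mu>)"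
proof -
  have "0 \<le> (\<integral>x. peetre N L f x \<partial>\<mu>)" by (intro Bochner_Integration.integral_nonneg peetre_nonneg')
  then show ?thesis using emeasure_peetre_measure_sphere by (simp add: measure_def)
qed

lemma measure_peetre_measure_le:
  assumes A: "A \<in> sets \<mu>" and le: "\<And>x. x \<in> A \<Longrightarrow> peetre N L f x \<le> c" and c: "0 \<le> c"
  shows "measure (peetre_measure N L f) A \<le> c * measure \<mu> A"
proof -
  have "emeasure (peetre_measure N L f) A \<le> (\<integral>\<^sup>+x. ennreal c * indicator A x \<partial>\<mu>)"
    unfolding emeasure_peetre_measure[OF A] using le by (intro nn_integral_mono) (auto simp: indicator_def ennreal_leI)
  also have "\<dots> = ennreal (c * measure \<mu> A)"
    using A c by (simp add: nn_integral_cmult_indicator emeasure_eq_measure ennreal_mult')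
  finally show ?thesis using c by (simp add: pm.emeasure_eq_measure ennreal_le_iff)
qed

lemma measure_peetre_measure_ge:
  assumes A: "A \<in> sets \<mu>" and ge: "\<And>x. x \<in> A \<Longrightarrow> c \<le> peetre N L f x" and c: "0 \<le> c"
  shows "c * measure \<mu> A \<le> measure (peetre_measure N L f) A"
proof -
  have "ennreal (c * measure \<mu> A) = (\<integral>\<^sup>+x. ennreal c * indicator A x \<partial>\<mu>)"
    using A c by (simp add: nn_integral_cmult_indicator emeasure_eq_measure ennreal_mult')
  also have "\<dots> \<le> emeasure (peetre_measure N L f) A"
    unfolding emeasure_peetre_measure[OF A] using ge by (intro nn_integral_mono) (auto simp: indicator_def ennreal_leI)
  finally show ?thesis by (simp add: pm.emeasure_eq_measure ennreal_le_iff)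
qed

text \<open>Carries a comparison of caps over from \<open>\<mu>\<close> to the weighted measure, in
  the form required by \<open>vitali_density_bound\<close>. The power of \<open>1 + R\<close> occurs
  twice: the weight is compared with its value at \<open>v\<close> once from above on the large cap
  and once from below on \<open>B\<close>.\<close>

lemma measure_peetre_measure_cap_le:
  assumes v: "norm v = 1" and B: "B \<in> sets \<mu>" "B \<subseteq> G \<inter> ball v s" and G: "G \<in> sets \<mu>"
    and M: "measure \<mu> (cap v (5 * s)) \<le> M * measure \<mu> B" "0 \<le> M" and R: "real L * (5 * s) \<le> R" and s: "0 < s"
  shows "measure (peetre_measure N L f) (cap v (5 * s)) \<le> (1 + R) ^ N * (1 + R) ^ N * M * measure (peetre_measure N L f) (G \<inter> ball v s)"
proof -
  let ?P = "peetre N L f"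
  have R0: "0 \<le> R" using R s by (meson mult_nonneg_nonneg of_nat_0_le_iff order.trans less_imp_le zero_le_numeral)
  have near: "real L * dist v x \<le> R" if "dist v x \<le> 5 * s" for x
    using mult_left_mono[OF that, of "real L"] R by simp
  have "measure (peetre_measure N L f) (cap v (5 * s)) \<le> (1 + R) ^ N * ?P v * measure \<mu> (cap v (5 * s))"
    using near R0 peetre_nonneg'
    by (intro measure_peetre_measure_le peetre_near[OF poly_fun_continuous[OF f]]) (auto simp: dist_commute)
  also have "\<dots> \<le> (1 + R) ^ N * ?P v * (M * measure \<mu> B)"
    using M R0 peetre_nonneg' by (intro mult_left_mono) auto
  also have "\<dots> = (1 + R) ^ N * (1 + R) ^ N * M * (?P v / (1 + R) ^ N * measure \<mu> B)"
    using R0 by simp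
  also have "\<dots> \<le> (1 + R) ^ N * (1 + R) ^ N * M * measure (peetre_measure N L f) B"
  proof (intro mult_left_mono measure_peetre_measure_ge B(1))
    fix x assume "x \<in> B"
    then have "dist v x \<le> 5 * s" using B(2) s by auto
    then have "?P v \<le> (1 + R) ^ N * ?P x" using near by (intro peetre_near[OF poly_fun_continuous[OF f]]) auto
    then show "?P v / (1 + R) ^ N \<le> ?P x" using R0 by (simp add: divide_le_eq mult.commute zero_less_power)
  qed (use R0 M peetre_nonneg' in auto)
  also have "\<dots> \<le> (1 + R) ^ N * (1 + R) ^ N * M * measure (peetre_measure N L f) (G \<inter> ball v s)"
  proof (intro mult_left_mono pm.finite_measure_mono B(2))
    show "G \<inter> ball v s \<in> sets (peetre_measure N L f)" using G by (auto simp: sets_iff)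
  qed (use R0 M in auto)
  finally show ?thesis .
qed

lemma norm_rders_measurable [measurable]: "(\<lambda>v. norm (rders w f v)) \<in> borel_measurable \<mu>"
  by (intro borel_measurable_continuous_on_sphere continuous_intros poly_fun_continuous[OF poly_fun_rders[OF f]])

end

section \<open>Points with a small derivative whose next derivative is large\<close>

definition steep_set ::
    "real \<Rightarrow> real \<Rightarrow> nat \<Rightarrow> nat \<Rightarrow> (real^'n \<Rightarrow> complex) \<Rightarrow> nat \<Rightarrow> ('n \<times> 'n) list \<Rightarrow> 'n \<Rightarrow> 'n \<Rightarrow> (real^'n) set" where
  "steep_set \<epsilon> \<delta> N L f k w i j = {v \<in> unit_sphere. norm (rders w f v) < \<epsilon> * (real L ^ k * peetre N L f v) \<and>
     \<delta> * (real L ^ Suc k * peetre N L f v) \<le> norm (rder i j (rders w f) v)}"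

text \<open>Where \<open>g = rders w f\<close> is small but has a large derivative, one finds at each of many scales
  \<open>\<tau>\<close> a nearby cap of comparable size on which the modulus of \<open>g\<close> is of size \<open>\<tau>\<close>. The corresponding level shells
  are disjoint, and each carries at least a fixed fraction of the mass of the set in question.\<close>

lemma peetre_measure_gradient_bound:
  assumes n: "CARD('n) \<ge> 2" and \<delta>: "\<delta> > 0" and \<eta>: "\<eta> > 0"
  shows "\<exists>\<epsilon>>0. \<forall>L f w i j. L \<ge> 1 \<longrightarrow> poly_fun L f \<longrightarrow> length w = k \<longrightarrow>
    measure (peetre_measure N L f) (steep_set \<epsilon> \<delta> N L f k w i j)
    \<le> \<eta> * measure (peetre_measure N L f) unit_sphere"
proof -
  define n2 where "n2 = (real CARD('n))\<^sup>2"
  have n2: "n2 > 0" by (simp add: n2_def)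
  define H where "H = n2 * n2 * bern_const N ^ Suc (Suc k) * 2 ^ N"
  define \<Lambda> where "\<Lambda> = 2 * n2 * 3 ^ N * bern_const N ^ Suc k"
  have H: "H > 0" and \<Lambda>: "\<Lambda> > 0" unfolding H_def \<Lambda>_def using n2 bern_const_pos[of N] by (intro mult_pos_pos; simp)+
  \<comment> \<open>Edges of the shells, relative to \<open>\<tau>\<close>. The powers of 3 pay for
    replacing \<open>P v\<close> by \<open>P y\<close> at distance at most \<open>2 / L\<close>;
    apart from them, the modulus of \<open>g\<close> lies between \<open>\<delta> / 8\<close> and
    \<open>\<delta> + \<Lambda>\<close>.\<close>
  define a where "a = \<delta> / (8 * 3 ^ N)"
  define b where "b = (\<delta> + \<Lambda>) * 3 ^ N"
  have a: "a > 0" and b: "b > 0" unfolding a_def b_def using \<delta> \<Lambda> by auto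
  \<comment> \<open>On a cap of radius \<open>c * \<tau> / L\<close> around the point found,
    \<open>g\<close> varies by at most \<open>\<delta> / 8 * \<tau>\<close>.\<close>
  obtain q where q: "8 * \<Lambda> * 2 ^ N / \<delta> < 2 ^ q" using real_arch_pow[of 2] by auto
  define c where "c = 1 / (2 ^ q :: real)"
  have c: "0 < c" "c \<le> 1" "\<Lambda> * 2 ^ N * c \<le> \<delta> / 8" using q \<delta> by (auto simp: c_def field_simps)
  \<comment> \<open>Vitali's lemma uses the radius \<open>2 * \<tau> / L\<close>; its fivefold
    enlargement stays within \<open>10 / L\<close>, hence \<open>11 = 1 + 10\<close>. The enlarged
    cap lies in one of radius \<open>16 * \<tau> / L\<close>, which is \<open>q + 4\<close>
    doublings away from \<open>c * \<tau> / L\<close>.\<close>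
  define K where "K = 11 ^ N * 11 ^ N * D ^ (q + 4)"
  have K: "K > 0" using D by (simp add: K_def)
  \<comment> \<open>Below this scale the quadratic error costs at most
    \<open>\<delta> / 8 * \<tau>\<close>.\<close>
  define \<tau>0 where "\<tau>0 = min 1 (\<delta> / (8 * H))"
  have \<tau>0: "0 < \<tau>0" "\<tau>0 \<le> 1" "H * \<tau>0 \<le> \<delta> / 8"
    using \<delta> H by (auto simp: \<tau>0_def min_def field_simps)
  \<comment> \<open>With this ratio the upper edge of the next shell is half the lower edge of the
    present one.\<close>
  define \<sigma> where "\<sigma> = a / (2 * b)"
  have ab: "a \<le> b"
  proof -
    have "1 \<le> (3::real) ^ N" by (rule one_le_power) simp
    then have "1 \<le> 8 * (3::real) ^ N" by linarith
    then have "a \<le> \<delta>" unfolding a_def using \<delta> by (simp add: divide_le_eq)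
    also have "\<dots> \<le> (\<delta> + \<Lambda>) * 1" using \<Lambda> by simp
    also have "\<dots> \<le> b" unfolding b_def using \<delta> \<Lambda> by (intro mult_left_mono one_le_power) auto
    finally show ?thesis .
  qed
  have \<sigma>: "0 < \<sigma>" "\<sigma> \<le> 1" "b * \<sigma> = a / 2" using a b ab by (auto simp: \<sigma>_def field_simps)
  \<comment> \<open>The number of shells: each carries at least \<open>1 / K\<close> of the mass of
    the set, and together they fit into the sphere.\<close>
  obtain k0 :: nat where k0: "K / \<eta> < real k0" using reals_Archimedean2 by blast
  have k0pos: "k0 > 0" using k0 K \<eta> by (metis divide_pos_pos less_trans of_nat_0_less_iff)
  \<comment> \<open>Small enough for the value of \<open>g\<close> at the starting point to be
    negligible at every scale in use.\<close>
  define \<epsilon> where "\<epsilon> = \<delta> * (\<tau>0 * \<sigma> ^ k0) / 8"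
  define \<tau> where "\<tau> j = \<tau>0 * \<sigma> ^ j" for j
  have \<tau>: "0 < \<tau> j" "\<tau> j \<le> 1" "H * \<tau> j \<le> \<delta> / 8" for j
  proof -
    have "\<sigma> ^ j \<le> 1" using \<sigma> by (intro power_le_one) auto
    then have le: "\<tau> j \<le> \<tau>0" unfolding \<tau>_def using \<tau>0 mult_left_mono[of "\<sigma> ^ j" 1 \<tau>0] by simp
    then show "\<tau> j \<le> 1" using \<tau>0 by simp
    show "0 < \<tau> j" using \<tau>0 \<sigma> by (simp add: \<tau>_def)
    have "H * \<tau> j \<le> H * \<tau>0" using le H by (intro mult_left_mono) auto
    then show "H * \<tau> j \<le> \<delta> / 8" using \<tau>0(3) by linarith
  qed
  have \<epsilon>\<tau>: "\<epsilon> \<le> \<delta> * \<tau> j / 8" if "j < k0" for j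
  proof -
    have "\<sigma> ^ k0 \<le> \<sigma> ^ j" using that \<sigma> by (intro power_decreasing) auto
    then show ?thesis unfolding \<epsilon>_def \<tau>_def using \<delta> \<tau>0 by (intro divide_right_mono mult_left_mono) auto
  qed
  have \<tau>_sep: "b * \<tau> j < a * \<tau> i" if "i < j" for i j
  proof -
    have "\<tau> j \<le> \<tau> (Suc i)"
      unfolding \<tau>_def using that \<sigma> \<tau>0 by (intro mult_left_mono power_decreasing) auto
    then have "b * \<tau> j \<le> b * (\<tau> i * \<sigma>)" using b by (intro mult_left_mono) (auto simp: \<tau>_def mult_ac)
    also have "\<dots> = a / 2 * \<tau> i" using \<sigma>(3) by (simp add: mult_ac)
    also have "\<dots> < a * \<tau> i" using a \<tau>(1)[of i] by simp
    finally show ?thesis .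
  qed
  show ?thesis
  proof (intro exI[of _ \<epsilon>] conjI allI impI)
    show "0 < \<epsilon>" using \<delta> \<tau>0 \<sigma> by (simp add: \<epsilon>_def)
    fix L :: nat and f :: "real^'n \<Rightarrow> complex" and w :: "('n \<times> 'n) list" and i j :: 'n
    assume L: "L \<ge> 1" and f: "poly_fun L f" and w: "length w = k"
    interpret pm: sphere_measure "peetre_measure N L f" by (rule sphere_measure_peetre[OF f])
    define P where "P = peetre N L f"
    define g where "g = rders w f"
    define A where "A = {v \<in> unit_sphere. norm (g v) < \<epsilon> * (real L ^ k * P v) \<and>
       \<delta> * (real L ^ Suc k * P v) \<le> norm (rder i j g v)}"
    note fc = poly_fun_continuous[OF f]
    have [measurable]: "P \<in> borel_measurable \<mu>" unfolding P_def by (rule peetre_measurable[OF f])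
    have [measurable]: "(\<lambda>v. norm (g v)) \<in> borel_measurable \<mu>" unfolding g_def by (rule norm_rders_measurable[OF f])
    have [measurable]: "(\<lambda>v. norm (rder i j g v)) \<in> borel_measurable \<mu>"
      using norm_rders_measurable[OF f, of "(i, j) # w"] by (simp add: g_def)
    have Aset: "A \<in> sets \<mu>"
    proof -
      have "A = {v \<in> space \<mu>. norm (g v) < \<epsilon> * (real L ^ k * P v) \<and> \<delta> * (real L ^ Suc k * P v) \<le> norm (rder i j g v)}"
        by (simp add: A_def space_eq)
      then show ?thesis by simp
    qed
    have P0: "0 \<le> P v" for v unfolding P_def by (rule peetre_nonneg'[OF f])
    have Pnear: "P x \<le> (1 + R) ^ N * P y" if "real L * dist x y \<le> R" for x y R
      unfolding P_def by (rule peetre_near[OF fc _ that]) simp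
    have "measure (peetre_measure N L f) A \<le> \<eta> * measure (peetre_measure N L f) unit_sphere"
    proof (cases "\<exists>v. P v = 0")
      case True
      then obtain v where v: "P v = 0" by blast
      \<comment> \<open>Slow variation holds at any distance with a suitable \<open>R\<close>, so a
        single zero of the Peetre function makes it vanish identically.\<close>
      have "P x = 0" for x using Pnear[of x v "real L * dist x v"] v P0[of x] by simp
      then have "measure (peetre_measure N L f) A \<le> 0 * measure \<mu> A"
        by (intro measure_peetre_measure_le[OF f] Aset) (auto simp: P_def)
      then show ?thesis using \<eta> by (simp add: order.trans[OF _ mult_nonneg_nonneg])
    next
      case False
      then have Ppos: "P v > 0" for v using P0[of v] by (metis order_le_less)
      define G where "G m = {y \<in> unit_sphere. a * \<tau> m * (real L ^ k * P y) \<le> norm (g y) \<and>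
         norm (g y) \<le> b * \<tau> m * (real L ^ k * P y)}" for m
      have Gset: "G m \<in> sets \<mu>" for m
      proof -
        have "G m = {y \<in> space \<mu>. a * \<tau> m * (real L ^ k * P y) \<le> norm (g y) \<and> norm (g y) \<le> b * \<tau> m * (real L ^ k * P y)}"
          by (simp add: G_def space_eq)
        then show ?thesis by simp
      qed
      have LP: "0 < real L ^ k * P v" for v using L Ppos by simp
      have Gdisj: "G l \<inter> G m = {}" if "l < m" for l m
      proof -
        have False if "y \<in> G l" "y \<in> G m" for y
        proof -
          have "a * \<tau> l * (real L ^ k * P y) \<le> b * \<tau> m * (real L ^ k * P y)"
            using that by (auto simp: G_def)
          then have "a * \<tau> l \<le> b * \<tau> m" using LP[of y] by (simp only: mult_le_cancel_right_pos)
          then show False using \<tau>_sep[OF \<open>l < m\<close>] by simp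
        qed
        then show ?thesis by blast
      qed
      have shell: "measure (peetre_measure N L f) A \<le> K * measure (peetre_measure N L f) (G m)" if m: "m < k0" for m
      proof (rule pm.vitali_density_bound)
        show "A \<subseteq> unit_sphere" "A \<in> sets (peetre_measure N L f)" "G m \<in> sets (peetre_measure N L f)" using Aset Gset by (auto simp: A_def)
        show "0 < 2 * \<tau> m / real L" using \<tau> L by simp
        show "0 \<le> K" using K by simp
        fix v assume v: "v \<in> A"
        then have v1: "norm v = 1" by (simp add: A_def)
        have gv: "norm (g v) \<le> \<delta> * \<tau> m / 8 * (real L ^ k * P v)"
          using v \<epsilon>\<tau>[OF m] LP[of v] mult_right_mono[of \<epsilon> "\<delta> * \<tau> m / 8" "real L ^ k * P v"] by (simp add: A_def)
        have "\<delta> * real L * real L ^ length w * P v \<le> norm (rder i j (rders w f) v)"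
          using v by (simp add: A_def g_def w mult_ac)
        from rders_second_order[OF f L v1 _ \<delta> this[unfolded P_def], of H]
        obtain \<eta>' where gc: "great_circle v \<eta>'" and lower: "\<And>\<tau>. 0 < \<tau> \<Longrightarrow> \<tau> \<le> 1 \<Longrightarrow>
            norm (g (great_circle.gc v \<eta>' (\<tau> / real L))) \<ge> (\<delta> / 2 * \<tau> - H * \<tau>\<^sup>2) * (real L ^ k * P v) - norm (g v)"
          using Ppos[of v] w unfolding H_def n2_def g_def P_def by metis
        interpret great_circle v \<eta>' by fact
        define x where "x = gc (\<tau> m / real L)"
        have x1: "norm x = 1" by (simp add: x_def)
        have dvx: "dist v x \<le> \<tau> m / real L" unfolding x_def using \<tau>[of m] L by (intro dist_gc_le) auto
        then have Ldvx: "real L * dist v x \<le> \<tau> m" using L by (simp add: field_simps)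
        \<comment> \<open>Of the linear growth \<open>\<delta> / 2 * \<tau>\<close>, an eighth of
          \<open>\<delta>\<close> is lost to the quadratic term and another to the value at
          \<open>v\<close>.\<close>
        have gx_lower: "\<delta> / 4 * \<tau> m * (real L ^ k * P v) \<le> norm (g x)"
        proof -
          have "H * \<tau> m * \<tau> m \<le> \<delta> / 8 * \<tau> m" using \<tau>[of m] by (intro mult_right_mono) auto
          then have "\<delta> / 4 * \<tau> m + \<delta> * \<tau> m / 8 \<le> \<delta> / 2 * \<tau> m - H * (\<tau> m)\<^sup>2"
            by (simp add: power2_eq_square mult.assoc)
          then have "(\<delta> / 4 * \<tau> m + \<delta> * \<tau> m / 8) * (real L ^ k * P v) \<le> (\<delta> / 2 * \<tau> m - H * (\<tau> m)\<^sup>2) * (real L ^ k * P v)"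
            using LP[of v] by (intro mult_right_mono) auto
          then show ?thesis using lower[OF \<tau>(1,2)[of m]] gv unfolding x_def by (simp add: distrib_right)
        qed
        have lip: "norm (g z - g y) \<le> \<Lambda> * (real L ^ k * P y) * (real L * dist y z)"
          if "norm y = 1" "norm z = 1" "real L * dist y z \<le> 1" for y z
          using rders_lipschitz[OF n f L that, of w N] by (simp add: \<Lambda>_def n2_def g_def P_def w mult_ac)
        have gx_upper: "norm (g x) \<le> (\<delta> / 8 + \<Lambda>) * \<tau> m * (real L ^ k * P v)"
        proof -
          have "norm (g x - g v) \<le> \<Lambda> * (real L ^ k * P v) * (real L * dist v x)"
            using Ldvx \<tau>[of m] x1 v1 by (intro lip) auto
          also have "\<dots> \<le> \<Lambda> * (real L ^ k * P v) * \<tau> m"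
            using Ldvx \<Lambda> LP[of v] by (intro mult_left_mono) auto
          finally show ?thesis using gv norm_triangle_sub[of "g x" "g v"] by (simp add: algebra_simps)
        qed
        define B where "B = cap x (c * \<tau> m / real L)"
        have yB: "norm y = 1" "real L * dist x y \<le> c * \<tau> m" "dist v y < 2 * \<tau> m / real L" if "y \<in> B" for y
        proof -
          show "norm y = 1" using that by (simp add: B_def)
          have "dist x y < c * \<tau> m / real L" using that by (simp add: B_def)
          then show "real L * dist x y \<le> c * \<tau> m" using L by (simp add: field_simps)
          have "c * \<tau> m \<le> \<tau> m" using c \<tau>(1)[of m] by simp
          then have "c * \<tau> m / real L \<le> \<tau> m / real L" by (intro divide_right_mono) auto
          then show "dist v y < 2 * \<tau> m / real L"
            using dist_triangle[of v y x] \<open>dist x y < _\<close> dvx by simp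
        qed
        have BG: "B \<subseteq> G m \<inter> ball v (2 * \<tau> m / real L)"
        proof
          fix y assume y: "y \<in> B"
          have ct: "c * \<tau> m \<le> 1" using c \<tau>[of m] mult_mono[of c 1 "\<tau> m" 1] by simp
          have "norm (g y - g x) \<le> \<Lambda> * (real L ^ k * P x) * (real L * dist x y)"
            using yB[OF y] x1 ct by (intro lip) auto
          also have "\<dots> \<le> \<Lambda> * (real L ^ k * (2 ^ N * P v)) * (c * \<tau> m)"
          proof (rule mult_mono)
            have "real L * dist x v \<le> 1" using Ldvx \<tau>[of m] by (simp add: dist_commute)
            from Pnear[OF this] have "P x \<le> 2 ^ N * P v" by simp
            then show "\<Lambda> * (real L ^ k * P x) \<le> \<Lambda> * (real L ^ k * (2 ^ N * P v))"
              using \<Lambda> by (intro mult_left_mono) auto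
          qed (use yB[OF y] \<Lambda> P0 in auto)
          also have "\<dots> = (\<Lambda> * 2 ^ N * c) * (\<tau> m * (real L ^ k * P v))" by (simp add: mult_ac)
          also have "\<dots> \<le> \<delta> / 8 * (\<tau> m * (real L ^ k * P v))"
            using c \<tau>(1)[of m] LP[of v] by (intro mult_right_mono) auto
          finally have gyx: "norm (g y - g x) \<le> \<delta> / 8 * \<tau> m * (real L ^ k * P v)" by (simp add: mult_ac)
          have Lvy: "real L * dist v y \<le> 2"
          proof -
            have "real L * dist v y \<le> real L * (2 * \<tau> m / real L)"
              using yB(3)[OF y] by (intro mult_left_mono) auto
            also have "\<dots> \<le> 2" using L \<tau>[of m] by simp
            finally show ?thesis .
          qed
          have Pvy: "P v \<le> 3 ^ N * P y" using Pnear[OF Lvy] by simp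
          have Pyv: "P y \<le> 3 ^ N * P v" using Pnear[of y v 2] Lvy by (simp add: dist_commute)
          have "a * \<tau> m * (real L ^ k * P y) \<le> a * \<tau> m * (real L ^ k * (3 ^ N * P v))"
            using a \<tau>(1)[of m] Pyv by (intro mult_left_mono) auto
          also have "\<dots> = \<delta> / 8 * \<tau> m * (real L ^ k * P v)" by (simp add: a_def)
          also have "\<dots> \<le> norm (g y)"
            using gx_lower gyx norm_triangle_sub[of "g x" "g y"] by (simp add: norm_minus_commute)
          finally have 1: "a * \<tau> m * (real L ^ k * P y) \<le> norm (g y)" .
          have "norm (g y) \<le> (\<delta> / 8 + \<Lambda>) * \<tau> m * (real L ^ k * P v) + \<delta> / 8 * \<tau> m * (real L ^ k * P v)"
            using gx_upper gyx norm_triangle_sub[of "g y" "g x"] by simp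
          also have "\<dots> \<le> (\<delta> + \<Lambda>) * \<tau> m * (real L ^ k * P v)"
            unfolding distrib_right[symmetric] using \<delta> \<tau>(1)[of m] LP[of v]
            by (intro mult_right_mono) auto
          also have "\<dots> \<le> (\<delta> + \<Lambda>) * \<tau> m * (real L ^ k * (3 ^ N * P y))"
            using \<delta> \<Lambda> \<tau>(1)[of m] Pvy by (intro mult_left_mono) auto
          finally have 2: "norm (g y) \<le> b * \<tau> m * (real L ^ k * P y)" by (simp add: b_def mult_ac)
          show "y \<in> G m \<inter> ball v (2 * \<tau> m / real L)" using 1 2 yB[OF y] by (simp add: G_def)
        qed
        have "measure \<mu> (cap v (5 * (2 * \<tau> m / real L))) \<le> measure \<mu> (cap x (16 * (\<tau> m / real L)))"
        proof (rule finite_measure_mono)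
          show "cap v (5 * (2 * \<tau> m / real L)) \<subseteq> cap x (16 * (\<tau> m / real L))"
          proof
            fix z assume z: "z \<in> cap v (5 * (2 * \<tau> m / real L))"
            have "0 < \<tau> m / real L" using \<tau> L by simp
            then show "z \<in> cap x (16 * (\<tau> m / real L))"
              using z dist_triangle[of x z v] dvx by (simp add: dist_commute)
          qed
        qed simp
        also have "\<dots> \<le> D ^ (q + 4) * measure \<mu> B"
          unfolding B_def
        proof (rule cap_doubling_le[OF x1])
          show "0 < c * \<tau> m / real L" using c \<tau> L by simp
          show "16 * (\<tau> m / real L) \<le> 2 ^ (q + 4) * (c * \<tau> m / real L)"
            by (simp add: c_def power_add)
        qed
        finally have "measure (peetre_measure N L f) (cap v (5 * (2 * \<tau> m / real L)))
          \<le> (1 + 10) ^ N * (1 + 10) ^ N * D ^ (q + 4) * measure (peetre_measure N L f) (G m \<inter> ball v (2 * \<tau> m / real L))"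
          using BG Gset v1 D \<tau>[of m] L by (intro measure_peetre_measure_cap_le[OF f, where B = B]) (auto simp: B_def)
        then show "measure (peetre_measure N L f) (cap v (5 * (2 * \<tau> m / real L)))
          \<le> K * measure (peetre_measure N L f) (G m \<inter> ball v (2 * \<tau> m / real L))" by (simp add: K_def)
      qed
      \<comment> \<open>Disjointness of the shells turns \<open>k0\<close> separate bounds into a
        bound for \<open>k0\<close> times the mass of \<open>A\<close>.\<close>
      have "real k0 * measure (peetre_measure N L f) A = (\<Sum>m<k0. measure (peetre_measure N L f) A)" by simp
      also have "\<dots> \<le> (\<Sum>m<k0. K * measure (peetre_measure N L f) (G m))" using shell by (intro sum_mono) auto
      also have "\<dots> = K * measure (peetre_measure N L f) (\<Union>m<k0. G m)"
      proof -
        have "disjoint_family_on G {..<k0}"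
          unfolding disjoint_family_on_def using Gdisj by (metis inf_commute linorder_neqE_nat)
        then have "measure (peetre_measure N L f) (\<Union>m<k0. G m) = (\<Sum>m<k0. measure (peetre_measure N L f) (G m))"
          using Gset by (intro pm.finite_measure_finite_Union) auto
        then show ?thesis by (simp add: sum_distrib_left)
      qed
      also have "\<dots> \<le> K * measure (peetre_measure N L f) unit_sphere"
        using K pm.bounded_measure[of "\<Union>m<k0. G m"] by simp
      also have "\<dots> \<le> (\<eta> * real k0) * measure (peetre_measure N L f) unit_sphere"
        using k0 \<eta> by (intro mult_right_mono) (auto simp: field_simps)
      finally show ?thesis using k0pos by (simp add: mult_ac)
    qed
    then show "measure (peetre_measure N L f) (steep_set \<epsilon> \<delta> N L f k w i j)
      \<le> \<eta> * measure (peetre_measure N L f) unit_sphere"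
      by (simp only: A_def g_def P_def steep_set_def)
  qed
qed

text \<open>The normalisation \<open>L ^ length w * peetre\<close> is the size that Bernstein's
  inequality allows, so \<open>\<delta>\<close> is scale invariant.\<close>

definition large_jet :: "nat \<Rightarrow> real \<Rightarrow> nat \<Rightarrow> nat \<Rightarrow> (real^'n \<Rightarrow> complex) \<Rightarrow> (real^'n) set" where
  "large_jet k \<delta> N L f = {v \<in> unit_sphere. \<exists>w\<in>{w. length w \<le> k}.
     \<delta> * (real L ^ length w * peetre N L f v) \<le> norm (rders w f v)}"

definition small_value :: "real \<Rightarrow> nat \<Rightarrow> nat \<Rightarrow> (real^'n \<Rightarrow> complex) \<Rightarrow> (real^'n) set" where
  "small_value \<epsilon> N L f = {v \<in> unit_sphere. norm (f v) < \<epsilon> * peetre N L f v}"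

lemma finite_words_le: "finite {w :: ('n \<times> 'n) list. length w \<le> k}"
  using finite_lists_length_le[of "UNIV :: ('n \<times> 'n) set" k] by simp

lemma finite_words_eq: "finite {w :: ('n \<times> 'n) list. length w = k}"
  using finite_lists_length_eq[of "UNIV :: ('n \<times> 'n) set" k] by simp

lemma large_jet_sets: assumes f: "poly_fun L f" shows "large_jet k \<delta> N L f \<in> sets \<mu>"
proof -
  have [measurable]: "peetre N L f \<in> borel_measurable \<mu>" "(\<lambda>v. norm (rders w f v)) \<in> borel_measurable \<mu>" for w
    using peetre_measurable[OF f] norm_rders_measurable[OF f] by auto
  have "large_jet k \<delta> N L f = (\<Union>w\<in>{w. length w \<le> k}.
     {v \<in> space \<mu>. \<delta> * (real L ^ length w * peetre N L f v) \<le> norm (rders w f v)})"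
    by (auto simp: large_jet_def space_eq)
  then show ?thesis using finite_words_le by (auto intro!: sets.finite_UN)
qed

lemma small_value_sets: assumes f: "poly_fun L f" shows "small_value \<epsilon> N L f \<in> sets \<mu>"
proof -
  have [measurable]: "peetre N L f \<in> borel_measurable \<mu>" "(\<lambda>v. norm (f v)) \<in> borel_measurable \<mu>"
    using peetre_measurable[OF f] norm_rders_measurable[OF f, of "[]"] by auto
  have "small_value \<epsilon> N L f = {v \<in> space \<mu>. norm (f v) < \<epsilon> * peetre N L f v}"
    by (simp add: small_value_def space_eq)
  then show ?thesis by simp
qed

text \<open>Take a derivative of order \<open>k + 1\<close> that is large at \<open>v\<close>, and
  remove its outermost differentiation. Either the derivative of order \<open>k\<close> so obtained
  is still large, which the induction covers with a smaller threshold, or \<open>v\<close> lies in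
  one of finitely many steep sets.\<close>

lemma peetre_measure_small_value_large_jet:
  assumes n: "CARD('n) \<ge> 2" and \<delta>: "\<delta> > 0" and \<eta>: "\<eta> > 0"
  shows "\<exists>\<epsilon>>0. \<forall>L f. L \<ge> 1 \<longrightarrow> poly_fun L f \<longrightarrow>
    measure (peetre_measure N L f) (small_value \<epsilon> N L f \<inter> large_jet k \<delta> N L f) \<le> \<eta> * measure (peetre_measure N L f) unit_sphere"
  using \<delta> \<eta>
proof (induction k arbitrary: \<delta> \<eta>)
  case 0
  have "small_value \<delta> N L f \<inter> large_jet 0 \<delta> N L f = {}" for L and f :: "real^'n \<Rightarrow> complex"
    by (auto simp: small_value_def large_jet_def)
  \<comment> \<open>At order 0 the set is empty for \<open>\<epsilon> = \<delta>\<close>, as the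
    value would be both below and above the same threshold.\<close>
  then show ?case using 0 by (intro exI[of _ \<delta>]) auto
next
  case (Suc k)
  define I where "I = (UNIV :: ('n \<times> 'n) set) \<times> {w :: ('n \<times> 'n) list. length w = k}"
  have I: "finite I" by (simp add: I_def finite_words_eq)
  define c where "c = real (card I) + 1"
  have c: "c > 0" by (simp add: c_def)
  \<comment> \<open>The gradient bound is invoked first: its \<open>\<delta>'\<close> becomes part
    of the threshold for order \<open>k\<close>, from which the induction hypothesis then produces
    \<open>\<epsilon>\<close>. Each steep set gets an equal share of
    \<open>\<eta> / 2\<close>.\<close>
  obtain \<delta>' where \<delta>': "\<delta>' > 0" and grad: "\<And>L f w i j. L \<ge> 1 \<Longrightarrow> poly_fun L f \<Longrightarrow> length w = k \<Longrightarrow>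
    measure (peetre_measure N L f) (steep_set \<delta>' \<delta> N L f k w i j)
    \<le> (\<eta> / (2 * c)) * measure (peetre_measure N L f) unit_sphere"
    using peetre_measure_gradient_bound[OF n Suc.prems(1), of "\<eta> / (2 * c)" k N] Suc.prems c by auto
  obtain \<epsilon> where \<epsilon>: "\<epsilon> > 0" and IH: "\<And>L f. L \<ge> 1 \<Longrightarrow> poly_fun L f \<Longrightarrow>
    measure (peetre_measure N L f) (small_value \<epsilon> N L f \<inter> large_jet k (min \<delta> \<delta>') N L f) \<le> \<eta> / 2 * measure (peetre_measure N L f) unit_sphere"
    using Suc.IH[of "min \<delta> \<delta>'" "\<eta> / 2"] Suc.prems \<delta>' by auto
  show ?case
  proof (intro exI[of _ \<epsilon>] conjI allI impI \<epsilon>)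
    fix L :: nat and f :: "real^'n \<Rightarrow> complex" assume L: "L \<ge> 1" and f: "poly_fun L f"
    interpret pm: sphere_measure "peetre_measure N L f" by (rule sphere_measure_peetre[OF f])
    define P where "P = peetre N L f"
    have P0: "0 \<le> P v" for v unfolding P_def by (rule peetre_nonneg'[OF f])
    define G where "G = (\<lambda>(p, w). {v \<in> unit_sphere. norm (rders w f v) < \<delta>' * (real L ^ k * P v) \<and>
       \<delta> * (real L ^ Suc k * P v) \<le> norm (rder (fst p) (snd p) (rders w f) v)})"
    have Gset: "G z \<in> sets \<mu>" for z
    proof -
      obtain p w where z: "z = (p, w)" by (cases z)
      have [measurable]: "P \<in> borel_measurable \<mu>" "(\<lambda>v. norm (rders w f v)) \<in> borel_measurable \<mu>"
        "(\<lambda>v. norm (rder (fst p) (snd p) (rders w f) v)) \<in> borel_measurable \<mu>"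
        using peetre_measurable[OF f] norm_rders_measurable[OF f, of w] norm_rders_measurable[OF f, of "p # w"]
        by (auto simp: P_def)
      have "G z = {v \<in> space \<mu>. norm (rders w f v) < \<delta>' * (real L ^ k * P v) \<and>
       \<delta> * (real L ^ Suc k * P v) \<le> norm (rder (fst p) (snd p) (rders w f) v)}"
        by (simp add: G_def z space_eq)
      then show ?thesis by simp
    qed
    have sub: "small_value \<epsilon> N L f \<inter> large_jet (Suc k) \<delta> N L f
      \<subseteq> (small_value \<epsilon> N L f \<inter> large_jet k (min \<delta> \<delta>') N L f) \<union> (\<Union>z\<in>I. G z)"
    proof
      fix v assume v: "v \<in> small_value \<epsilon> N L f \<inter> large_jet (Suc k) \<delta> N L f"
      then have v1: "v \<in> unit_sphere" by (simp add: small_value_def)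
      obtain w where w: "length w \<le> Suc k" "\<delta> * (real L ^ length w * P v) \<le> norm (rders w f v)"
        using v by (auto simp: large_jet_def P_def)
      have LP: "0 \<le> real L ^ m * P v" for m using P0 by simp
      have jet: "v \<in> large_jet k (min \<delta> \<delta>') N L f"
        if "length w' \<le> k" "d * (real L ^ length w' * P v) \<le> norm (rders w' f v)" "min \<delta> \<delta>' \<le> d" for w' d
        using that v1 mult_right_mono[OF that(3) LP, of "length w'"] order.trans
        unfolding large_jet_def P_def by blast
      show "v \<in> (small_value \<epsilon> N L f \<inter> large_jet k (min \<delta> \<delta>') N L f) \<union> (\<Union>z\<in>I. G z)"
      proof (cases "length w \<le> k")
        case True
        then show ?thesis using jet[OF True w(2)] v by simp
      next
        case False
        then obtain p w' where pw: "w = p # w'" "length w' = k" using w(1) by (cases w) auto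
        show ?thesis
        proof (cases "norm (rders w' f v) < \<delta>' * (real L ^ k * P v)")
          case True
          then have "v \<in> G (p, w')" using w(2) v1 by (simp add: G_def pw)
          moreover have "(p, w') \<in> I" using pw by (simp add: I_def)
          ultimately show ?thesis by blast
        next
          case False
          then show ?thesis using jet[of w' \<delta>'] v pw by simp
        qed
      qed
    qed
    have "measure (peetre_measure N L f) (small_value \<epsilon> N L f \<inter> large_jet (Suc k) \<delta> N L f)
      \<le> measure (peetre_measure N L f) ((small_value \<epsilon> N L f \<inter> large_jet k (min \<delta> \<delta>') N L f) \<union> (\<Union>z\<in>I. G z))"
      using I Gset small_value_sets[OF f] large_jet_sets[OF f]
      by (intro pm.finite_measure_mono sub) auto
    also have "\<dots> \<le> measure (peetre_measure N L f) (small_value \<epsilon> N L f \<inter> large_jet k (min \<delta> \<delta>') N L f)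
        + measure (peetre_measure N L f) (\<Union>z\<in>I. G z)"
      using I Gset small_value_sets[OF f] large_jet_sets[OF f]
      by (intro measure_Un_le) auto
    also have "measure (peetre_measure N L f) (\<Union>z\<in>I. G z) \<le> (\<Sum>z\<in>I. measure (peetre_measure N L f) (G z))"
      using I Gset by (intro pm.finite_measure_subadditive_finite) auto
    also have "\<dots> \<le> (\<Sum>z\<in>I. (\<eta> / (2 * c)) * measure (peetre_measure N L f) unit_sphere)"
    proof (rule sum_mono)
      fix z assume "z \<in> I"
      then obtain p w where "z = (p, w)" "length w = k" by (auto simp: I_def)
      then show "measure (peetre_measure N L f) (G z) \<le> (\<eta> / (2 * c)) * measure (peetre_measure N L f) unit_sphere"
        using grad[OF L f, of w "fst p" "snd p"] by (simp add: G_def P_def steep_set_def)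
    qed
    also have "\<dots> \<le> \<eta> / 2 * measure (peetre_measure N L f) unit_sphere"
    proof -
      have "real (card I) * (\<eta> / (2 * c)) \<le> c * (\<eta> / (2 * c))"
        using Suc.prems c by (intro mult_right_mono) (auto simp: c_def)
      also have "\<dots> = \<eta> / 2" using c by simp
      finally have "real (card I) * (\<eta> / (2 * c)) * measure (peetre_measure N L f) unit_sphere \<le> \<eta> / 2 * measure (peetre_measure N L f) unit_sphere"
        by (rule mult_right_mono) simp
      then show ?thesis by (simp add: mult.assoc)
    qed
    finally show "measure (peetre_measure N L f) (small_value \<epsilon> N L f \<inter> large_jet (Suc k) \<delta> N L f) \<le> \<eta> * measure (peetre_measure N L f) unit_sphere"
      using IH[OF L f] by simp
  qed
qed

end

subsection \<open>Logvinenko-Sereda sets and density\<close>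

context sphere_measure
begin

lemma integrable_indicator_mult:
  fixes f :: "real^'n \<Rightarrow> real"
  assumes "continuous_on unit_sphere f" "A \<in> sets \<mu>"
  shows "integrable \<mu> (\<lambda>x. indicator A x * f x)"
  using integrable_mult_indicator[OF assms(2) integrable_continuous_on_sphere[OF assms(1)]] by simp

lemma nn_integral_indicator_mult:
  fixes f :: "real^'n \<Rightarrow> real"
  assumes "continuous_on unit_sphere f" "A \<in> sets \<mu>" "\<And>x. 0 \<le> f x"
  shows "(\<integral>\<^sup>+x. ennreal (f x) * indicator A x \<partial>\<mu>) = ennreal (\<integral>x. indicator A x * f x \<partial>\<mu>)"
proof -
  have "(\<integral>\<^sup>+x. ennreal (f x) * indicator A x \<partial>\<mu>) = (\<integral>\<^sup>+x. ennreal (indicator A x * f x) \<partial>\<mu>)"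
    by (intro nn_integral_cong) (auto simp: indicator_def)
  also have "\<dots> = ennreal (\<integral>x. indicator A x * f x \<partial>\<mu>)"
    using assms by (intro nn_integral_eq_integral integrable_indicator_mult) auto
  finally show ?thesis .
qed

end

context doubling_sphere_measure
begin

lemma exponent_exists:
  obtains N where "2 * D \<le> 2 ^ N" "N \<ge> 1"
proof -
  obtain N where N: "2 * D < 2 ^ N" using real_arch_pow[of 2 "2 * D"] by auto
  then have "N \<noteq> 0" using D by (intro notI) simp
  then show thesis using that[of N] N by simp
qed

lemma measure_peetre_measure_eq:
  assumes f: "poly_fun L f" and A: "A \<in> sets \<mu>"
  shows "measure (peetre_measure N L f) A = (\<integral>x. indicator A x * peetre N L f x \<partial>\<mu>)"
proof -
  have "emeasure (peetre_measure N L f) A = ennreal (\<integral>x. indicator A x * peetre N L f x \<partial>\<mu>)"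
    unfolding emeasure_peetre_measure[OF f A]
    by (intro nn_integral_indicator_mult A continuous_peetre[OF f] peetre_nonneg'[OF f])
  moreover have "0 \<le> (\<integral>x. indicator A x * peetre N L f x \<partial>\<mu>)"
    by (intro Bochner_Integration.integral_nonneg mult_nonneg_nonneg peetre_nonneg'[OF f]) simp
  ultimately show ?thesis by (simp add: measure_def)
qed

text \<open>If all derivatives at \<open>v\<close> up to high order are small then \<open>f\<close> is small near \<open>v\<close>, so the
  supremum defining the Peetre function is attained far away, where passing from the exponent
  \<open>N\<close> to \<open>2 * N\<close> gains a large factor.\<close>

lemma peetre_small_jet:
  assumes n: "CARD('n) \<ge> 2" and R: "R \<ge> 0"
  obtains m \<delta> where "\<delta> > 0" "\<And>L f v. L \<ge> 1 \<Longrightarrow> poly_fun L f \<Longrightarrow> norm v = 1 \<Longrightarrow> v \<notin> large_jet m \<delta> (2 * N) L f \<Longrightarrow>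
    (1 + R) ^ N * peetre (2 * N) L f v \<le> peetre N L f v"
proof -
  define x where "x = bern_const (2 * N) * (real CARD('n))\<^sup>2 * (2 * R)"
  define B where "B = (1 + 2 * R) ^ (2 * N)"
  have B: "B > 0" using R by (simp add: B_def)
  have "(\<lambda>m. inverse (fact m) * x ^ m) \<longlonglongrightarrow> 0" by (rule summable_LIMSEQ_zero[OF summable_exp])
  moreover have "0 < 1 / (4 * B)" using B by simp
  ultimately have "\<forall>\<^sub>F m in sequentially. inverse (fact m) * x ^ m < 1 / (4 * B)"
    by (rule order_tendstoD(2))
  then obtain m where m: "inverse (fact m) * x ^ m < 1 / (4 * B)"
    by (auto simp: eventually_sequentially)
  \<comment> \<open>\<open>m\<close> brings the Taylor remainder below a quarter of the Peetre
    function, and \<open>\<delta>\<close> does the same for the contribution of the derivatives at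
    \<open>v\<close>; the latter choice does not involve \<open>m\<close>.\<close>
  define \<delta> where "\<delta> = exp (- ((real CARD('n))\<^sup>2 * (2 * R))) / 4"
  have \<delta>: "\<delta> > 0" "\<delta> * exp ((real CARD('n))\<^sup>2 * (2 * R)) = 1 / 4"
    by (auto simp: \<delta>_def exp_minus)
  have Bm: "B * (x ^ m / fact m) \<le> 1 / 4"
  proof -
    have "B * (x ^ m / fact m) = B * (inverse (fact m) * x ^ m)"
      by (simp only: divide_real_def mult.commute[of "x ^ m"])
    also have "\<dots> \<le> B * (1 / (4 * B))" using m B by (intro mult_left_mono) auto
    also have "\<dots> = 1 / 4" using B by simp
    finally show ?thesis .
  qed
  show thesis
  proof (rule that[OF \<delta>(1)])
    fix L :: nat and f :: "real^'n \<Rightarrow> complex" and v :: "real^'n"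
    assume L: "L \<ge> 1" and f: "poly_fun L f" and v: "norm v = 1" and jet: "v \<notin> large_jet m \<delta> (2 * N) L f"
    let ?P = "peetre (2 * N) L f v" and ?P' = "peetre N L f v"
    note fc = poly_fun_continuous[OF f]
    have P0: "0 \<le> ?P" "0 \<le> ?P'" using peetre_nonneg'[OF f] by auto
    obtain y where y: "norm y = 1" "?P = norm (f y) / (1 + real L * dist v y) ^ (2 * N)"
      by (rule peetre_attained[OF fc, of "real L" "2 * N" v]) auto
    have pos: "0 < 1 + real L * dist v y" by (simp add: add_pos_nonneg)
    show "(1 + R) ^ N * ?P \<le> ?P'"
    proof (cases "real L * dist v y \<le> R")
      case True
      have "norm (rders w f v) \<le> \<delta> * real L ^ length w * ?P" if "length w < m" for w
      proof -
        have "\<not> \<delta> * (real L ^ length w * ?P) \<le> norm (rders w f v)"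
          using jet v that unfolding large_jet_def by force
        then show ?thesis by (simp add: mult.assoc)
      qed
      from taylor_bound[OF n f L v y(1) True _ this] \<delta>(1)
      have "norm (f y) \<le> (\<delta> * exp ((real CARD('n))\<^sup>2 * (2 * R)) + B * (x ^ m / fact m)) * ?P"
        by (simp add: B_def x_def)
      also have "\<dots> \<le> (1 / 4 + 1 / 4) * ?P"
        unfolding \<delta>(2) using Bm P0 by (intro mult_right_mono add_mono) auto
      finally have "norm (f y) \<le> ?P / 2" by simp
      \<comment> \<open>The weight at the maximum point \<open>y\<close> is at least 1. Against the
        bound by half of the same quantity, this leaves only the value 0, for which the claim is
        trivial.\<close>
      moreover have "?P \<le> norm (f y)"
        unfolding y(2) using one_le_power[of "1 + real L * dist v y" "2 * N"]
        by (simp add: divide_le_eq mult_left_le_one_le mult_le_cancel_left1 zero_less_power pos)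
      ultimately have "?P = 0" using P0 by linarith
      then show ?thesis using P0 by simp
    next
      case False
      \<comment> \<open>The weight with exponent \<open>2 * N\<close> is \<open>a * a\<close>. One
        factor \<open>a\<close> goes with \<open>norm (f y)\<close> into the Peetre function of
        exponent \<open>N\<close>; the other is the gain.\<close>
      define a where "a = (1 + real L * dist v y) ^ N"
      have a: "a > 0" using pos by (simp add: a_def)
      have "(1 + real L * dist v y) ^ (2 * N) = a * a" by (simp add: a_def mult_2 power_add)
      then have "?P = norm (f y) / (a * a)" using y(2) by simp
      then have "?P * (1 + real L * dist v y) ^ N = norm (f y) / (1 + real L * dist v y) ^ N"
        using a unfolding a_def[symmetric] by simp
      also have "\<dots> \<le> ?P'"
        using norm_le_peetre[OF fc _ y(1), of "real L" N v] pos by (simp add: divide_le_eq zero_less_power)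
      finally have "?P * (1 + real L * dist v y) ^ N \<le> ?P'" .
      moreover have "?P * (1 + R) ^ N \<le> ?P * (1 + real L * dist v y) ^ N"
        using False R P0 by (intro mult_left_mono power_mono) auto
      ultimately show ?thesis by (simp add: mult.commute)
    qed
  qed
qed

text \<open>Density of \<open>E\<close> passes to the weighted measure with constant
  \<open>K\<close>. Inside \<open>E L\<close>, the points where \<open>f\<close> is far below its
  Peetre function have at most \<open>1 / (2 * K)\<close> of the total weighted mass, so the rest of
  \<open>E L\<close> still carries a fixed share, and there \<open>\<epsilon>\<close> times the
  Peetre function is at most \<open>norm (f x)\<close>.\<close>

lemma density_imp_Logvinenko_Sereda:
  assumes n: "CARD('n) \<ge> 2" and E: "\<And>L. L \<ge> 1 \<Longrightarrow> E L \<in> sets \<mu>"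
    and r: "r > 0" and \<rho>: "\<rho> > 0"
    and dens: "\<And>L u. L \<ge> 1 \<Longrightarrow> norm u = 1 \<Longrightarrow>
      \<rho> * measure \<mu> (cap u (r / real L)) \<le> measure \<mu> (E L \<inter> cap u (r / real L))"
  shows "Logvinenko_Sereda \<mu> 1 E"
proof -
  obtain N where N: "2 * D \<le> 2 ^ N" "N \<ge> 1" by (rule exponent_exists)
  obtain C where C: "C > 0" and Cint: "\<And>L f. L \<ge> 1 \<Longrightarrow> poly_fun L f \<Longrightarrow>
    (\<integral>x. peetre N L f x \<partial>\<mu>) \<le> C * (\<integral>x. norm (f x) \<partial>\<mu>)"
    using peetre_integral_le[OF n N(1)] by blast
  \<comment> \<open>Three doublings cover the Vitali factor 5.\<close>
  define M where "M = D ^ 3 / \<rho>"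
  have M: "M > 0" using D \<rho> by (simp add: M_def)
  define K where "K = (1 + 5 * r) ^ (2 * N) * (1 + 5 * r) ^ (2 * N) * M"
  have K: "K > 0" unfolding K_def using r M by (intro mult_pos_pos) auto
  \<comment> \<open>Chosen so that \<open>(1 + R) ^ N\<close> beats \<open>4 * K * C\<close>, where
    \<open>C\<close> is the constant in the integral bound for the exponent
    \<open>N\<close>.\<close>
  define R where "R = 4 * K * C"
  have R: "R \<ge> 0" using K C by (simp add: R_def)
  obtain m \<delta> where \<delta>: "\<delta> > 0" and jet: "\<And>L f v. L \<ge> 1 \<Longrightarrow> poly_fun L f \<Longrightarrow> norm v = 1 \<Longrightarrow>
    v \<notin> large_jet m \<delta> (2 * N) L f \<Longrightarrow> (1 + R) ^ N * peetre (2 * N) L f v \<le> peetre N L f v"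
    by (rule peetre_small_jet[where N = N, OF n R]) (rule that)
  obtain \<epsilon> where \<epsilon>: "\<epsilon> > 0" and small: "\<And>L f. L \<ge> 1 \<Longrightarrow> poly_fun L f \<Longrightarrow>
    measure (peetre_measure (2 * N) L f) (small_value \<epsilon> (2 * N) L f \<inter> large_jet m \<delta> (2 * N) L f)
      \<le> 1 / (4 * K) * measure (peetre_measure (2 * N) L f) unit_sphere"
    using peetre_measure_small_value_large_jet[OF n \<delta>, of "1 / (4 * K)" "2 * N" m] K by auto
  have main: "(\<integral>x. norm (f x) \<partial>\<mu>) \<le> 2 * K / \<epsilon> * (\<integral>x. indicator (E L) x * norm (f x) \<partial>\<mu>)"
    if L: "L \<ge> 1" and f: "poly_fun L f" for L f
  proof -
    let ?\<nu> = "peetre_measure (2 * N) L f" and ?J = "large_jet m \<delta> (2 * N) L f" and ?V = "small_value \<epsilon> (2 * N) L f"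
    let ?P = "peetre (2 * N) L f"
    interpret pm: sphere_measure ?\<nu> by (rule sphere_measure_peetre[OF f])
    note fc = poly_fun_continuous[OF f]
    note EL = E[OF L]
    note sets = large_jet_sets[OF f, of m \<delta> "2 * N"] small_value_sets[OF f, of \<epsilon> "2 * N"] EL
    have S: "unit_sphere \<in> sets \<mu>" using sets.top[of \<mu>] by (simp add: space_eq)
    have tot: "measure ?\<nu> unit_sphere \<le> K * measure ?\<nu> (E L)"
    proof (rule pm.vitali_density_bound)
      fix v :: "real^'n" assume "v \<in> unit_sphere"
      then have v: "norm v = 1" by simp
      have "measure \<mu> (cap v (5 * (r / real L))) \<le> D ^ 3 * measure \<mu> (cap v (r / real L))"
        using r L by (intro cap_doubling_le[OF v]) (auto intro!: divide_right_mono)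
      also have "\<dots> \<le> M * measure \<mu> (E L \<inter> cap v (r / real L))"
        using mult_left_mono[OF dens[OF L v], of "D ^ 3 / \<rho>"] D \<rho> by (simp add: M_def)
      finally show "measure ?\<nu> (cap v (5 * (r / real L))) \<le> K * measure ?\<nu> (E L \<inter> ball v (r / real L))"
        unfolding K_def using r L M EL v
        by (intro measure_peetre_measure_cap_le[OF f, where B = "E L \<inter> cap v (r / real L)"]) auto
    qed (use S EL r L K in auto)
    \<comment> \<open>Off the large jets the Peetre function of exponent \<open>2 * N\<close> is
      smaller than that of exponent \<open>N\<close> by the gained factor. The latter integrates to
      at most \<open>C\<close> times the integral of \<open>norm (f x)\<close>, which the Peetre
      function of exponent \<open>2 * N\<close> dominates again.\<close>
    have far: "measure ?\<nu> (unit_sphere - ?J) \<le> 1 / (4 * K) * measure ?\<nu> unit_sphere"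
    proof -
      have RN: "4 * K * C \<le> (1 + R) ^ N"
      proof -
        have "4 * K * C \<le> (1 + R) ^ 1" by (simp add: R_def)
        also have "\<dots> \<le> (1 + R) ^ N" using R N by (intro power_increasing) auto
        finally show ?thesis .
      qed
      have "(4 * K * C) * measure ?\<nu> (unit_sphere - ?J) \<le> (1 + R) ^ N * measure ?\<nu> (unit_sphere - ?J)"
        using RN by (intro mult_right_mono) auto
      also have "\<dots> = (\<integral>x. (1 + R) ^ N * (indicator (unit_sphere - ?J) x * ?P x) \<partial>\<mu>)"
        using S sets by (subst measure_peetre_measure_eq[OF f]) auto
      also have "\<dots> \<le> (\<integral>x. peetre N L f x \<partial>\<mu>)"
      proof (rule integral_mono)
        show "integrable \<mu> (\<lambda>x. (1 + R) ^ N * (indicator (unit_sphere - ?J) x * ?P x))"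
          using S sets by (intro integrable_mult_right integrable_indicator_mult continuous_peetre[OF f]) auto
        show "integrable \<mu> (peetre N L f)"
          by (intro integrable_continuous_on_sphere continuous_peetre[OF f])
        fix x assume "x \<in> space \<mu>"
        then show "(1 + R) ^ N * (indicator (unit_sphere - ?J) x * ?P x) \<le> peetre N L f x"
          using jet[OF L f] peetre_nonneg'[OF f] by (auto simp: indicator_def space_eq)
      qed
      also have "\<dots> \<le> C * (\<integral>x. norm (f x) \<partial>\<mu>)" by (rule Cint[OF L f])
      also have "\<dots> \<le> C * measure ?\<nu> unit_sphere"
        unfolding measure_peetre_measure_sphere[OF f] using C
        by (intro mult_left_mono integral_mono integrable_continuous_on_sphere continuous_peetre[OF f]
            continuous_intros fc norm_le_peetre_same[OF fc]) (auto simp: space_eq)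
      finally have "C * ((4 * K) * measure ?\<nu> (unit_sphere - ?J)) \<le> C * measure ?\<nu> unit_sphere"
        by (simp add: mult_ac)
      then have "(4 * K) * measure ?\<nu> (unit_sphere - ?J) \<le> measure ?\<nu> unit_sphere"
        using C by (simp only: mult_le_cancel_left_pos)
      then show ?thesis using K by (simp add: field_simps)
    qed
    define G where "G = E L - ?V"
    have Gset: "G \<in> sets \<mu>" using sets by (auto simp: G_def)
    \<comment> \<open>The points of \<open>E L\<close> with a small value are split according to the
      jet; each of the two parts costs \<open>1 / (4 * K)\<close> of the total mass.\<close>
    have "measure ?\<nu> (E L) \<le> measure ?\<nu> (G \<union> ((?V \<inter> ?J) \<union> (unit_sphere - ?J)))"
      using EL sets Gset S by (intro pm.finite_measure_mono) (auto simp: G_def sets_iff)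
    also have "\<dots> \<le> measure ?\<nu> G + measure ?\<nu> ((?V \<inter> ?J) \<union> (unit_sphere - ?J))"
      using sets Gset S by (intro measure_Un_le) auto
    also have "measure ?\<nu> ((?V \<inter> ?J) \<union> (unit_sphere - ?J)) \<le> measure ?\<nu> (?V \<inter> ?J) + measure ?\<nu> (unit_sphere - ?J)"
      using sets S by (intro measure_Un_le) auto
    finally have "measure ?\<nu> (E L) \<le> measure ?\<nu> G + 1 / (2 * K) * measure ?\<nu> unit_sphere"
      using small[OF L f] far by (simp add: field_simps)
    from mult_left_mono[OF this, of K]
    have "K * measure ?\<nu> (E L) \<le> K * measure ?\<nu> G + measure ?\<nu> unit_sphere / 2"
      using K by (simp add: distrib_left)
    then have 1: "measure ?\<nu> unit_sphere \<le> 2 * K * measure ?\<nu> G" using tot by simp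
    have "\<epsilon> * measure ?\<nu> G = (\<integral>x. \<epsilon> * (indicator G x * ?P x) \<partial>\<mu>)"
      using Gset by (subst measure_peetre_measure_eq[OF f]) auto
    also have "\<dots> \<le> (\<integral>x. indicator (E L) x * norm (f x) \<partial>\<mu>)"
    proof (rule integral_mono)
      show "integrable \<mu> (\<lambda>x. \<epsilon> * (indicator G x * ?P x))"
        using Gset by (intro integrable_mult_right integrable_indicator_mult continuous_peetre[OF f])
      show "integrable \<mu> (\<lambda>x. indicator (E L) x * norm (f x))"
        using EL by (intro integrable_indicator_mult continuous_intros fc)
      fix x assume "x \<in> space \<mu>"
      then show "\<epsilon> * (indicator G x * ?P x) \<le> indicator (E L) x * norm (f x)"
        by (auto simp: indicator_def G_def small_value_def space_eq)
    qed
    finally have "2 * K / \<epsilon> * (\<epsilon> * measure ?\<nu> G) \<le> 2 * K / \<epsilon> * (\<integral>x. indicator (E L) x * norm (f x) \<partial>\<mu>)"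
      using K \<epsilon> by (intro mult_left_mono) auto
    then have 2: "2 * K * measure ?\<nu> G \<le> 2 * K / \<epsilon> * (\<integral>x. indicator (E L) x * norm (f x) \<partial>\<mu>)"
      using \<epsilon> by simp
    have "(\<integral>x. norm (f x) \<partial>\<mu>) \<le> measure ?\<nu> unit_sphere"
      unfolding measure_peetre_measure_sphere[OF f]
      by (intro integral_mono integrable_continuous_on_sphere continuous_peetre[OF f]
          continuous_intros fc norm_le_peetre_same[OF fc]) (auto simp: space_eq)
    then show ?thesis using 1 2 by linarith
  qed
  show ?thesis
    unfolding Logvinenko_Sereda_def
  proof (intro exI[of _ "2 * K / \<epsilon>"] conjI allI ballI impI)
    show "0 < 2 * K / \<epsilon>" using K \<epsilon> by simp
    fix L :: nat and Q :: "real^'n \<Rightarrow> complex" assume L: "1 \<le> L" and "Q \<in> spherical_harmonics L"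
    then obtain f where f: "poly_fun L f" "Q = sphere_restrict f" using spherical_harmonics_poly_fun by blast
    have Q: "norm (Q x) powr 1 = norm (f x)" if "x \<in> space \<mu>" for x
      using that by (simp add: f(2) sphere_restrict_def space_eq)
    have "(LINT u|\<mu>. norm (Q u) powr 1) = (\<integral>x. norm (f x) \<partial>\<mu>)"
      by (intro Bochner_Integration.integral_cong refl Q)
    moreover have "(LINT u:E L|\<mu>. norm (Q u) powr 1) = (\<integral>x. indicator (E L) x * norm (f x) \<partial>\<mu>)"
      unfolding set_lebesgue_integral_def by (intro Bochner_Integration.integral_cong refl) (simp only: Q real_scaleR_def)
    ultimately show "(LINT u|\<mu>. norm (Q u) powr 1) \<le> 2 * K / \<epsilon> * (LINT u:E L|\<mu>. norm (Q u) powr 1)"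
      using main[OF L f(1)] by simp
  qed
qed

text \<open>A single Fejer kernel decays only quadratically, so its \<open>M\<close>-th power is
  used, with the degree of the kernel reduced to about \<open>L / M\<close>. The peak then still has
  width of order \<open>1 / L\<close>, for fixed \<open>M\<close>.\<close>

lemma peak_polynomial:
  assumes M: "M \<ge> 1" and L: "L \<ge> 1" and u: "norm u = 1"
  obtains h where "continuous_on unit_sphere h" "\<And>v. norm v = 1 \<Longrightarrow> 0 \<le> h v" "\<And>v. norm v = 1 \<Longrightarrow> h v \<le> 1"
    "\<And>v. norm v = 1 \<Longrightarrow> real L * dist u v \<le> 1 / 4 \<Longrightarrow> (1 / 2) ^ M \<le> h v"
    "\<And>v. norm v = 1 \<Longrightarrow> v \<noteq> u \<Longrightarrow> h v \<le> (2 * real M) ^ (2 * M) * (1 / (real L * dist u v)) ^ (2 * M)"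
    "sphere_restrict (\<lambda>v. of_real (h v)) \<in> spherical_harmonics L"
proof -
  \<comment> \<open>The rounding serves both needs: \<open>(m - 1) * M \<le> L\<close> keeps the
    degree admissible, and \<open>L < m * M\<close> gives decay on the scale \<open>1 / L\<close>.
    For \<open>L < M\<close> the kernel is constant and the bounds remain true.\<close>
  define m where "m = L div M + 1"
  define p where "p = fejer_poly m ^ M"
  define h where "h v = poly p (u \<bullet> v)" for v
  have m: "m \<ge> 1" by (simp add: m_def)
  have mL: "real L \<le> real m * real M"
  proof -
    have "L < m * M" unfolding m_def using M dividend_less_div_times[of M L] by simp
    then show ?thesis by (simp flip: of_nat_mult)
  qed
  have m2L: "real m \<le> 2 * real L"
  proof -
    have "m \<le> L + 1" unfolding m_def by simp
    then show ?thesis using L by linarith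
  qed
  have "degree p \<le> (m - 1) * M"
    unfolding p_def using degree_power_le[of "fejer_poly m" M] degree_fejer_poly[of m]
    by (meson mult_le_mono1 order.trans)
  then have deg: "degree p \<le> L" by (simp add: m_def) (meson div_times_less_eq_dividend order.trans)
  have K: "0 \<le> poly (fejer_poly m) (u \<bullet> v)" "poly (fejer_poly m) (u \<bullet> v) \<le> 1" if "norm v = 1" for v
    using poly_fejer_nonneg[OF m] poly_fejer_le_1[OF m] abs_inner_unit_le[OF u that] by auto
  show thesis
  proof (rule that[of h])
    show "continuous_on unit_sphere h" unfolding h_def by (intro continuous_intros)
    show "0 \<le> h v" "h v \<le> 1" if "norm v = 1" for v
      using K[OF that] by (auto simp: h_def p_def power_le_one)
    show "sphere_restrict (\<lambda>v. of_real (h v)) \<in> spherical_harmonics L"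
      unfolding h_def by (rule zonal_poly_in_spherical_harmonics[OF u deg])
    show "(1 / 2) ^ M \<le> h v" if v: "norm v = 1" and near: "real L * dist u v \<le> 1 / 4" for v
    proof -
      have "(real m)\<^sup>2 * (1 - u \<bullet> v) = (real m * dist u v)\<^sup>2 / 2"
        using sq_dist_unit[OF u v] by (simp add: power_mult_distrib)
      also have "\<dots> \<le> (1 / 2)\<^sup>2 / 2"
      proof (intro divide_right_mono power_mono)
        \<comment> \<open>As \<open>m \<le> 2 * L\<close>, the distance \<open>1 / (4 * L)\<close>
          becomes at most \<open>1 / 2\<close> in units of \<open>1 / m\<close>, where the kernel
          exceeds \<open>1 / 2\<close>.\<close>
        have "real m * dist u v \<le> 2 * real L * dist u v" using m2L by (intro mult_right_mono) auto
        then show "real m * dist u v \<le> 1 / 2" using near by simp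
      qed auto
      finally have "1 / 2 \<le> poly (fejer_poly m) (u \<bullet> v)"
        using poly_fejer_lower[OF m abs_inner_unit_le[OF u v]] by (simp add: power2_eq_square)
      then show ?thesis unfolding h_def p_def poly_power by (intro power_mono) auto
    qed
    show "h v \<le> (2 * real M) ^ (2 * M) * (1 / (real L * dist u v)) ^ (2 * M)" if v: "norm v = 1" "v \<noteq> u" for v
    proof -
      have d: "dist u v > 0" using v by simp
      let ?k = "poly (fejer_poly m) (u \<bullet> v)"
      have "(dist u v)\<^sup>2 * (real m)\<^sup>2 * ?k = 2 * ((1 - u \<bullet> v) * (real m)\<^sup>2 * ?k)"
        by (simp only: sq_dist_unit[OF u v(1)] mult.assoc)
      then have "(dist u v)\<^sup>2 * (real m)\<^sup>2 * ?k \<le> 4"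
        using poly_fejer_decay[OF m abs_inner_unit_le[OF u v(1)]] by linarith
      moreover have "(real L * dist u v)\<^sup>2 * ?k \<le> (real M)\<^sup>2 * ((dist u v)\<^sup>2 * (real m)\<^sup>2 * ?k)"
      proof -
        have "(real L)\<^sup>2 \<le> (real m * real M)\<^sup>2" using mL by (intro power_mono) auto
        then have "(real L)\<^sup>2 * ((dist u v)\<^sup>2 * ?k) \<le> (real m * real M)\<^sup>2 * ((dist u v)\<^sup>2 * ?k)"
          using K[OF v(1)] by (intro mult_right_mono) auto
        then show ?thesis by (simp add: power_mult_distrib mult_ac)
      qed
      moreover have "(real M)\<^sup>2 * ((dist u v)\<^sup>2 * (real m)\<^sup>2 * ?k) \<le> (real M)\<^sup>2 * 4"
        using calculation(1) by (intro mult_left_mono) auto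
      ultimately have "(real L * dist u v)\<^sup>2 * ?k \<le> (2 * real M)\<^sup>2" by (simp add: power_mult_distrib)
      then have "?k \<le> (2 * real M * (1 / (real L * dist u v)))\<^sup>2"
        using d L by (simp add: power_mult_distrib power_divide pos_le_divide_eq mult.commute)
      then have "?k ^ M \<le> ((2 * real M * (1 / (real L * dist u v)))\<^sup>2) ^ M"
        using K[OF v(1)] by (intro power_mono) auto
      then show ?thesis unfolding h_def p_def poly_power by (simp only: power_mult power_mult_distrib)
    qed
  qed
qed

text \<open>Since \<open>0 \<le> h \<le> 1\<close> and \<open>p \<ge> 1\<close>, the power
  \<open>h powr p\<close> decays at least as fast as \<open>h\<close>; the exponent enters only the
  lower bound at the peak. Once the radius is large, the tail is at most half of the mass of the
  peak, and the other half must be found in \<open>E L\<close> near \<open>u\<close>.\<close>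

lemma Logvinenko_Sereda_imp_density:
  assumes LS: "Logvinenko_Sereda \<mu> p E" and p: "p \<ge> 1" and E: "\<And>L. L \<ge> 1 \<Longrightarrow> E L \<in> sets \<mu>"
  obtains r \<rho> where "r > 0" "\<rho> > 0" "\<And>L u. L \<ge> 1 \<Longrightarrow> norm u = 1 \<Longrightarrow>
      \<rho> * measure \<mu> (cap u (r / real L)) \<le> measure \<mu> (E L \<inter> cap u (r / real L))"
proof -
  obtain C where C: "C > 0" and LSC: "\<And>L Q. L \<ge> 1 \<Longrightarrow> Q \<in> spherical_harmonics L \<Longrightarrow>
       (LINT u|\<mu>. norm (Q u) powr p) \<le> C * (LINT u:E L|\<mu>. norm (Q u) powr p)"
    using LS unfolding Logvinenko_Sereda_def by blast
  obtain M where M: "2 * D \<le> 2 ^ M" "M \<ge> 1" by (rule exponent_exists)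
  have "(2::real) ^ M \<le> 2 ^ (2 * M)" by (intro power_increasing) auto
  with M(1) have M2: "2 * D \<le> 2 ^ (2 * M)" by linarith
  \<comment> \<open>The height of the peak, divided by two doublings from the radius
    \<open>1 / (4 * L)\<close> to \<open>1 / L\<close>.\<close>
  define c0 where "c0 = ((1 / 2) ^ M) powr p / D\<^sup>2"
  have c0: "c0 > 0" using D by (simp add: c0_def)
  define c1 where "c1 = (2 * real M) ^ (2 * M)"
  have c1: "c1 > 0" using M by (simp add: c1_def)
  \<comment> \<open>The tail carries a factor \<open>1 / 2 ^ s\<close>, so this \<open>s\<close>
    makes it at most \<open>c0 / 2 * b\<close> even after multiplication by
    \<open>C\<close>.\<close>
  obtain s where s: "2 * C * c1 * (2 * D) / c0 < 2 ^ s" using real_arch_pow[of 2] by auto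
  show thesis
  proof (rule that[of "2 ^ s" "c0 / (2 * C * D ^ s)"])
    show "(0::real) < 2 ^ s" "0 < c0 / (2 * C * D ^ s)" using c0 C D by auto
    fix L :: nat and u :: "real^'n" assume L: "L \<ge> 1" and u: "norm u = 1"
    obtain h where h: "continuous_on unit_sphere h" "\<And>v. norm v = 1 \<Longrightarrow> 0 \<le> h v" "\<And>v. norm v = 1 \<Longrightarrow> h v \<le> 1"
      "\<And>v. norm v = 1 \<Longrightarrow> real L * dist u v \<le> 1 / 4 \<Longrightarrow> (1 / 2) ^ M \<le> h v"
      "\<And>v. norm v = 1 \<Longrightarrow> v \<noteq> u \<Longrightarrow> h v \<le> c1 * (1 / (real L * dist u v)) ^ (2 * M)"
      "sphere_restrict (\<lambda>v. of_real (h v)) \<in> spherical_harmonics L"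
      using peak_polynomial[OF M(2) L u] unfolding c1_def by blast
    define g where "g v = h v powr p" for v
    have gc: "continuous_on unit_sphere g"
      unfolding g_def using h(1,2) p by (intro continuous_on_powr' continuous_intros) auto
    have g: "0 \<le> g v" "g v \<le> 1" "g v \<le> h v" if "norm v = 1" for v
    proof -
      show "0 \<le> g v" by (simp add: g_def)
      have "h v powr p \<le> h v powr 1" using h(2,3)[OF that] p by (intro powr_mono') auto
      then show "g v \<le> h v" using h(2)[OF that] by (simp add: g_def)
      then show "g v \<le> 1" using h(3)[OF that] by simp
    qed
    have Eset: "E L \<in> sets \<mu>" by (rule E[OF L])
    have gE: "integrable \<mu> (\<lambda>v. indicator (E L) v * g v)" by (rule integrable_indicator_mult[OF gc Eset])
    define b where "b = measure \<mu> (cap u (1 / real L))"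
    let ?B = "cap u (2 ^ s / real L)"
    have LSg: "(\<integral>v. g v \<partial>\<mu>) \<le> C * (\<integral>v. indicator (E L) v * g v \<partial>\<mu>)"
    proof -
      let ?Q = "sphere_restrict (\<lambda>v. complex_of_real (h v))"
      have Q: "norm (?Q v) powr p = g v" if "v \<in> space \<mu>" for v
        using that h(2)[of v] by (simp add: sphere_restrict_def space_eq g_def)
      have "(LINT u|\<mu>. norm (?Q u) powr p) = (\<integral>v. g v \<partial>\<mu>)"
        by (intro Bochner_Integration.integral_cong refl Q)
      moreover have "(LINT u:E L|\<mu>. norm (?Q u) powr p) = (\<integral>v. indicator (E L) v * g v \<partial>\<mu>)"
        unfolding set_lebesgue_integral_def by (intro Bochner_Integration.integral_cong refl) (simp only: Q real_scaleR_def)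
      ultimately show ?thesis using LSC[OF L h(6)] by simp
    qed
    have lower: "c0 * b \<le> (\<integral>v. g v \<partial>\<mu>)"
    proof -
      have "b \<le> D\<^sup>2 * measure \<mu> (cap u (1 / (4 * real L)))"
        unfolding b_def using L by (intro cap_doubling_le[OF u]) auto
      then have "c0 * b \<le> c0 * (D\<^sup>2 * measure \<mu> (cap u (1 / (4 * real L))))" using c0 by (intro mult_left_mono) auto
      also have "\<dots> = (\<integral>v. ((1 / 2) ^ M) powr p * indicator (cap u (1 / (4 * real L))) v \<partial>\<mu>)"
        using D by (simp add: c0_def)
      also have "\<dots> \<le> (\<integral>v. g v \<partial>\<mu>)"
      proof (rule integral_mono)
        fix v assume "v \<in> space \<mu>"
        then have v: "norm v = 1" by (simp add: space_eq)
        show "((1 / 2) ^ M) powr p * indicator (cap u (1 / (4 * real L))) v \<le> g v"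
        proof (cases "v \<in> cap u (1 / (4 * real L))")
          case True
          then have "real L * dist u v \<le> 1 / 4" using L by (simp add: field_simps)
          then have "((1 / 2) ^ M) powr p \<le> g v"
            unfolding g_def using h(4)[OF v] p by (intro powr_mono2) auto
          then show ?thesis using True by simp
        qed (use g(1)[OF v] in simp)
      qed (auto intro!: integrable_continuous_on_sphere gc integrable_real_indicator simp: emeasure_eq_measure)
      finally show ?thesis .
    qed
    have upper: "(\<integral>v. indicator (E L) v * g v \<partial>\<mu>) \<le> measure \<mu> (E L \<inter> ?B) + c1 * (2 * D / 2 ^ s * b)"
    proof -
      have "ennreal (\<integral>v. indicator (E L) v * g v \<partial>\<mu>) = (\<integral>\<^sup>+v. ennreal (indicator (E L) v * g v) \<partial>\<mu>)"
        using g by (intro nn_integral_eq_integral[symmetric] gE) (auto simp: space_eq)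
      also have "\<dots> \<le> (\<integral>\<^sup>+v. indicator (E L \<inter> ?B) v +
          ennreal c1 * (ennreal ((1 / (real L * dist u v)) ^ (2 * M)) * indicator {v. 2 ^ s \<le> real L * dist u v} v) \<partial>\<mu>)"
      proof (rule nn_integral_mono)
        fix v assume "v \<in> space \<mu>"
        then have v: "norm v = 1" by (simp add: space_eq)
        show "ennreal (indicator (E L) v * g v) \<le> indicator (E L \<inter> ?B) v +
          ennreal c1 * (ennreal ((1 / (real L * dist u v)) ^ (2 * M)) * indicator {v. 2 ^ s \<le> real L * dist u v} v)"
        proof (cases "2 ^ s \<le> real L * dist u v")
          case True
          have "0 < real L * dist u v" by (rule order.strict_trans2[OF _ True]) simp
          then have "v \<noteq> u" by auto
          have "indicator (E L) v * g v \<le> 1 * g v" using g(1)[OF v] by (intro mult_right_mono) (auto simp: indicator_def)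
          also have "\<dots> \<le> c1 * (1 / (real L * dist u v)) ^ (2 * M)"
            using g(3)[OF v] h(5)[OF v \<open>v \<noteq> u\<close>] by simp
          finally have "ennreal (indicator (E L) v * g v) \<le> ennreal c1 * ennreal ((1 / (real L * dist u v)) ^ (2 * M))"
            using c1 by (subst ennreal_mult'[symmetric]) (auto intro: ennreal_leI)
          then show ?thesis using True by (auto intro!: add_increasing)
        next
          case False
          then have "v \<in> ?B" using v L by (simp add: field_simps not_le)
          then have "ennreal (indicator (E L) v * g v) \<le> indicator (E L \<inter> ?B) v"
            using g(2)[OF v] by (simp add: indicator_def ennreal_le_1)
          then show ?thesis by (simp add: add_increasing2)
        qed
      qed
      also have "\<dots> = emeasure \<mu> (E L \<inter> ?B) + ennreal c1 *
          (\<integral>\<^sup>+v. ennreal ((1 / (real L * dist u v)) ^ (2 * M)) * indicator {v. 2 ^ s \<le> real L * dist u v} v \<partial>\<mu>)"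
        using Eset by (subst nn_integral_add) (auto simp: nn_integral_cmult)
      also have "\<dots> \<le> ennreal (measure \<mu> (E L \<inter> ?B)) + ennreal c1 * ennreal (2 * D / 2 ^ s * b)"
        unfolding emeasure_eq_measure b_def using L u
        by (intro add_mono mult_left_mono nn_integral_tail_le M2) auto
      also have "\<dots> = ennreal (measure \<mu> (E L \<inter> ?B) + c1 * (2 * D / 2 ^ s * b))"
        using c1 D by (simp add: ennreal_mult'[symmetric] ennreal_plus[symmetric] b_def del: ennreal_plus)
      finally show ?thesis using c1 D by (subst (asm) ennreal_le_iff) (auto simp: b_def)
    qed
    have b0: "b \<ge> 0" by (simp add: b_def)
    have "C * (c1 * (2 * D / 2 ^ s * b)) \<le> c0 / 2 * b"
    proof -
      have "C * c1 * (2 * D) / 2 ^ s \<le> c0 / 2" using s c0 by (simp add: field_simps)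
      from mult_right_mono[OF this b0] show ?thesis by (simp add: mult_ac)
    qed
    moreover have "c0 * b \<le> C * measure \<mu> (E L \<inter> ?B) + C * (c1 * (2 * D / 2 ^ s * b))"
      using lower LSg mult_left_mono[OF upper, of C] C by (simp add: distrib_left)
    ultimately have 1: "c0 / 2 * b \<le> C * measure \<mu> (E L \<inter> ?B)" by simp
    have "measure \<mu> ?B \<le> D ^ s * b"
      unfolding b_def using L by (intro cap_doubling_le[OF u]) auto
    then have "c0 / (2 * C * D ^ s) * measure \<mu> ?B \<le> c0 / (2 * C * D ^ s) * (D ^ s * b)"
      using c0 C D by (intro mult_left_mono) auto
    also have "\<dots> = (c0 / 2 * b) / C" using D C by (simp add: field_simps)
    also have "\<dots> \<le> measure \<mu> (E L \<inter> ?B)" using 1 C by (simp add: divide_le_eq mult.commute)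
    finally show "c0 / (2 * C * D ^ s) * measure \<mu> ?B \<le> measure \<mu> (E L \<inter> ?B)" .
  qed
qed

end

theorem theorem1p5:
  fixes d :: nat
    and \<mu> :: "(real^'n) measure"
    and E :: "nat \<Rightarrow> (real^'n) set"
  assumes "d \<ge> 1"
    and "CARD('n) = d + 1"
    and "doubling_measure \<mu>"
    and "\<And>L. L \<ge> 1 \<Longrightarrow> E L \<in> sets \<mu>"
  shows "(\<exists>p::real\<ge>1. Logvinenko_Sereda \<mu> p E) \<longleftrightarrow> relatively_dense \<mu> E"
proof -
  have n: "CARD('n) \<ge> 2" using assms(1,2) by simp
  obtain D where loc: "doubling_sphere_measure \<mu> D"
    and gdbl: "\<And>u s. norm u = 1 \<Longrightarrow> s > 0 \<Longrightarrow> measure \<mu> (geodesic_ball u (2 * s)) \<le> D * measure \<mu> (geodesic_ball u s)"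
    and gsets: "\<And>u s. norm u = 1 \<Longrightarrow> geodesic_ball u s \<in> sets \<mu>"
    using doubling_measure_imp_locale[OF assms(3)] by blast
  interpret doubling_sphere_measure \<mu> D by (rule loc)
  have gpos: "measure \<mu> (geodesic_ball u s) > 0" if "norm u = 1" "s > 0" for u s
  proof -
    have "measure \<mu> (cap u (s / 2)) \<le> measure \<mu> (geodesic_ball u s)"
      using cap_subset_geodesic_ball[OF that(1), of "s / 2"] gsets[OF that(1)] by (intro finite_measure_mono) auto
    then show ?thesis using cap_pos[of u "s / 2"] that by simp
  qed
  show ?thesis
  proof
    assume "\<exists>p::real\<ge>1. Logvinenko_Sereda \<mu> p E"
    then obtain p where p: "p \<ge> 1" and LS: "Logvinenko_Sereda \<mu> p E" by blast
    obtain r \<rho> where r: "r > 0" and \<rho>: "\<rho> > 0" and dens: "\<And>L u. L \<ge> 1 \<Longrightarrow> norm u = 1 \<Longrightarrow>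
      \<rho> * measure \<mu> (cap u (r / real L)) \<le> measure \<mu> (E L \<inter> cap u (r / real L))"
      using Logvinenko_Sereda_imp_density[OF LS p assms(4)] by blast
    show "relatively_dense \<mu> E"
      unfolding relatively_dense_def
    \<comment> \<open>A cap of radius \<open>r / L\<close> lies in the geodesic ball of twice that
      radius. The mass of this ball is at most \<open>D\<close> times that of the ball of radius
      \<open>r / L\<close>, which the cap contains; hence the division of \<open>\<rho>\<close> by
      \<open>D\<close>.\<close>
    proof (rule exI[of _ "2 * r"], intro conjI exI[of _ "\<rho> / D"] allI impI)
      fix L :: nat assume L: "1 \<le> L"
      show "\<rho> / D \<le> (INF u\<in>unit_sphere. measure \<mu> (E L \<inter> geodesic_ball u (2 * r / real L))
                             / measure \<mu> (geodesic_ball u (2 * r / real L)))"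
      proof (rule cINF_greatest)
        fix u :: "real^'n" assume "u \<in> unit_sphere"
        then have u: "norm u = 1" by simp
        have rL: "r / real L > 0" using r L by simp
        have "\<rho> / D * measure \<mu> (geodesic_ball u (2 * (r / real L))) \<le> \<rho> / D * (D * measure \<mu> (geodesic_ball u (r / real L)))"
          using \<rho> D by (intro mult_left_mono gdbl u rL) auto
        also have "\<dots> = \<rho> * measure \<mu> (geodesic_ball u (r / real L))" using D by simp
        also have "\<dots> \<le> \<rho> * measure \<mu> (cap u (r / real L))"
          using \<rho> by (intro mult_left_mono finite_measure_mono geodesic_ball_subset_cap u) auto
        also have "\<dots> \<le> measure \<mu> (E L \<inter> cap u (r / real L))" by (rule dens[OF L u])
        also have "\<dots> \<le> measure \<mu> (E L \<inter> geodesic_ball u (2 * (r / real L)))"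
          using gsets[OF u] assms(4)[OF L]
          by (intro finite_measure_mono Int_mono order.refl cap_subset_geodesic_ball u sets.Int)
        finally show "\<rho> / D \<le> measure \<mu> (E L \<inter> geodesic_ball u (2 * r / real L)) / measure \<mu> (geodesic_ball u (2 * r / real L))"
          using gpos[OF u, of "2 * r / real L"] r L by (simp add: pos_le_divide_eq)
      qed simp
    qed (use r \<rho> D in auto)
  next
    assume "relatively_dense \<mu> E"
    then obtain r \<rho> where r: "r > 0" and \<rho>: "\<rho> > 0" and INF: "\<And>L. L \<ge> 1 \<Longrightarrow>
       \<rho> \<le> (INF u\<in>unit_sphere. measure \<mu> (E L \<inter> geodesic_ball u (r / real L))
                             / measure \<mu> (geodesic_ball u (r / real L)))"
      unfolding relatively_dense_def by auto
    have "Logvinenko_Sereda \<mu> 1 E"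
    proof (rule density_imp_Logvinenko_Sereda[OF n assms(4) r])
      show "\<rho> / D > 0" using \<rho> D by simp
      fix L :: nat and u :: "real^'n" assume L: "L \<ge> 1" and u: "norm u = 1"
      have rL: "r / real L > 0" using r L by simp
      \<comment> \<open>The infimum is below each ratio because the ratios are bounded below by 0;
        for real numbers this boundedness has to be supplied.\<close>
      have "(INF u\<in>unit_sphere. measure \<mu> (E L \<inter> geodesic_ball u (r / real L)) / measure \<mu> (geodesic_ball u (r / real L)))
        \<le> measure \<mu> (E L \<inter> geodesic_ball u (r / real L)) / measure \<mu> (geodesic_ball u (r / real L))"
        using u by (intro cINF_lower bdd_belowI2[where m = 0]) auto
      with INF[OF L] have "\<rho> \<le> measure \<mu> (E L \<inter> geodesic_ball u (r / real L)) / measure \<mu> (geodesic_ball u (r / real L))"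
        by simp
      then have "\<rho> * measure \<mu> (geodesic_ball u (r / real L)) \<le> measure \<mu> (E L \<inter> geodesic_ball u (r / real L))"
        using gpos[OF u rL] by (simp add: pos_le_divide_eq)
      also have "\<dots> \<le> measure \<mu> (E L \<inter> cap u (r / real L))"
        using geodesic_ball_subset_cap[OF u] assms(4)[OF L] by (intro finite_measure_mono) auto
      finally have 1: "\<rho> * measure \<mu> (geodesic_ball u (r / real L)) \<le> measure \<mu> (E L \<inter> cap u (r / real L))" .
      \<comment> \<open>In this direction the radius is kept: the geodesic ball sits inside the cap,
        and one doubling of the ball covers the cap.\<close>
      have "measure \<mu> (cap u (r / real L)) \<le> measure \<mu> (geodesic_ball u (2 * (r / real L)))"
        by (intro finite_measure_mono cap_subset_geodesic_ball gsets u)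
      also have "\<dots> \<le> D * measure \<mu> (geodesic_ball u (r / real L))" by (rule gdbl[OF u rL])
      finally have "\<rho> / D * measure \<mu> (cap u (r / real L)) \<le> \<rho> / D * (D * measure \<mu> (geodesic_ball u (r / real L)))"
        using \<rho> D by (intro mult_left_mono) auto
      then show "\<rho> / D * measure \<mu> (cap u (r / real L)) \<le> measure \<mu> (E L \<inter> cap u (r / real L))"
        using 1 D by simp
    qed
    then show "\<exists>p::real\<ge>1. Logvinenko_Sereda \<mu> p E" by (intro exI[of _ 1]) simp
  qed
qed

end
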